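(* The inclusion $2$-functor $[\mathbf F,\mathbf{Set}]\text{-}\mathbf{CAT}_{\mathrm{rep}}\to[\mathbf F,\mathbf{Set}]\text{-}\mathbf{CAT}$ admits a left biadjoint $L$.
   Context: $\mathbf F$ is the full subcategory of $\mathbf{Set}$ on the finite cardinals; $[\mathbf F,\mathbf{Set}]$ is monoidal with unit the inclusion $\mathbf F\to\mathbf{Set}$ and tensor $(A\otimes B)(n)=\int^{m\in\mathbf F}Am\times(Bn)^m$. Categories enriched in it unfold as follows. An $[\mathbf F,\mathbf{Set}]$-category $\mathcal M$ consists of: a (possibly large) collection of objects; sets $\mathcal M_n(X,Y)$ for objects $X,Y$ and $n\in\mathbf F$, functorial in $n$ via maps $\phi_\ast\colon\mathcal M_n(X,Y)\to\mathcal M_m(X,Y)$ for $\phi\colon n\to m$; identities $1_X\in\mathcal M_1(X,X)$; and composition operations $\mathcal M_m(Y,Z)\times\mathcal M_n(X,Y)^m\to\mathcal M_n(X,Z)$, $(g,f_1,\dots,f_m)\mapsto g\circ(f_1,\dots,f_m)$, natural in $n$ and $m$. Writing $\pi_1,\dots,\pi_n\in\mathcal M_n(X,X)$ for the images of $1_X$ under the $n$ maps $1\to n$, the axioms are $\pi_i\circ(f_1,\dots,f_n)=f_i$; $g\circ(\pi_1,\dots,\pi_n)=g$; and $h\circ(g_1\circ(f_1,\dots,f_k),\dots,g_j\circ(f_1,\dots,f_k))=(h\circ(g_1,\dots,g_j))\circ(f_1,\dots,f_k)$. An $[\mathbf F,\mathbf{Set}]$-functor $F\colon\mathcal M\to\mathcal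 N$ is an assignment on objects with maps $\mathcal M_n(X,Y)\to\mathcal N_n(FX,FY)$ natural in $n$ and preserving composition and identities. A transformation $\alpha\colon F\Rightarrow G$ consists of $\alpha_X\in\mathcal N_1(FX,GX)$ with $\alpha_Y\circ Ff=Gf\circ(\alpha_X\circ\pi_1,\dots,\alpha_X\circ\pi_n)$ for all $f\in\mathcal M_n(X,Y)$. These form a $2$-category $[\mathbf F,\mathbf{Set}]\text{-}\mathbf{CAT}$. Let $y_n=\mathbf F(n,-)$. An element $i\in\mathcal M_n(X,Z)$ exhibits $Z$ as the tensor $y_n\otimes X$ if for all $Y\in\mathcal M$ and $k\in\mathbf F$ the function $\mathcal M_k(Z,Y)\to\mathcal M_{kn}(X,Y)$, $g\mapsto g\circ((\iota_1)_\ast i,\dots,(\iota_k)_\ast i)$, is invertible, where $\iota_j\colon n\to kn=n+\dots+n$ are the coproduct injections. $\mathcal M$ is representable if $y_n\otimes X$ exists for all $X\in\mathcal M$ and $n\in\mathbf F$, and $[\mathbf F,\mathbf{Set}]\text{-}\mathbf{CAT}_{\mathrm{rep}}$ is the full sub-$2$-category of $[\mathbf F,\mathbf{Set}]\text{-}\mathbf{CAT}$ on the representable objects. *)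

theory Defs
  imports "HOL-Library.FuncSet"
begin

section \<open>Categories, functors and equivalences\<close>

record ('x, 'm) cat =
  Ob :: "'x set"
  Ar :: "'x \<Rightarrow> 'x \<Rightarrow> 'm set"
  Idn :: "'x \<Rightarrow> 'm"
  Cmp :: "'m \<Rightarrow> 'm \<Rightarrow> 'm"

locale is_category =
  fixes X :: "('x, 'm) cat"
  assumes Idn_in: "x \<in> Ob X \<Longrightarrow> Idn X x \<in> Ar X x x"
    and Cmp_in: "\<lbrakk>x \<in> Ob X; y \<in> Ob X; z \<in> Ob X; f \<in> Ar X x y; g \<in> Ar X y z\<rbrakk>
      \<Longrightarrow> Cmp X g f \<in> Ar X x z"
    and Cmp_Idn: "\<lbrakk>x \<in> Ob X; y \<in> Ob X; f \<in> Ar X x y\<rbrakk> \<Longrightarrow> Cmp X f (Idn X x) = f"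
    and Idn_Cmp: "\<lbrakk>x \<in> Ob X; y \<in> Ob X; f \<in> Ar X x y\<rbrakk> \<Longrightarrow> Cmp X (Idn X y) f = f"
    and Cmp_assoc: "\<lbrakk>w \<in> Ob X; x \<in> Ob X; y \<in> Ob X; z \<in> Ob X;
        f \<in> Ar X w x; g \<in> Ar X x y; h \<in> Ar X y z\<rbrakk>
      \<Longrightarrow> Cmp X (Cmp X h g) f = Cmp X h (Cmp X g f)"

definition is_iso :: "('x, 'm) cat \<Rightarrow> 'x \<Rightarrow> 'x \<Rightarrow> 'm \<Rightarrow> bool" where
  "is_iso X x y f \<longleftrightarrow> f \<in> Ar X x y \<and>
     (\<exists>g \<in> Ar X y x. Cmp X g f = Idn X x \<and> Cmp X f g = Idn X y)"

locale is_functor =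
  fixes X :: "('x, 'm) cat" and Y :: "('y, 'n) cat"
    and F0 :: "'x \<Rightarrow> 'y" and F1 :: "'m \<Rightarrow> 'n"
  assumes F0_in: "x \<in> Ob X \<Longrightarrow> F0 x \<in> Ob Y"
    and F1_in: "\<lbrakk>x \<in> Ob X; y \<in> Ob X; f \<in> Ar X x y\<rbrakk> \<Longrightarrow> F1 f \<in> Ar Y (F0 x) (F0 y)"
    and F1_Idn: "x \<in> Ob X \<Longrightarrow> F1 (Idn X x) = Idn Y (F0 x)"
    and F1_Cmp: "\<lbrakk>x \<in> Ob X; y \<in> Ob X; z \<in> Ob X; f \<in> Ar X x y; g \<in> Ar X y z\<rbrakk>
      \<Longrightarrow> F1 (Cmp X g f) = Cmp Y (F1 g) (F1 f)"

locale is_nat_iso =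
  fixes X :: "('x, 'm) cat" and Y :: "('y, 'n) cat"
    and F0 :: "'x \<Rightarrow> 'y" and F1 :: "'m \<Rightarrow> 'n"
    and G0 :: "'x \<Rightarrow> 'y" and G1 :: "'m \<Rightarrow> 'n"
    and \<alpha> :: "'x \<Rightarrow> 'n"
  assumes iso: "x \<in> Ob X \<Longrightarrow> is_iso Y (F0 x) (G0 x) (\<alpha> x)"
    and natural: "\<lbrakk>x \<in> Ob X; y \<in> Ob X; f \<in> Ar X x y\<rbrakk>
      \<Longrightarrow> Cmp Y (\<alpha> y) (F1 f) = Cmp Y (G1 f) (\<alpha> x)"

definition is_equivalence ::
  "('x, 'm) cat \<Rightarrow> ('y, 'n) cat \<Rightarrow> ('x \<Rightarrow> 'y) \<Rightarrow> ('m \<Rightarrow> 'n) \<Rightarrow> bool" where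
  "is_equivalence X Y F0 F1 \<longleftrightarrow> is_functor X Y F0 F1 \<and>
     (\<exists>G0 G1 \<eta> \<epsilon>. is_functor Y X G0 G1
        \<and> is_nat_iso X X (\<lambda>x. x) (\<lambda>f. f) (\<lambda>x. G0 (F0 x)) (\<lambda>f. G1 (F1 f)) \<eta>
        \<and> is_nat_iso Y Y (\<lambda>y. F0 (G0 y)) (\<lambda>g. F1 (G1 g)) (\<lambda>y. y) (\<lambda>g. g) \<epsilon>)"


section \<open>2-categories, pseudofunctors and biadjunctions\<close>

text \<open>All compositions are written in function order: \<open>g \<odot> f\<close> is first \<open>f\<close>, then \<open>g\<close>.\<close>

record ('o, 'f, 't) two_cat =
  Cell0 :: "'o set"
  Cell1 :: "'f set"
  Cell2 :: "'t set"
  Dom1 :: "'f \<Rightarrow> 'o"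
  Cod1 :: "'f \<Rightarrow> 'o"
  Dom2 :: "'t \<Rightarrow> 'f"
  Cod2 :: "'t \<Rightarrow> 'f"
  Id1 :: "'o \<Rightarrow> 'f"
  Comp1 :: "'f \<Rightarrow> 'f \<Rightarrow> 'f" (infixr \<open>\<odot>\<index>\<close> 75)
  Id2 :: "'f \<Rightarrow> 't"
  VComp :: "'t \<Rightarrow> 't \<Rightarrow> 't" (infixr \<open>\<cdot>\<index>\<close> 65)
  HComp :: "'t \<Rightarrow> 't \<Rightarrow> 't" (infixr \<open>\<star>\<index>\<close> 70)

definition hom1 :: "('o, 'f, 't) two_cat \<Rightarrow> 'o \<Rightarrow> 'o \<Rightarrow> 'f set" where
  "hom1 C A B = {f \<in> Cell1 C. Dom1 C f = A \<and> Cod1 C f = B}"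

definition hom2 :: "('o, 'f, 't) two_cat \<Rightarrow> 'f \<Rightarrow> 'f \<Rightarrow> 't set" where
  "hom2 C f g = {s \<in> Cell2 C. Dom2 C s = f \<and> Cod2 C s = g}"

definition hom_cat :: "('o, 'f, 't) two_cat \<Rightarrow> 'o \<Rightarrow> 'o \<Rightarrow> ('f, 't) cat" where
  "hom_cat C A B = \<lparr>Ob = hom1 C A B, Ar = hom2 C, Idn = Id2 C, Cmp = VComp C\<rparr>"

definition iso2 :: "('o, 'f, 't) two_cat \<Rightarrow> 'f \<Rightarrow> 'f \<Rightarrow> 't \<Rightarrow> bool" where
  "iso2 C f g s \<longleftrightarrow> s \<in> hom2 C f g \<and>
     (\<exists>t \<in> hom2 C g f. VComp C t s = Id2 C f \<and> VComp C s t = Id2 C g)"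

locale is_two_category =
  fixes C :: "('o, 'f, 't) two_cat" (structure)
  assumes Dom1_in: "f \<in> Cell1 C \<Longrightarrow> Dom1 C f \<in> Cell0 C"
    and Cod1_in: "f \<in> Cell1 C \<Longrightarrow> Cod1 C f \<in> Cell0 C"
    and Dom2_in: "s \<in> Cell2 C \<Longrightarrow> Dom2 C s \<in> Cell1 C"
    and Cod2_in: "s \<in> Cell2 C \<Longrightarrow> Cod2 C s \<in> Cell1 C"
    and parallel: "s \<in> Cell2 C \<Longrightarrow>
      Dom1 C (Dom2 C s) = Dom1 C (Cod2 C s) \<and> Cod1 C (Dom2 C s) = Cod1 C (Cod2 C s)"
    and hom_category: "\<lbrakk>A \<in> Cell0 C; B \<in> Cell0 C\<rbrakk> \<Longrightarrow> is_category (hom_cat C A B)"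
    and Id1_in: "A \<in> Cell0 C \<Longrightarrow> Id1 C A \<in> hom1 C A A"
    and Comp1_in: "\<lbrakk>f \<in> hom1 C A B; g \<in> hom1 C B D\<rbrakk> \<Longrightarrow> g \<odot> f \<in> hom1 C A D"
    and Comp1_Id1: "f \<in> hom1 C A B \<Longrightarrow> f \<odot> Id1 C A = f"
    and Id1_Comp1: "f \<in> hom1 C A B \<Longrightarrow> Id1 C B \<odot> f = f"
    and Comp1_assoc: "\<lbrakk>f \<in> hom1 C A B; g \<in> hom1 C B D; h \<in> hom1 C D E\<rbrakk>
      \<Longrightarrow> (h \<odot> g) \<odot> f = h \<odot> (g \<odot> f)"
    and HComp_in: "\<lbrakk>f \<in> hom1 C A B; f' \<in> hom1 C A B; g \<in> hom1 C B D; g' \<in> hom1 C B D;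
        s \<in> hom2 C f f'; t \<in> hom2 C g g'\<rbrakk>
      \<Longrightarrow> t \<star> s \<in> hom2 C (g \<odot> f) (g' \<odot> f')"
    and HComp_Id2: "\<lbrakk>f \<in> hom1 C A B; g \<in> hom1 C B D\<rbrakk>
      \<Longrightarrow> Id2 C g \<star> Id2 C f = Id2 C (g \<odot> f)"
    and interchange: "\<lbrakk>f \<in> hom1 C A B; f' \<in> hom1 C A B; f'' \<in> hom1 C A B;
        g \<in> hom1 C B D; g' \<in> hom1 C B D; g'' \<in> hom1 C B D;
        s \<in> hom2 C f f'; s' \<in> hom2 C f' f''; t \<in> hom2 C g g'; t' \<in> hom2 C g' g''\<rbrakk>
      \<Longrightarrow> (t' \<cdot> t) \<star> (s' \<cdot> s) = (t' \<star> s') \<cdot> (t \<star> s)"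
    and HComp_unit_right: "\<lbrakk>f \<in> hom1 C A B; f' \<in> hom1 C A B; s \<in> hom2 C f f'\<rbrakk>
      \<Longrightarrow> s \<star> Id2 C (Id1 C A) = s"
    and HComp_unit_left: "\<lbrakk>f \<in> hom1 C A B; f' \<in> hom1 C A B; s \<in> hom2 C f f'\<rbrakk>
      \<Longrightarrow> Id2 C (Id1 C B) \<star> s = s"
    and HComp_assoc: "\<lbrakk>f \<in> hom1 C A B; f' \<in> hom1 C A B; g \<in> hom1 C B D; g' \<in> hom1 C B D;
        h \<in> hom1 C D E; h' \<in> hom1 C D E;
        s \<in> hom2 C f f'; t \<in> hom2 C g g'; r \<in> hom2 C h h'\<rbrakk>
      \<Longrightarrow> (r \<star> t) \<star> s = r \<star> (t \<star> s)"

definition full_sub :: "('o, 'f, 't) two_cat \<Rightarrow> 'o set \<Rightarrow> ('o, 'f, 't) two_cat" where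
  "full_sub C S = C\<lparr>Cell0 := Cell0 C \<inter> S,
     Cell1 := {f \<in> Cell1 C. Dom1 C f \<in> S \<and> Cod1 C f \<in> S},
     Cell2 := {s \<in> Cell2 C. Dom1 C (Dom2 C s) \<in> S \<and> Cod1 C (Dom2 C s) \<in> S}\<rparr>"

text \<open>The comparison cells point as \<open>PComp g f : P g \<odot> P f \<Rightarrow> P (g \<odot> f)\<close> and
  \<open>PUnit A : Id1 (P A) \<Rightarrow> P (Id1 A)\<close>.\<close>

record ('o, 'f, 't, 'p, 'g, 'u) psfun =
  P0 :: "'o \<Rightarrow> 'p"
  P1 :: "'f \<Rightarrow> 'g"
  P2 :: "'t \<Rightarrow> 'u"
  PComp :: "'f \<Rightarrow> 'f \<Rightarrow> 'u"
  PUnit :: "'o \<Rightarrow> 'u"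

locale is_pseudofunctor =
  fixes C :: "('o, 'f, 't) two_cat" and D :: "('p, 'g, 'u) two_cat"
    and P :: "('o, 'f, 't, 'p, 'g, 'u) psfun"
  assumes P0_in: "A \<in> Cell0 C \<Longrightarrow> P0 P A \<in> Cell0 D"
    and P_hom: "\<lbrakk>A \<in> Cell0 C; B \<in> Cell0 C\<rbrakk>
      \<Longrightarrow> is_functor (hom_cat C A B) (hom_cat D (P0 P A) (P0 P B)) (P1 P) (P2 P)"
    and PComp_iso: "\<lbrakk>f \<in> hom1 C A B; g \<in> hom1 C B E\<rbrakk>
      \<Longrightarrow> iso2 D (P1 P g \<odot>\<^bsub>D\<^esub> P1 P f) (P1 P (g \<odot>\<^bsub>C\<^esub> f)) (PComp P g f)"
    and PUnit_iso: "A \<in> Cell0 C \<Longrightarrow> iso2 D (Id1 D (P0 P A)) (P1 P (Id1 C A)) (PUnit P A)"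
    and PComp_natural: "\<lbrakk>f \<in> hom1 C A B; f' \<in> hom1 C A B; g \<in> hom1 C B E; g' \<in> hom1 C B E;
        s \<in> hom2 C f f'; t \<in> hom2 C g g'\<rbrakk>
      \<Longrightarrow> PComp P g' f' \<cdot>\<^bsub>D\<^esub> (P2 P t \<star>\<^bsub>D\<^esub> P2 P s) = P2 P (t \<star>\<^bsub>C\<^esub> s) \<cdot>\<^bsub>D\<^esub> PComp P g f"
    and PComp_assoc: "\<lbrakk>f \<in> hom1 C A B; g \<in> hom1 C B E; h \<in> hom1 C E G\<rbrakk>
      \<Longrightarrow> PComp P (h \<odot>\<^bsub>C\<^esub> g) f \<cdot>\<^bsub>D\<^esub> (PComp P h g \<star>\<^bsub>D\<^esub> Id2 D (P1 P f))
        = PComp P h (g \<odot>\<^bsub>C\<^esub> f) \<cdot>\<^bsub>D\<^esub> (Id2 D (P1 P h) \<star>\<^bsub>D\<^esub> PComp P g f)"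
    and PUnit_right: "f \<in> hom1 C A B
      \<Longrightarrow> PComp P f (Id1 C A) \<cdot>\<^bsub>D\<^esub> (Id2 D (P1 P f) \<star>\<^bsub>D\<^esub> PUnit P A) = Id2 D (P1 P f)"
    and PUnit_left: "f \<in> hom1 C A B
      \<Longrightarrow> PComp P (Id1 C B) f \<cdot>\<^bsub>D\<^esub> (PUnit P B \<star>\<^bsub>D\<^esub> Id2 D (P1 P f)) = Id2 D (P1 P f)"

definition inclusion :: "('o, 'f, 't) two_cat \<Rightarrow> ('o, 'f, 't, 'o, 'f, 't) psfun" where
  "inclusion D = \<lparr>P0 = (\<lambda>A. A), P1 = (\<lambda>f. f), P2 = (\<lambda>s. s),
     PComp = (\<lambda>g f. Id2 D (g \<odot>\<^bsub>D\<^esub> f)), PUnit = (\<lambda>A. Id2 D (Id1 D A))\<rparr>"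

text \<open>A biadjunction between \<open>L : C \<rightarrow> D\<close> and \<open>U : D \<rightarrow> C\<close>: equivalences of categories
  \<open>\<Phi> A B : D(L A, B) \<rightarrow> C(A, U B)\<close>, pseudonatural in \<open>A\<close> and \<open>B\<close>. The pseudonaturality
  cell at \<open>u : A' \<rightarrow> A\<close>, \<open>v : B \<rightarrow> B'\<close> and \<open>f : L A \<rightarrow> B\<close> is
  \<open>\<theta> u v f : \<Phi> (v \<odot> f \<odot> L u) \<Rightarrow> U v \<odot> \<Phi> f \<odot> u\<close>; \<open>theta_unit\<close> and \<open>theta_comp\<close>
  are the two coherence axioms of a pseudonatural transformation between the pseudofunctors
  \<open>D(L -, -)\<close> and \<open>C(-, U -)\<close> on the product of the opposite of \<open>C\<close> with \<open>D\<close>.\<close>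

locale is_biadjunction =
  C: is_two_category C + D: is_two_category D +
  L: is_pseudofunctor C D L + U: is_pseudofunctor D C U
  for C :: "('o, 'f, 't) two_cat" and D :: "('p, 'g, 'u) two_cat"
    and L :: "('o, 'f, 't, 'p, 'g, 'u) psfun" and U :: "('p, 'g, 'u, 'o, 'f, 't) psfun" +
  fixes \<Phi>0 :: "'o \<Rightarrow> 'p \<Rightarrow> 'g \<Rightarrow> 'f"
    and \<Phi>1 :: "'o \<Rightarrow> 'p \<Rightarrow> 'u \<Rightarrow> 't"
    and \<theta> :: "'f \<Rightarrow> 'g \<Rightarrow> 'g \<Rightarrow> 't"
  assumes Phi_equivalence: "\<lbrakk>A \<in> Cell0 C; B \<in> Cell0 D\<rbrakk>
      \<Longrightarrow> is_equivalence (hom_cat D (P0 L A) B) (hom_cat C A (P0 U B)) (\<Phi>0 A B) (\<Phi>1 A B)"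
    and theta_iso: "\<lbrakk>A \<in> Cell0 C; u \<in> hom1 C A' A; v \<in> hom1 D B B'; f \<in> hom1 D (P0 L A) B\<rbrakk>
      \<Longrightarrow> iso2 C (\<Phi>0 A' B' (v \<odot>\<^bsub>D\<^esub> f \<odot>\<^bsub>D\<^esub> P1 L u)) (P1 U v \<odot>\<^bsub>C\<^esub> \<Phi>0 A B f \<odot>\<^bsub>C\<^esub> u) (\<theta> u v f)"
    and theta_natural: "\<lbrakk>A \<in> Cell0 C; u \<in> hom1 C A' A; u' \<in> hom1 C A' A;
        v \<in> hom1 D B B'; v' \<in> hom1 D B B';
        f \<in> hom1 D (P0 L A) B; f' \<in> hom1 D (P0 L A) B;
        r \<in> hom2 C u u'; s \<in> hom2 D v v'; t \<in> hom2 D f f'\<rbrakk>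
      \<Longrightarrow> \<theta> u' v' f' \<cdot>\<^bsub>C\<^esub> \<Phi>1 A' B' (s \<star>\<^bsub>D\<^esub> t \<star>\<^bsub>D\<^esub> P2 L r)
        = (P2 U s \<star>\<^bsub>C\<^esub> \<Phi>1 A B t \<star>\<^bsub>C\<^esub> r) \<cdot>\<^bsub>C\<^esub> \<theta> u v f"
    and theta_unit: "\<lbrakk>A \<in> Cell0 C; f \<in> hom1 D (P0 L A) B\<rbrakk>
      \<Longrightarrow> \<theta> (Id1 C A) (Id1 D B) f
            \<cdot>\<^bsub>C\<^esub> \<Phi>1 A B (Id2 D (Id1 D B) \<star>\<^bsub>D\<^esub> Id2 D f \<star>\<^bsub>D\<^esub> PUnit L A)
        = PUnit U B \<star>\<^bsub>C\<^esub> Id2 C (\<Phi>0 A B f) \<star>\<^bsub>C\<^esub> Id2 C (Id1 C A)"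
    and theta_comp: "\<lbrakk>A \<in> Cell0 C; u \<in> hom1 C A' A; u' \<in> hom1 C A'' A';
        v \<in> hom1 D B B'; v' \<in> hom1 D B' B''; f \<in> hom1 D (P0 L A) B\<rbrakk>
      \<Longrightarrow> \<theta> (u \<odot>\<^bsub>C\<^esub> u') (v' \<odot>\<^bsub>D\<^esub> v) f
            \<cdot>\<^bsub>C\<^esub> \<Phi>1 A'' B'' (Id2 D (v' \<odot>\<^bsub>D\<^esub> v) \<star>\<^bsub>D\<^esub> Id2 D f \<star>\<^bsub>D\<^esub> PComp L u u')
        = (PComp U v' v \<star>\<^bsub>C\<^esub> Id2 C (\<Phi>0 A B f \<odot>\<^bsub>C\<^esub> u \<odot>\<^bsub>C\<^esub> u'))
            \<cdot>\<^bsub>C\<^esub> (Id2 C (P1 U v') \<star>\<^bsub>C\<^esub> \<theta> u v f \<star>\<^bsub>C\<^esub> Id2 C u')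
            \<cdot>\<^bsub>C\<^esub> \<theta> u' v' (v \<odot>\<^bsub>D\<^esub> f \<odot>\<^bsub>D\<^esub> P1 L u)"

definition is_left_biadjoint ::
  "('o, 'f, 't) two_cat \<Rightarrow> ('p, 'g, 'u) two_cat \<Rightarrow> ('o, 'f, 't, 'p, 'g, 'u) psfun
    \<Rightarrow> ('p, 'g, 'u, 'o, 'f, 't) psfun \<Rightarrow> bool" where
  "is_left_biadjoint C D L U \<longleftrightarrow> (\<exists>\<Phi>0 \<Phi>1 \<theta>. is_biadjunction C D L U \<Phi>0 \<Phi>1 \<theta>)"


section \<open>Categories enriched in functors on finite cardinals\<close>

text \<open>The finite cardinal \<open>n\<close> is \<open>{..<n}\<close>, so the indices \<open>1, ..., n\<close> are shifted to
  \<open>0, ..., n - 1\<close>; tuples are lists.\<close>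

definition FinMap :: "nat \<Rightarrow> nat \<Rightarrow> (nat \<Rightarrow> nat) set" where
  "FinMap n m = {..<n} \<rightarrow>\<^sub>E {..<m}"

text \<open>Objects form a subset of the type \<open>'o\<close> and every hom-set is a subset of the type \<open>'a\<close>;
  thus \<open>'a\<close> plays the role of the universe of small sets, and \<open>'o\<close> that of the collections.
  In \<open>Act M X Y n m \<phi>\<close> the map \<open>\<phi>\<close> goes from \<open>n\<close> to \<open>m\<close>; \<open>Sub M X Y Z n g fs\<close> is
  \<open>g \<circ> (fs)\<close> with \<open>g \<in> M\<^sub>m(Y, Z)\<close>, \<open>fs \<in> M\<^sub>n(X, Y)\<^sup>m\<close> and \<open>m = length fs\<close>.\<close>

record ('o, 'a) fset_cat =
  Obj :: "'o set"
  Hom :: "nat \<Rightarrow> 'o \<Rightarrow> 'o \<Rightarrow> 'a set"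
  Act :: "'o \<Rightarrow> 'o \<Rightarrow> nat \<Rightarrow> nat \<Rightarrow> (nat \<Rightarrow> nat) \<Rightarrow> 'a \<Rightarrow> 'a"
  Unt :: "'o \<Rightarrow> 'a"
  Sub :: "'o \<Rightarrow> 'o \<Rightarrow> 'o \<Rightarrow> nat \<Rightarrow> 'a \<Rightarrow> 'a list \<Rightarrow> 'a"

definition Tup :: "('o, 'a) fset_cat \<Rightarrow> nat \<Rightarrow> nat \<Rightarrow> 'o \<Rightarrow> 'o \<Rightarrow> 'a list set" where
  "Tup M m n X Y = {fs. length fs = m \<and> set fs \<subseteq> Hom M n X Y}"

definition Prj :: "('o, 'a) fset_cat \<Rightarrow> 'o \<Rightarrow> nat \<Rightarrow> nat \<Rightarrow> 'a" where
  "Prj M X n i = Act M X X 1 n (\<lambda>j\<in>{..<1}. i) (Unt M X)"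

definition Prjs :: "('o, 'a) fset_cat \<Rightarrow> 'o \<Rightarrow> nat \<Rightarrow> 'a list" where
  "Prjs M X n = map (Prj M X n) [0..<n]"

locale is_fset_category =
  fixes M :: "('o, 'a) fset_cat"
  assumes Act_in: "\<lbrakk>X \<in> Obj M; Y \<in> Obj M; \<phi> \<in> FinMap n m; f \<in> Hom M n X Y\<rbrakk>
      \<Longrightarrow> Act M X Y n m \<phi> f \<in> Hom M m X Y"
    and Act_id: "\<lbrakk>X \<in> Obj M; Y \<in> Obj M; f \<in> Hom M n X Y\<rbrakk>
      \<Longrightarrow> Act M X Y n n (\<lambda>i\<in>{..<n}. i) f = f"
    and Act_comp: "\<lbrakk>X \<in> Obj M; Y \<in> Obj M; \<phi> \<in> FinMap n m; \<psi> \<in> FinMap m k; f \<in> Hom M n X Y\<rbrakk>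
      \<Longrightarrow> Act M X Y n k (compose {..<n} \<psi> \<phi>) f = Act M X Y m k \<psi> (Act M X Y n m \<phi> f)"
    and Unt_in: "X \<in> Obj M \<Longrightarrow> Unt M X \<in> Hom M 1 X X"
    and Sub_in: "\<lbrakk>X \<in> Obj M; Y \<in> Obj M; Z \<in> Obj M; g \<in> Hom M m Y Z; fs \<in> Tup M m n X Y\<rbrakk>
      \<Longrightarrow> Sub M X Y Z n g fs \<in> Hom M n X Z"
    and Sub_natural: "\<lbrakk>X \<in> Obj M; Y \<in> Obj M; Z \<in> Obj M; \<psi> \<in> FinMap n n';
        g \<in> Hom M m Y Z; fs \<in> Tup M m n X Y\<rbrakk>
      \<Longrightarrow> Sub M X Y Z n' g (map (Act M X Y n n' \<psi>) fs) = Act M X Z n n' \<psi> (Sub M X Y Z n g fs)"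
    and Sub_dinatural: "\<lbrakk>X \<in> Obj M; Y \<in> Obj M; Z \<in> Obj M; \<phi> \<in> FinMap m m';
        g \<in> Hom M m Y Z; fs \<in> Tup M m' n X Y\<rbrakk>
      \<Longrightarrow> Sub M X Y Z n (Act M Y Z m m' \<phi> g) fs
        = Sub M X Y Z n g (map (\<lambda>i. fs ! \<phi> i) [0..<m])"
    and Sub_Prj: "\<lbrakk>X \<in> Obj M; Y \<in> Obj M; fs \<in> Tup M n k X Y; i < n\<rbrakk>
      \<Longrightarrow> Sub M X Y Y k (Prj M Y n i) fs = fs ! i"
    and Sub_Prjs: "\<lbrakk>X \<in> Obj M; Y \<in> Obj M; g \<in> Hom M n X Y\<rbrakk>
      \<Longrightarrow> Sub M X X Y n g (Prjs M X n) = g"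
    and Sub_assoc: "\<lbrakk>W \<in> Obj M; X \<in> Obj M; Y \<in> Obj M; Z \<in> Obj M;
        h \<in> Hom M j Y Z; gs \<in> Tup M j k X Y; fs \<in> Tup M k n W X\<rbrakk>
      \<Longrightarrow> Sub M W Y Z n h (map (\<lambda>g. Sub M W X Y n g fs) gs)
        = Sub M W X Z n (Sub M X Y Z k h gs) fs"

text \<open>Functors and transformations are required to be \<open>undefined\<close> outside the sets on which
  they are meaningful, so that HOL equality is the intended equality of 1-cells and 2-cells.\<close>

record ('o, 'a) fset_fun =
  FDom :: "('o, 'a) fset_cat"
  FCod :: "('o, 'a) fset_cat"
  FObj :: "'o \<Rightarrow> 'o"
  FHom :: "nat \<Rightarrow> 'o \<Rightarrow> 'o \<Rightarrow> 'a \<Rightarrow> 'a"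

definition FHom_restrict ::
  "('o, 'a) fset_cat \<Rightarrow> (nat \<Rightarrow> 'o \<Rightarrow> 'o \<Rightarrow> 'a \<Rightarrow> 'a) \<Rightarrow> nat \<Rightarrow> 'o \<Rightarrow> 'o \<Rightarrow> 'a \<Rightarrow> 'a" where
  "FHom_restrict M h = (\<lambda>n X Y f.
     if X \<in> Obj M \<and> Y \<in> Obj M \<and> f \<in> Hom M n X Y then h n X Y f else undefined)"

locale is_fset_functor =
  fixes F :: "('o, 'a) fset_fun"
  assumes FDom_cat: "is_fset_category (FDom F)"
    and FCod_cat: "is_fset_category (FCod F)"
    and FObj_in: "X \<in> Obj (FDom F) \<Longrightarrow> FObj F X \<in> Obj (FCod F)"
    and FHom_in: "\<lbrakk>X \<in> Obj (FDom F); Y \<in> Obj (FDom F); f \<in> Hom (FDom F) n X Y\<rbrakk>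
      \<Longrightarrow> FHom F n X Y f \<in> Hom (FCod F) n (FObj F X) (FObj F Y)"
    and FHom_natural: "\<lbrakk>X \<in> Obj (FDom F); Y \<in> Obj (FDom F); \<phi> \<in> FinMap n m;
        f \<in> Hom (FDom F) n X Y\<rbrakk>
      \<Longrightarrow> FHom F m X Y (Act (FDom F) X Y n m \<phi> f)
        = Act (FCod F) (FObj F X) (FObj F Y) n m \<phi> (FHom F n X Y f)"
    and FHom_Unt: "X \<in> Obj (FDom F) \<Longrightarrow> FHom F 1 X X (Unt (FDom F) X) = Unt (FCod F) (FObj F X)"
    and FHom_Sub: "\<lbrakk>X \<in> Obj (FDom F); Y \<in> Obj (FDom F); Z \<in> Obj (FDom F);
        g \<in> Hom (FDom F) m Y Z; fs \<in> Tup (FDom F) m n X Y\<rbrakk>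
      \<Longrightarrow> FHom F n X Z (Sub (FDom F) X Y Z n g fs)
        = Sub (FCod F) (FObj F X) (FObj F Y) (FObj F Z) n (FHom F m Y Z g) (map (FHom F n X Y) fs)"
    and FObj_ext: "FObj F \<in> extensional (Obj (FDom F))"
    and FHom_ext: "FHom_restrict (FDom F) (FHom F) = FHom F"

text \<open>In \<open>natural\<close> the list of arguments on the right is
  \<open>a X \<circ> \<pi>\<^sub>1, ..., a X \<circ> \<pi>\<^sub>n\<close>.\<close>

locale is_fset_transformation =
  fixes F G :: "('o, 'a) fset_fun" and a :: "'o \<Rightarrow> 'a"
  assumes dom_functor: "is_fset_functor F"
    and cod_functor: "is_fset_functor G"
    and FDom_eq: "FDom G = FDom F"
    and FCod_eq: "FCod G = FCod F"
    and at_in: "X \<in> Obj (FDom F) \<Longrightarrow> a X \<in> Hom (FCod F) 1 (FObj F X) (FObj G X)"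
    and natural: "\<lbrakk>X \<in> Obj (FDom F); Y \<in> Obj (FDom F); f \<in> Hom (FDom F) n X Y\<rbrakk>
      \<Longrightarrow> Sub (FCod F) (FObj F X) (FObj F Y) (FObj G Y) n (a Y) [FHom F n X Y f]
        = Sub (FCod F) (FObj F X) (FObj G X) (FObj G Y) n (FHom G n X Y f)
            (map (\<lambda>p. Sub (FCod F) (FObj F X) (FObj F X) (FObj G X) n (a X) [p])
              (Prjs (FCod F) (FObj F X) n))"
    and at_ext: "a \<in> extensional (Obj (FDom F))"

record ('o, 'a) fset_tr =
  TDom :: "('o, 'a) fset_fun"
  TCod :: "('o, 'a) fset_fun"
  TAt :: "'o \<Rightarrow> 'a"

definition fset_id :: "('o, 'a) fset_cat \<Rightarrow> ('o, 'a) fset_fun" where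
  "fset_id M = \<lparr>FDom = M, FCod = M, FObj = (\<lambda>X\<in>Obj M. X),
     FHom = FHom_restrict M (\<lambda>n X Y f. f)\<rparr>"

definition fset_comp :: "('o, 'a) fset_fun \<Rightarrow> ('o, 'a) fset_fun \<Rightarrow> ('o, 'a) fset_fun" where
  "fset_comp G F = \<lparr>FDom = FDom F, FCod = FCod G,
     FObj = (\<lambda>X\<in>Obj (FDom F). FObj G (FObj F X)),
     FHom = FHom_restrict (FDom F)
       (\<lambda>n X Y f. FHom G n (FObj F X) (FObj F Y) (FHom F n X Y f))\<rparr>"

definition fset_tr_id :: "('o, 'a) fset_fun \<Rightarrow> ('o, 'a) fset_tr" where
  "fset_tr_id F = \<lparr>TDom = F, TCod = F, TAt = (\<lambda>X\<in>Obj (FDom F). Unt (FCod F) (FObj F X))\<rparr>"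

definition fset_vcomp :: "('o, 'a) fset_tr \<Rightarrow> ('o, 'a) fset_tr \<Rightarrow> ('o, 'a) fset_tr" where
  "fset_vcomp \<beta> \<alpha> = \<lparr>TDom = TDom \<alpha>, TCod = TCod \<beta>,
     TAt = (\<lambda>X\<in>Obj (FDom (TDom \<alpha>)).
       Sub (FCod (TDom \<alpha>)) (FObj (TDom \<alpha>) X) (FObj (TCod \<alpha>) X) (FObj (TCod \<beta>) X) 1
         (TAt \<beta> X) [TAt \<alpha> X])\<rparr>"

text \<open>For \<open>\<alpha> : F \<Rightarrow> G\<close> and \<open>\<beta> : H \<Rightarrow> K\<close> the component of the horizontal composite at
  \<open>X\<close> is \<open>\<beta> (G X) \<circ> H (\<alpha> X)\<close>.\<close>

definition fset_hcomp :: "('o, 'a) fset_tr \<Rightarrow> ('o, 'a) fset_tr \<Rightarrow> ('o, 'a) fset_tr" where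
  "fset_hcomp \<beta> \<alpha> = (let F = TDom \<alpha>; G = TCod \<alpha>; H = TDom \<beta>; K = TCod \<beta> in
     \<lparr>TDom = fset_comp H F, TCod = fset_comp K G,
      TAt = (\<lambda>X\<in>Obj (FDom F).
        Sub (FCod H) (FObj H (FObj F X)) (FObj H (FObj G X)) (FObj K (FObj G X)) 1
          (TAt \<beta> (FObj G X)) [FHom H 1 (FObj F X) (FObj G X) (TAt \<alpha> X)])\<rparr>)"

text \<open>Records that agree on the meaningful arguments of \<open>Hom\<close>, \<open>Act\<close>, \<open>Unt\<close>, \<open>Sub\<close>
  but differ elsewhere are distinct, isomorphic objects of \<open>FSetCAT\<close>.\<close>

definition FSetCAT ::
  "(('o, 'a) fset_cat, ('o, 'a) fset_fun, ('o, 'a) fset_tr) two_cat" where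
  "FSetCAT = \<lparr>Cell0 = {M. is_fset_category M}, Cell1 = {F. is_fset_functor F},
     Cell2 = {\<alpha>. is_fset_transformation (TDom \<alpha>) (TCod \<alpha>) (TAt \<alpha>)},
     Dom1 = FDom, Cod1 = FCod, Dom2 = TDom, Cod2 = TCod,
     Id1 = fset_id, Comp1 = fset_comp,
     Id2 = fset_tr_id, VComp = fset_vcomp, HComp = fset_hcomp\<rparr>"

text \<open>\<open>Inj n j\<close> is the coproduct injection of the \<open>j\<close>-th summand \<open>n\<close> into
  \<open>k * n = n + ... + n\<close>, for any \<open>k > j\<close>.\<close>

definition Inj :: "nat \<Rightarrow> nat \<Rightarrow> nat \<Rightarrow> nat" where
  "Inj n j = (\<lambda>i\<in>{..<n}. j * n + i)"

definition exhibits_tensor :: "('o, 'a) fset_cat \<Rightarrow> nat \<Rightarrow> 'o \<Rightarrow> 'o \<Rightarrow> 'a \<Rightarrow> bool" where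
  "exhibits_tensor M n X Z i \<longleftrightarrow> i \<in> Hom M n X Z \<and>
     (\<forall>Y\<in>Obj M. \<forall>k. bij_betw
        (\<lambda>g. Sub M X Z Y (k * n) g (map (\<lambda>j. Act M X Z n (k * n) (Inj n j) i) [0..<k]))
        (Hom M k Z Y) (Hom M (k * n) X Y))"

definition representable :: "('o, 'a) fset_cat \<Rightarrow> bool" where
  "representable M \<longleftrightarrow> (\<forall>X\<in>Obj M. \<forall>n. \<exists>Z\<in>Obj M. \<exists>i. exhibits_tensor M n X Z i)"

definition FSetCAT_rep ::
  "(('o, 'a) fset_cat, ('o, 'a) fset_fun, ('o, 'a) fset_tr) two_cat" where
  "FSetCAT_rep = full_sub FSetCAT {M. representable M}"

end

theory Submission
  imports Defs
begin

text \<open>The tensor \<open>y\<^sub>n \<otimes> X\<close> is absolute: it amounts to a map \<open>i \<in> M\<^sub>n(X, Z)\<close> together with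
  \<open>p\<^sub>1, ..., p\<^sub>n \<in> M\<^sub>1(Z, X)\<close> such that \<open>p\<^sub>j \<circ> (i) = \<pi>\<^sub>j\<close> and \<open>i \<circ> (p\<^sub>1, ..., p\<^sub>n) = 1\<close>, equations that
  every functor preserves. Hence the free completion \<open>L M\<close> has as objects the formal tensors
  \<open>y\<^sub>n \<otimes> X\<close>, with \<open>L M\<^sub>k(y\<^sub>n \<otimes> X, y\<^sub>m \<otimes> Y) = M\<^sub>k\<^sub>n(X, Y)\<^sup>m\<close> and substitution of concatenated tuples, and
  restriction along the unit \<open>X \<mapsto> y\<^sub>1 \<otimes> X\<close> is fully faithful on functors out of \<open>L M\<close>. It is
  essentially surjective onto functors with representable codomain \<open>N\<close>, since \<open>y\<^sub>n \<otimes> X\<close> can be sent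
  to a chosen tensor in \<open>N\<close>. As \<open>L\<close> is strictly functorial on 1-cells and its unit is strictly
  natural, the biadjunction has identities as pseudonaturality cells.\<close>

section \<open>Biadjunctions from strict reflections\<close>

text \<open>What makes restriction along the unit full is a closure property: the maps at which a
  family of components is natural contain the projections and are closed under substitution. Every
  map between formal tensors is built by substitution from \<open>i\<close>, the
  \<open>p\<^sub>j\<close>, projections and maps of \<open>M\<close>, so naturality has to be
  checked on these generators alone, and the component at a formal tensor is forced by the component
  at its base. Choices of tensors in \<open>N\<close> occur only in essential surjectivity, and they
  determine the extended functor only up to isomorphism. This is why restriction is an equivalence
  and not a bijection on 1-cells, and why the result is a biadjunction. \<open>L\<close> itself
  involves no choice beyond one coding of tuples and of formal tensors, fixed for all
  \<open>M\<close> at once; hence it preserves composition and identities of 1-cells on the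
  nose.\<close>

lemma is_equivalenceI:
  assumes X: "is_category X" and Y: "is_category Y" and F: "is_functor X Y F0 F1"
    and full_faithful: "\<And>x y. \<lbrakk>x \<in> Ob X; y \<in> Ob X\<rbrakk> \<Longrightarrow> bij_betw F1 (Ar X x y) (Ar Y (F0 x) (F0 y))"
    and ess_surj: "\<And>y. y \<in> Ob Y \<Longrightarrow> \<exists>x\<in>Ob X. \<exists>e. is_iso Y (F0 x) y e"
    and dom: "\<And>x y g. g \<in> Ar Y x y \<Longrightarrow> d g = x" and cod: "\<And>x y g. g \<in> Ar Y x y \<Longrightarrow> c g = y"
  shows "is_equivalence X Y F0 F1"
proof -
  interpret X: is_category X by fact
  interpret Y: is_category Y by fact
  interpret F: is_functor X Y F0 F1 by fact
  have "\<forall>y\<in>Ob Y. \<exists>x e e'. x \<in> Ob X \<and> e \<in> Ar Y (F0 x) y \<and> e' \<in> Ar Y y (F0 x)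
      \<and> Cmp Y e' e = Idn Y (F0 x) \<and> Cmp Y e e' = Idn Y y"
    using ess_surj unfolding is_iso_def by blast
  then obtain G0 \<epsilon> \<epsilon>' where G: "\<And>y. y \<in> Ob Y \<Longrightarrow> G0 y \<in> Ob X \<and> \<epsilon> y \<in> Ar Y (F0 (G0 y)) y
      \<and> \<epsilon>' y \<in> Ar Y y (F0 (G0 y)) \<and> Cmp Y (\<epsilon>' y) (\<epsilon> y) = Idn Y (F0 (G0 y)) \<and> Cmp Y (\<epsilon> y) (\<epsilon>' y) = Idn Y y"
    by metis
  define lft where "lft x y = the_inv_into (Ar X x y) F1" for x y
  have lft_in: "lft x y g \<in> Ar X x y" and F1_lft: "F1 (lft x y g) = g"
    if "x \<in> Ob X" "y \<in> Ob X" "g \<in> Ar Y (F0 x) (F0 y)" for x y g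
    using full_faithful[OF that(1,2)] that(3) unfolding lft_def bij_betw_def
    by (auto intro: the_inv_into_into f_the_inv_into_f)
  have F1_inj: "f = g" if "x \<in> Ob X" "y \<in> Ob X" "f \<in> Ar X x y" "g \<in> Ar X x y" "F1 f = F1 g" for x y f g
    using full_faithful[OF that(1,2)] that(3-) unfolding bij_betw_def inj_on_def by blast
  \<comment> \<open>The action on arrows receives only the arrow, and the hom-sets of a
    \<open>cat\<close> may overlap; \<open>d\<close> and \<open>c\<close> recover the endpoints, so
    that \<open>G1\<close> makes sense as a function of one argument.\<close>
  define G1 where "G1 g = lft (G0 (d g)) (G0 (c g)) (Cmp Y (\<epsilon>' (c g)) (Cmp Y g (\<epsilon> (d g))))" for g
  have G1_in: "G1 g \<in> Ar X (G0 x) (G0 y)"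
    and F1_G1: "F1 (G1 g) = Cmp Y (\<epsilon>' y) (Cmp Y g (\<epsilon> x))"
    if "x \<in> Ob Y" "y \<in> Ob Y" "g \<in> Ar Y x y" for x y g
  proof -
    have "Cmp Y (\<epsilon>' y) (Cmp Y g (\<epsilon> x)) \<in> Ar Y (F0 (G0 x)) (F0 (G0 y))"
      using that G[OF that(1)] G[OF that(2)] F.F0_in by (meson Y.Cmp_in)
    then show "G1 g \<in> Ar X (G0 x) (G0 y)" "F1 (G1 g) = Cmp Y (\<epsilon>' y) (Cmp Y g (\<epsilon> x))"
      using lft_in F1_lft that G dom cod unfolding G1_def by auto
  qed
  \<comment> \<open>In a composite of two conjugates \<open>\<epsilon>' g \<epsilon>\<close> the
    inner pair disappears; the same cancellation gives naturality of
    \<open>\<epsilon>\<close>.\<close>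
  have cancel: "Cmp Y (\<epsilon> y) (Cmp Y (\<epsilon>' y) g) = g" if "x \<in> Ob Y" "y \<in> Ob Y" "g \<in> Ar Y x y" for x y g
    using Y.Cmp_assoc[of x y "F0 (G0 y)" y g "\<epsilon>' y" "\<epsilon> y"] that G[OF that(2)] F.F0_in
    by (simp add: Y.Idn_Cmp)
  interpret G: is_functor Y X G0 G1
  proof
    fix x assume x: "x \<in> Ob Y"
    then show "G0 x \<in> Ob X" using G by blast
    show "G1 (Idn Y x) = Idn X (G0 x)"
      using x G[OF x] F1_G1[OF x x Y.Idn_in[OF x]] G1_in[OF x x Y.Idn_in[OF x]]
      by (intro F1_inj[of "G0 x" "G0 x"])
        (auto simp: X.Idn_in F.F1_Idn Y.Idn_Cmp[of "F0 (G0 x)" x] F.F0_in)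
  next
    fix x y g assume "x \<in> Ob Y" "y \<in> Ob Y" "g \<in> Ar Y x y"
    then show "G1 g \<in> Ar X (G0 x) (G0 y)" by (rule G1_in)
  next
    fix x y z f g assume a: "x \<in> Ob Y" "y \<in> Ob Y" "z \<in> Ob Y" "f \<in> Ar Y x y" "g \<in> Ar Y y z"
    note Gx = G[OF a(1)] and Gy = G[OF a(2)] and Gz = G[OF a(3)]
    have F: "F0 (G0 x) \<in> Ob Y" "F0 (G0 y) \<in> Ob Y" "F0 (G0 z) \<in> Ob Y"
      using Gx Gy Gz F.F0_in by auto
    have m: "Cmp Y f (\<epsilon> x) \<in> Ar Y (F0 (G0 x)) y"
      using a F Gx by (meson Y.Cmp_in)
    have n: "Cmp Y (\<epsilon>' y) (Cmp Y f (\<epsilon> x)) \<in> Ar Y (F0 (G0 x)) (F0 (G0 y))"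
      using m a F Gy by (meson Y.Cmp_in)
    have gf: "Cmp Y g f \<in> Ar Y x z" using a by (meson Y.Cmp_in)
    have "F1 (Cmp X (G1 g) (G1 f)) = Cmp Y (Cmp Y (\<epsilon>' z) (Cmp Y g (\<epsilon> y))) (Cmp Y (\<epsilon>' y) (Cmp Y f (\<epsilon> x)))"
      using a Gx Gy Gz G1_in[OF a(1,2,4)] G1_in[OF a(2,3,5)] F1_G1[OF a(1,2,4)] F1_G1[OF a(2,3,5)]
      by (subst F.F1_Cmp[of "G0 x" "G0 y" "G0 z"]) auto
    also have "\<dots> = Cmp Y (\<epsilon>' z) (Cmp Y (Cmp Y g (\<epsilon> y)) (Cmp Y (\<epsilon>' y) (Cmp Y f (\<epsilon> x))))"
      using Y.Cmp_assoc[OF F(1,2) a(3) F(3) n Y.Cmp_in[OF F(2) a(2,3) _ a(5)]] Gy Gz by blast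
    also have "\<dots> = Cmp Y (\<epsilon>' z) (Cmp Y g (Cmp Y (\<epsilon> y) (Cmp Y (\<epsilon>' y) (Cmp Y f (\<epsilon> x)))))"
      using Y.Cmp_assoc[OF F(1,2) a(2,3) n _ a(5)] Gy by simp
    also have "\<dots> = Cmp Y (\<epsilon>' z) (Cmp Y g (Cmp Y f (\<epsilon> x)))"
      using cancel[OF F(1) a(2) m] by simp
    also have "\<dots> = Cmp Y (\<epsilon>' z) (Cmp Y (Cmp Y g f) (\<epsilon> x))"
      using Y.Cmp_assoc[OF F(1) a(1-3) _ a(4,5)] Gx by simp
    also have "\<dots> = F1 (G1 (Cmp Y g f))" using F1_G1[OF a(1,3) gf] by simp
    finally show "G1 (Cmp Y g f) = Cmp X (G1 g) (G1 f)"
      using Gx Gy Gz G1_in[OF a(1,2,4)] G1_in[OF a(2,3,5)] G1_in[OF a(1,3) gf]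
      by (intro F1_inj[of "G0 x" "G0 z"]) (auto intro: X.Cmp_in)
  qed
  \<comment> \<open>By fullness \<open>\<epsilon>' (F0 x)\<close> and
    \<open>\<epsilon> (F0 x)\<close> come from arrows of \<open>X\<close>; faithfulness then makes
    the two lifts mutually inverse.\<close>
  define \<eta> where "\<eta> x = lft x (G0 (F0 x)) (\<epsilon>' (F0 x))" for x
  define \<eta>' where "\<eta>' x = lft (G0 (F0 x)) x (\<epsilon> (F0 x))" for x
  have \<eta>: "\<eta> x \<in> Ar X x (G0 (F0 x))" "F1 (\<eta> x) = \<epsilon>' (F0 x)"
    "\<eta>' x \<in> Ar X (G0 (F0 x)) x" "F1 (\<eta>' x) = \<epsilon> (F0 x)" if "x \<in> Ob X" for x
    using lft_in F1_lft G that F.F0_in unfolding \<eta>_def \<eta>'_def by auto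
  have n1: "is_nat_iso X X (\<lambda>x. x) (\<lambda>f. f) (\<lambda>x. G0 (F0 x)) (\<lambda>f. G1 (F1 f)) \<eta>"
  proof
    fix x assume x: "x \<in> Ob X"
    note Fx = F.F0_in[OF x]
    note Gx = G[OF Fx]
    have "Cmp X (\<eta>' x) (\<eta> x) = Idn X x"
      using x Gx \<eta>[OF x]
      by (intro F1_inj[of x x]) (auto intro: X.Cmp_in X.Idn_in simp: F.F1_Cmp[of x "G0 (F0 x)" x] F.F1_Idn)
    moreover have "Cmp X (\<eta> x) (\<eta>' x) = Idn X (G0 (F0 x))"
      using x Gx \<eta>[OF x]
      by (intro F1_inj[of "G0 (F0 x)" "G0 (F0 x)"])
        (auto intro: X.Cmp_in X.Idn_in simp: F.F1_Cmp[of "G0 (F0 x)" x "G0 (F0 x)"] F.F1_Idn)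
    ultimately show "is_iso X x (G0 (F0 x)) (\<eta> x)"
      using \<eta>[OF x] unfolding is_iso_def by blast
  next
    fix x y f assume a: "x \<in> Ob X" "y \<in> Ob X" "f \<in> Ar X x y"
    note Fa = F.F0_in[OF a(1)] F.F0_in[OF a(2)] F.F1_in[OF a]
    note Ga = G[OF Fa(1)] G[OF Fa(2)]
    have "Cmp Y (Cmp Y (\<epsilon>' (F0 y)) (Cmp Y (F1 f) (\<epsilon> (F0 x)))) (\<epsilon>' (F0 x)) =
        Cmp Y (\<epsilon>' (F0 y)) (Cmp Y (Cmp Y (F1 f) (\<epsilon> (F0 x))) (\<epsilon>' (F0 x)))"
      using Fa Ga F.F0_in
      by (intro Y.Cmp_assoc[of "F0 x" "F0 (G0 (F0 x))" "F0 y" "F0 (G0 (F0 y))"]) (auto intro: Y.Cmp_in)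
    also have "Cmp Y (Cmp Y (F1 f) (\<epsilon> (F0 x))) (\<epsilon>' (F0 x)) = Cmp Y (F1 f) (Cmp Y (\<epsilon> (F0 x)) (\<epsilon>' (F0 x)))"
      using Fa Ga F.F0_in
      by (intro Y.Cmp_assoc[of "F0 x" "F0 (G0 (F0 x))" "F0 x" "F0 y"]) auto
    also have "\<dots> = F1 f" using Fa Ga by (simp add: Y.Cmp_Idn)
    finally have *: "Cmp Y (Cmp Y (\<epsilon>' (F0 y)) (Cmp Y (F1 f) (\<epsilon> (F0 x)))) (\<epsilon>' (F0 x)) =
        Cmp Y (\<epsilon>' (F0 y)) (F1 f)" .
    show "Cmp X (\<eta> y) f = Cmp X (G1 (F1 f)) (\<eta> x)"
      using a Ga \<eta>[OF a(1)] \<eta>[OF a(2)] G1_in[OF Fa] F1_G1[OF Fa] *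
      by (intro F1_inj[of x "G0 (F0 y)"]) (auto intro: X.Cmp_in simp: F.F1_Cmp[of x y "G0 (F0 y)"]
          F.F1_Cmp[of x "G0 (F0 x)" "G0 (F0 y)"])
  qed
  have n2: "is_nat_iso Y Y (\<lambda>y. F0 (G0 y)) (\<lambda>g. F1 (G1 g)) (\<lambda>y. y) (\<lambda>g. g) \<epsilon>"
  proof
    fix y assume "y \<in> Ob Y" then show "is_iso Y (F0 (G0 y)) y (\<epsilon> y)"
      using G unfolding is_iso_def by blast
  next
    fix x y g assume a: "x \<in> Ob Y" "y \<in> Ob Y" "g \<in> Ar Y x y"
    then have "F0 (G0 x) \<in> Ob Y" "Cmp Y g (\<epsilon> x) \<in> Ar Y (F0 (G0 x)) y"
      using G F.F0_in by (auto intro: Y.Cmp_in)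
    then show "Cmp Y (\<epsilon> y) (F1 (G1 g)) = Cmp Y g (\<epsilon> x)"
      using a cancel by (auto simp: F1_G1)
  qed
  show ?thesis
    unfolding is_equivalence_def using F G.is_functor_axioms n1 n2 by blast
qed


section \<open>Whiskering in a strict 2-category\<close>

context is_two_category
begin

lemma hom1_Cell0:
  assumes "f \<in> hom1 C A B"
  shows "A \<in> Cell0 C" "B \<in> Cell0 C"
  using assms Dom1_in Cod1_in unfolding hom1_def by auto

lemma hom2_cod:
  assumes "s \<in> hom2 C f g" "f \<in> hom1 C A B"
  shows "g \<in> hom1 C A B"
  using assms parallel[of s] Cod2_in[of s] unfolding hom1_def hom2_def by auto

lemma Id2_in: "f \<in> hom1 C A B \<Longrightarrow> Id2 C f \<in> hom2 C f f"
  using is_category.Idn_in[OF hom_category[OF hom1_Cell0]] by (auto simp: hom_cat_def)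

lemma
  assumes f: "f \<in> hom1 C A B" and s: "s \<in> hom2 C f g"
  shows VComp_Id2: "s \<cdot> Id2 C f = s" and Id2_VComp: "Id2 C g \<cdot> s = s"
    and VComp_in: "t \<in> hom2 C g h \<Longrightarrow> t \<cdot> s \<in> hom2 C f h"
proof -
  interpret H: is_category "hom_cat C A B"
    using hom1_Cell0[OF f] by (rule hom_category)
  note H = H.Cmp_Idn H.Idn_Cmp H.Cmp_in
  note H' = H[unfolded hom_cat_def cat.simps]
  have g: "g \<in> hom1 C A B" using hom2_cod s f by blast
  show "s \<cdot> Id2 C f = s" "Id2 C g \<cdot> s = s" using H'(1,2)[OF f g s] by auto
  assume t: "t \<in> hom2 C g h"
  have h: "h \<in> hom1 C A B" using hom2_cod t g by blast
  show "t \<cdot> s \<in> hom2 C f h" using H'(3)[OF f g h s t] .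
qed

lemma HComp_in': "\<lbrakk>f \<in> hom1 C A B; g \<in> hom1 C B D; s \<in> hom2 C f f'; t \<in> hom2 C g g'\<rbrakk>
    \<Longrightarrow> t \<star> s \<in> hom2 C (g \<odot> f) (g' \<odot> f')"
  by (rule HComp_in[OF _ hom2_cod _ hom2_cod])

lemma HComp_assoc': "\<lbrakk>f \<in> hom1 C A B; g \<in> hom1 C B D; h \<in> hom1 C D E;
      s \<in> hom2 C f f'; t \<in> hom2 C g g'; r \<in> hom2 C h h'\<rbrakk>
    \<Longrightarrow> (r \<star> t) \<star> s = r \<star> (t \<star> s)"
  by (rule HComp_assoc[OF _ hom2_cod _ hom2_cod _ hom2_cod])

lemma whisker_VComp:
  assumes "f \<in> hom1 C A B" "g \<in> hom1 C B D" "t \<in> hom2 C g g'" "t' \<in> hom2 C g' g''"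
  shows "(t' \<cdot> t) \<star> Id2 C f = (t' \<star> Id2 C f) \<cdot> (t \<star> Id2 C f)"
  using interchange[of f A B f f g D g' g'' "Id2 C f" "Id2 C f" t t'] assms
    hom2_cod[of t g g'] hom2_cod[of t' g' g''] Id2_in[of f A B]
  by (simp add: VComp_Id2[of f A B])

lemma VComp_whisker:
  assumes "f \<in> hom1 C A B" "g \<in> hom1 C B D" "s \<in> hom2 C f f'" "s' \<in> hom2 C f' f''"
  shows "Id2 C g \<star> (s' \<cdot> s) = (Id2 C g \<star> s') \<cdot> (Id2 C g \<star> s)"
  using interchange[of f A B f' f'' g D g g s s' "Id2 C g" "Id2 C g"] assms
    hom2_cod[of s f f'] hom2_cod[of s' f' f''] Id2_in[of g B D]
  by (simp add: VComp_Id2[of g B D])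

lemma iso2_Id2: "f \<in> hom1 C A B \<Longrightarrow> iso2 C f f (Id2 C f)"
  using Id2_in VComp_Id2 unfolding iso2_def by metis

end

section \<open>Full sub-2-categories and their inclusions\<close>

lemma full_sub_simps [simp]:
  "Cell0 (full_sub C S) = Cell0 C \<inter> S"
  "Dom1 (full_sub C S) = Dom1 C" "Cod1 (full_sub C S) = Cod1 C"
  "Dom2 (full_sub C S) = Dom2 C" "Cod2 (full_sub C S) = Cod2 C"
  "Id1 (full_sub C S) = Id1 C" "Comp1 (full_sub C S) = Comp1 C"
  "Id2 (full_sub C S) = Id2 C" "VComp (full_sub C S) = VComp C" "HComp (full_sub C S) = HComp C"
  by (simp_all add: full_sub_def)

lemma hom1_full_sub:
  "f \<in> hom1 (full_sub C S) A B \<longleftrightarrow> f \<in> hom1 C A B \<and> A \<in> S \<and> B \<in> S"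
  by (auto simp: full_sub_def hom1_def)

text \<open>A 2-cell belongs to the sub-2-category as soon as the ends of its domain do, and
  \<open>f\<close> already supplies them. Hence invertibility means the same in both, as
  \<open>iso2_full_sub\<close> records.\<close>

lemma hom2_full_sub:
  assumes "f \<in> hom1 (full_sub C S) A B"
  shows "hom2 (full_sub C S) f g = hom2 C f g"
  using assms by (auto simp: full_sub_def hom1_def hom2_def)

lemma hom2_full_subD: "s \<in> hom2 (full_sub C S) f g \<Longrightarrow> s \<in> hom2 C f g"
  by (auto simp: full_sub_def hom2_def)

lemma iso2_full_sub:
  assumes "f \<in> hom1 (full_sub C S) A B" "g \<in> hom1 (full_sub C S) A B"
  shows "iso2 (full_sub C S) f g s \<longleftrightarrow> iso2 C f g s"
  using assms by (simp add: iso2_def hom2_full_sub)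

lemma (in is_two_category) full_sub_two_category: "is_two_category (full_sub C S)"
proof (rule is_two_category.intro)
  fix A B assume *: "A \<in> Cell0 (full_sub C S)" "B \<in> Cell0 (full_sub C S)"
  interpret H: is_category "hom_cat C A B"
    using * by (intro hom_category) auto
  show "is_category (hom_cat (full_sub C S) A B)"
    using H.Idn_in H.Cmp_in H.Cmp_Idn H.Idn_Cmp H.Cmp_assoc
    by unfold_locales (auto simp: hom_cat_def hom1_full_sub hom2_full_sub)
next
  fix f assume "f \<in> Cell1 (full_sub C S)"
  then show "Dom1 (full_sub C S) f \<in> Cell0 (full_sub C S)" "Cod1 (full_sub C S) f \<in> Cell0 (full_sub C S)"
    using Dom1_in Cod1_in by (auto simp: full_sub_def)
next
  fix s assume "s \<in> Cell2 (full_sub C S)"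
  then show "Dom2 (full_sub C S) s \<in> Cell1 (full_sub C S)" "Cod2 (full_sub C S) s \<in> Cell1 (full_sub C S)"
    "Dom1 (full_sub C S) (Dom2 (full_sub C S) s) = Dom1 (full_sub C S) (Cod2 (full_sub C S) s) \<and>
     Cod1 (full_sub C S) (Dom2 (full_sub C S) s) = Cod1 (full_sub C S) (Cod2 (full_sub C S) s)"
    using Dom2_in Cod2_in parallel by (auto simp: full_sub_def)
next
  fix A assume "A \<in> Cell0 (full_sub C S)"
  then show "Id1 (full_sub C S) A \<in> hom1 (full_sub C S) A A"
    using Id1_in by (auto simp: hom1_full_sub)
next
  fix f f' g g' A B D s t
  assume "f \<in> hom1 (full_sub C S) A B" "g \<in> hom1 (full_sub C S) B D"
    "s \<in> hom2 (full_sub C S) f f'" "t \<in> hom2 (full_sub C S) g g'"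
  then show "t \<star>\<^bsub>full_sub C S\<^esub> s \<in> hom2 (full_sub C S) (g \<odot>\<^bsub>full_sub C S\<^esub> f) (g' \<odot>\<^bsub>full_sub C S\<^esub> f')"
    using HComp_in'[of f A B g D s f' t g'] Comp1_in[of f A B g D]
    by (subst hom2_full_sub[where A = A and B = D]) (simp_all add: hom1_full_sub hom2_full_subD)
next
  fix f f' f'' g g' g'' A B D s s' t t'
  assume "f \<in> hom1 (full_sub C S) A B" "f' \<in> hom1 (full_sub C S) A B" "f'' \<in> hom1 (full_sub C S) A B"
    "g \<in> hom1 (full_sub C S) B D" "g' \<in> hom1 (full_sub C S) B D" "g'' \<in> hom1 (full_sub C S) B D"
    "s \<in> hom2 (full_sub C S) f f'" "s' \<in> hom2 (full_sub C S) f' f''"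
    "t \<in> hom2 (full_sub C S) g g'" "t' \<in> hom2 (full_sub C S) g' g''"
  then show "(t' \<cdot>\<^bsub>full_sub C S\<^esub> t) \<star>\<^bsub>full_sub C S\<^esub> (s' \<cdot>\<^bsub>full_sub C S\<^esub> s)
      = (t' \<star>\<^bsub>full_sub C S\<^esub> s') \<cdot>\<^bsub>full_sub C S\<^esub> (t \<star>\<^bsub>full_sub C S\<^esub> s)"
    using interchange[of f A B f' f'' g D g' g'' s s' t t'] by (simp add: hom1_full_sub hom2_full_subD)
next
  fix f f' g g' h h' A B D E s t r
  assume "f \<in> hom1 (full_sub C S) A B" "g \<in> hom1 (full_sub C S) B D" "h \<in> hom1 (full_sub C S) D E"
    "s \<in> hom2 (full_sub C S) f f'" "t \<in> hom2 (full_sub C S) g g'" "r \<in> hom2 (full_sub C S) h h'"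
  then show "(r \<star>\<^bsub>full_sub C S\<^esub> t) \<star>\<^bsub>full_sub C S\<^esub> s
      = r \<star>\<^bsub>full_sub C S\<^esub> (t \<star>\<^bsub>full_sub C S\<^esub> s)"
    unfolding full_sub_simps hom1_full_sub by (blast intro: HComp_assoc' dest: hom2_full_subD)
qed (auto simp: hom1_full_sub Comp1_Id1 Id1_Comp1 Comp1_assoc HComp_Id2
    intro: Comp1_in HComp_unit_right HComp_unit_left dest!: hom2_full_subD)

text \<open>Composites and identities are literally the same on both sides, so the comparison cells
  are identities and each coherence condition reduces to the laws for identity 2-cells.\<close>

lemma (in is_two_category) inclusion_pseudofunctor:
  "is_pseudofunctor (full_sub C S) C (inclusion (full_sub C S))"
proof (rule is_pseudofunctor.intro)
  show "is_functor (hom_cat (full_sub C S) A B)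
      (hom_cat C (P0 (inclusion (full_sub C S)) A) (P0 (inclusion (full_sub C S)) B))
      (P1 (inclusion (full_sub C S))) (P2 (inclusion (full_sub C S)))" for A B
    by unfold_locales (auto simp: inclusion_def hom_cat_def hom1_full_sub dest: hom2_full_subD)
next
  fix f f' g g' A B E s t
  assume a: "f \<in> hom1 (full_sub C S) A B" "g \<in> hom1 (full_sub C S) B E"
    "f' \<in> hom1 (full_sub C S) A B" "g' \<in> hom1 (full_sub C S) B E"
    "s \<in> hom2 (full_sub C S) f f'" "t \<in> hom2 (full_sub C S) g g'"
  then have "t \<star> s \<in> hom2 C (g \<odot> f) (g' \<odot> f')" "g \<odot> f \<in> hom1 C A E"
    using HComp_in' Comp1_in by (auto simp: hom1_full_sub dest!: hom2_full_subD)
  then show "PComp (inclusion (full_sub C S)) g' f' \<cdot> (P2 (inclusion (full_sub C S)) t \<star> P2 (inclusion (full_sub C S)) s)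
     = P2 (inclusion (full_sub C S)) (t \<star>\<^bsub>full_sub C S\<^esub> s) \<cdot> PComp (inclusion (full_sub C S)) g f"
    by (simp add: inclusion_def VComp_Id2 Id2_VComp)
next
  fix f A B assume "f \<in> hom1 (full_sub C S) A B"
  then have f: "f \<in> hom1 C A B" by (simp add: hom1_full_sub)
  note f' = Id1_in[OF hom1_Cell0(1)[OF f]] Id1_in[OF hom1_Cell0(2)[OF f]] Id2_in[OF f]
  show "PComp (inclusion (full_sub C S)) f (Id1 (full_sub C S) A) \<cdot>
        (Id2 C (P1 (inclusion (full_sub C S)) f) \<star> PUnit (inclusion (full_sub C S)) A)
      = Id2 C (P1 (inclusion (full_sub C S)) f)"
    "PComp (inclusion (full_sub C S)) (Id1 (full_sub C S) B) f \<cdot>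
        (PUnit (inclusion (full_sub C S)) B \<star> Id2 C (P1 (inclusion (full_sub C S)) f))
      = Id2 C (P1 (inclusion (full_sub C S)) f)"
    using f f' HComp_unit_right[OF f f] HComp_unit_left[OF f f]
    by (simp_all add: inclusion_def Comp1_Id1 Id1_Comp1 VComp_Id2)
next
  fix f g h A B E G
  assume "f \<in> hom1 (full_sub C S) A B" "g \<in> hom1 (full_sub C S) B E" "h \<in> hom1 (full_sub C S) E G"
  then have *: "f \<in> hom1 C A B" "g \<in> hom1 C B E" "h \<in> hom1 C E G" by (auto simp: hom1_full_sub)
  then have **: "h \<odot> g \<in> hom1 C B G" "g \<odot> f \<in> hom1 C A E" "h \<odot> g \<odot> f \<in> hom1 C A G"
    by (auto intro: Comp1_in)
  show "PComp (inclusion (full_sub C S)) (h \<odot>\<^bsub>full_sub C S\<^esub> g) f \<cdot>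
       (PComp (inclusion (full_sub C S)) h g \<star> Id2 C (P1 (inclusion (full_sub C S)) f)) =
       PComp (inclusion (full_sub C S)) h (g \<odot>\<^bsub>full_sub C S\<^esub> f) \<cdot>
       (Id2 C (P1 (inclusion (full_sub C S)) h) \<star> PComp (inclusion (full_sub C S)) g f)"
    using * ** by (simp add: inclusion_def HComp_Id2 Comp1_assoc)
next
  fix f g A B E assume "f \<in> hom1 (full_sub C S) A B" "g \<in> hom1 (full_sub C S) B E"
  then show "iso2 C (P1 (inclusion (full_sub C S)) g \<odot> P1 (inclusion (full_sub C S)) f)
     (P1 (inclusion (full_sub C S)) (g \<odot>\<^bsub>full_sub C S\<^esub> f)) (PComp (inclusion (full_sub C S)) g f)"
    using iso2_Id2[OF Comp1_in[of f A B g E]] by (simp add: inclusion_def hom1_full_sub)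
next
  fix A assume "A \<in> Cell0 (full_sub C S)"
  then show "iso2 C (Id1 C (P0 (inclusion (full_sub C S)) A)) (P1 (inclusion (full_sub C S)) (Id1 (full_sub C S) A))
      (PUnit (inclusion (full_sub C S)) A)"
    using iso2_Id2[OF Id1_in] by (simp add: inclusion_def)
qed (simp add: inclusion_def)

text \<open>Only the 1-cell part of \<open>L\<close> has to be given: its action on 2-cells is forced by \<open>full_faithful\<close>.\<close>

locale strict_reflection = is_two_category C
  for C :: "('o, 'f, 't) two_cat" (structure) +
  fixes S :: "'o set" and L0 :: "'o \<Rightarrow> 'o" and L1 :: "'f \<Rightarrow> 'f" and \<eta> :: "'o \<Rightarrow> 'f"
  assumes L0_in: "A \<in> Cell0 C \<Longrightarrow> L0 A \<in> Cell0 C \<inter> S"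
    and L1_in: "f \<in> hom1 C A B \<Longrightarrow> L1 f \<in> hom1 C (L0 A) (L0 B)"
    and L1_Id1: "A \<in> Cell0 C \<Longrightarrow> L1 (Id1 C A) = Id1 C (L0 A)"
    and L1_Comp1: "\<lbrakk>f \<in> hom1 C A B; g \<in> hom1 C B D\<rbrakk> \<Longrightarrow> L1 (g \<odot> f) = L1 g \<odot> L1 f"
    and eta_in: "A \<in> Cell0 C \<Longrightarrow> \<eta> A \<in> hom1 C A (L0 A)"
    and eta_natural: "f \<in> hom1 C A B \<Longrightarrow> L1 f \<odot> \<eta> A = \<eta> B \<odot> f"
    and full_faithful: "\<lbrakk>A \<in> Cell0 C; B \<in> Cell0 C \<inter> S; f \<in> hom1 C (L0 A) B; g \<in> hom1 C (L0 A) B\<rbrakk>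
      \<Longrightarrow> bij_betw (\<lambda>s. s \<star> Id2 C (\<eta> A)) (hom2 C f g) (hom2 C (f \<odot> \<eta> A) (g \<odot> \<eta> A))"
    and ess_surj: "\<lbrakk>A \<in> Cell0 C; B \<in> Cell0 C \<inter> S; h \<in> hom1 C A B\<rbrakk>
      \<Longrightarrow> \<exists>f\<in>hom1 C (L0 A) B. \<exists>s. iso2 C (f \<odot> \<eta> A) h s"
begin

text \<open>The 2-cell field of \<open>psfun\<close> receives the 2-cell alone, so its boundary is
  read off by \<open>Dom2\<close> and its relatives. The formula inverts whiskering with the unit:
  \<open>eta_natural\<close> is an equality, so \<open>Id2 C (\<eta> B) \<star> s\<close> lies in
  the codomain of the bijection \<open>full_faithful\<close> for \<open>L1 f\<close> and
  \<open>L1 g\<close>.\<close>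

definition L2 :: "'t \<Rightarrow> 't" where
  "L2 s = (let f = Dom2 C s; g = Cod2 C s; A = Dom1 C f; B = Cod1 C f in
     the_inv_into (hom2 C (L1 f) (L1 g)) (\<lambda>t. t \<star> Id2 C (\<eta> A)) (Id2 C (\<eta> B) \<star> s))"

text \<open>The third clause is the working tool: to identify \<open>L2\<close> of a composite it
  suffices to whisker the expected 2-cell with the unit and compare.\<close>

lemma L2:
  assumes f: "f \<in> hom1 C A B" and s: "s \<in> hom2 C f g"
  shows L2_in: "L2 s \<in> hom2 C (L1 f) (L1 g)"
    and L2_eta: "L2 s \<star> Id2 C (\<eta> A) = Id2 C (\<eta> B) \<star> s"
    and L2_unique: "\<lbrakk>t \<in> hom2 C (L1 f) (L1 g); t \<star> Id2 C (\<eta> A) = Id2 C (\<eta> B) \<star> s\<rbrakk> \<Longrightarrow> L2 s = t"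
proof -
  have eq: "Dom2 C s = f" "Cod2 C s = g" "Dom1 C f = A" "Cod1 C f = B"
    using f s by (auto simp: hom1_def hom2_def)
  have g: "g \<in> hom1 C A B" using hom2_cod f s by blast
  note AB = hom1_Cell0[OF f]
  have bij: "bij_betw (\<lambda>s. s \<star> Id2 C (\<eta> A)) (hom2 C (L1 f) (L1 g)) (hom2 C (\<eta> B \<odot> f) (\<eta> B \<odot> g))"
    using full_faithful[OF AB(1) L0_in[OF AB(2)] L1_in[OF f] L1_in[OF g]] eta_natural[OF f] eta_natural[OF g]
    by simp
  have "Id2 C (\<eta> B) \<star> s \<in> hom2 C (\<eta> B \<odot> f) (\<eta> B \<odot> g)"
    using HComp_in'[OF f eta_in[OF AB(2)] s] Id2_in[OF eta_in[OF AB(2)]] by blast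
  moreover have "L2 s = the_inv_into (hom2 C (L1 f) (L1 g)) (\<lambda>s. s \<star> Id2 C (\<eta> A)) (Id2 C (\<eta> B) \<star> s)"
    unfolding L2_def Let_def eq ..
  ultimately show "L2 s \<in> hom2 C (L1 f) (L1 g)" "L2 s \<star> Id2 C (\<eta> A) = Id2 C (\<eta> B) \<star> s"
    "\<lbrakk>t \<in> hom2 C (L1 f) (L1 g); t \<star> Id2 C (\<eta> A) = Id2 C (\<eta> B) \<star> s\<rbrakk> \<Longrightarrow> L2 s = t"
    using the_inv_into_into[OF bij_betw_imp_inj_on[OF bij], of "Id2 C (\<eta> B) \<star> s" "hom2 C (L1 f) (L1 g)"]
      f_the_inv_into_f[OF bij_betw_imp_inj_on[OF bij], of "Id2 C (\<eta> B) \<star> s"]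
      the_inv_into_f_eq[OF bij_betw_imp_inj_on[OF bij], of t "Id2 C (\<eta> B) \<star> s"]
      bij_betw_imp_surj_on[OF bij] by simp_all
qed

lemma L2_Id2:
  assumes f: "f \<in> hom1 C A B" shows "L2 (Id2 C f) = Id2 C (L1 f)"
proof (rule L2_unique[OF f Id2_in[OF f] Id2_in[OF L1_in[OF f]]])
  note AB = hom1_Cell0[OF f]
  show "Id2 C (L1 f) \<star> Id2 C (\<eta> A) = Id2 C (\<eta> B) \<star> Id2 C f"
    using HComp_Id2[OF eta_in[OF AB(1)] L1_in[OF f]] HComp_Id2[OF f eta_in[OF AB(2)]]
    by (simp add: eta_natural[OF f])
qed

lemma L2_VComp:
  assumes f: "f \<in> hom1 C A B" and s: "s \<in> hom2 C f g" and t: "t \<in> hom2 C g h"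
  shows "L2 (t \<cdot> s) = L2 t \<cdot> L2 s"
proof (rule L2_unique[OF f VComp_in[OF f s t]])
  have g: "g \<in> hom1 C A B" using hom2_cod f s by blast
  note AB = hom1_Cell0[OF f]
  show "L2 t \<cdot> L2 s \<in> hom2 C (L1 f) (L1 h)"
    using L1_in[OF f] L2_in[OF f s] L2_in[OF g t] by (rule VComp_in)
  show "(L2 t \<cdot> L2 s) \<star> Id2 C (\<eta> A) = Id2 C (\<eta> B) \<star> (t \<cdot> s)"
    by (simp only: whisker_VComp[OF eta_in[OF AB(1)] L1_in[OF f] L2_in[OF f s] L2_in[OF g t]]
        VComp_whisker[OF f eta_in[OF AB(2)] s t] L2_eta[OF f s] L2_eta[OF g t])
qed

text \<open>The unit slides past the two factors in turn: \<open>L2_eta\<close> moves it across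
  \<open>L2 s\<close>, associativity brings it next to \<open>L2 t\<close>, and
  \<open>L2_eta\<close> moves it across that factor as well.\<close>

lemma L2_HComp:
  assumes f: "f \<in> hom1 C A B" and g: "g \<in> hom1 C B D"
    and s: "s \<in> hom2 C f f'" and t: "t \<in> hom2 C g g'"
  shows "L2 (t \<star> s) = L2 t \<star> L2 s"
proof (rule L2_unique[OF Comp1_in[OF f g] HComp_in'[OF f g s t]])
  note AB = hom1_Cell0[OF f] and D = hom1_Cell0(2)[OF g]
  note \<eta> = AB[THEN eta_in] D[THEN eta_in]
  note \<eta>2 = \<eta>[THEN Id2_in]
  show "L2 t \<star> L2 s \<in> hom2 C (L1 (g \<odot> f)) (L1 (g' \<odot> f'))"
    using HComp_in'[OF L1_in[OF f] L1_in[OF g] L2_in[OF f s] L2_in[OF g t]]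
    by (simp add: L1_Comp1[OF f g] L1_Comp1[OF hom2_cod[OF s f] hom2_cod[OF t g]])
  have "(L2 t \<star> L2 s) \<star> Id2 C (\<eta> A) = L2 t \<star> (L2 s \<star> Id2 C (\<eta> A))"
    by (rule HComp_assoc'[OF \<eta>(1) L1_in[OF f] L1_in[OF g] \<eta>2(1) L2_in[OF f s] L2_in[OF g t]])
  also have "\<dots> = (L2 t \<star> Id2 C (\<eta> B)) \<star> s"
    using HComp_assoc'[OF f \<eta>(2) L1_in[OF g] s \<eta>2(2) L2_in[OF g t]] L2_eta[OF f s] by simp
  also have "\<dots> = Id2 C (\<eta> D) \<star> (t \<star> s)"
    using HComp_assoc'[OF f g \<eta>(3) s t \<eta>2(3)] L2_eta[OF g t] by simp
  finally show "(L2 t \<star> L2 s) \<star> Id2 C (\<eta> A) = Id2 C (\<eta> D) \<star> (t \<star> s)" .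
qed

definition reflector :: "('o, 'f, 't, 'o, 'f, 't) psfun" where
  "reflector = \<lparr>P0 = L0, P1 = L1, P2 = L2, PComp = (\<lambda>g f. Id2 C (L1 g \<odot> L1 f)),
     PUnit = (\<lambda>A. Id2 C (Id1 C (L0 A)))\<rparr>"

lemma reflector_simps [simp]:
  "P0 reflector = L0" "P1 reflector = L1" "P2 reflector = L2"
  "PComp reflector g f = Id2 C (L1 g \<odot> L1 f)" "PUnit reflector A = Id2 C (Id1 C (L0 A))"
  by (simp_all add: reflector_def)

lemma L1_full_sub: "f \<in> hom1 C A B \<Longrightarrow> L1 f \<in> hom1 (full_sub C S) (L0 A) (L0 B)"
  using L1_in[of f A B] L0_in hom1_Cell0[of f A B] by (auto simp: hom1_full_sub)

lemma reflector_pseudofunctor: "is_pseudofunctor C (full_sub C S) reflector"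
proof (rule is_pseudofunctor.intro)
  fix A B assume "A \<in> Cell0 C" "B \<in> Cell0 C"
  show "is_functor (hom_cat C A B) (hom_cat (full_sub C S) (P0 reflector A) (P0 reflector B))
      (P1 reflector) (P2 reflector)"
  proof
    fix f assume "f \<in> Ob (hom_cat C A B)"
    then have f: "f \<in> hom1 C A B" by (simp add: hom_cat_def)
    show "P1 reflector f \<in> Ob (hom_cat (full_sub C S) (P0 reflector A) (P0 reflector B))"
      "P2 reflector (Idn (hom_cat C A B) f)
        = Idn (hom_cat (full_sub C S) (P0 reflector A) (P0 reflector B)) (P1 reflector f)"
      using f by (simp_all add: hom_cat_def L1_full_sub L2_Id2)
    fix g s assume "s \<in> Ar (hom_cat C A B) f g"
    then have s: "s \<in> hom2 C f g" by (simp add: hom_cat_def)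
    show "P2 reflector s \<in> Ar (hom_cat (full_sub C S) (P0 reflector A) (P0 reflector B))
        (P1 reflector f) (P1 reflector g)"
      using f s by (simp add: hom_cat_def hom2_full_sub[OF L1_full_sub] L2_in)
    fix h t assume "t \<in> Ar (hom_cat C A B) g h"
    then have t: "t \<in> hom2 C g h" by (simp add: hom_cat_def)
    show "P2 reflector (Cmp (hom_cat C A B) t s)
        = Cmp (hom_cat (full_sub C S) (P0 reflector A) (P0 reflector B)) (P2 reflector t) (P2 reflector s)"
      using f s t by (simp add: hom_cat_def L2_VComp)
  qed
next
  fix f g A B E
  assume *: "f \<in> hom1 C A B" "g \<in> hom1 C B E"
  then have "L1 g \<odot> L1 f \<in> hom1 C (L0 A) (L0 E)"
    by (intro Comp1_in[of _ _ "L0 B"] L1_in) auto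
  moreover have "L1 g \<odot> L1 f \<in> hom1 (full_sub C S) (L0 A) (L0 E)"
    using L1_full_sub[OF Comp1_in[OF *]] by (simp add: L1_Comp1[OF *])
  ultimately show "iso2 (full_sub C S) (P1 reflector g \<odot>\<^bsub>full_sub C S\<^esub> P1 reflector f)
      (P1 reflector (g \<odot> f)) (PComp reflector g f)"
    by (simp add: L1_Comp1[OF *] iso2_full_sub iso2_Id2)
  fix f' g' s t assume f': "f' \<in> hom1 C A B" "g' \<in> hom1 C B E" "s \<in> hom2 C f f'" "t \<in> hom2 C g g'"
  have *: "L2 t \<star> L2 s \<in> hom2 C (L1 g \<odot> L1 f) (L1 g' \<odot> L1 f')"
    using * f' by (intro HComp_in'[of _ "L0 A" "L0 B" _ "L0 E"] L1_in L2_in) auto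
  with \<open>L1 g \<odot> L1 f \<in> hom1 C (L0 A) (L0 E)\<close>
  show "PComp reflector g' f' \<cdot>\<^bsub>full_sub C S\<^esub> (P2 reflector t \<star>\<^bsub>full_sub C S\<^esub> P2 reflector s) =
      P2 reflector (t \<star> s) \<cdot>\<^bsub>full_sub C S\<^esub> PComp reflector g f"
    using VComp_Id2 Id2_VComp L2_HComp[OF \<open>f \<in> hom1 C A B\<close> \<open>g \<in> hom1 C B E\<close> f'(3,4)] by simp
next
  fix A assume *: "A \<in> Cell0 C"
  then have "Id1 C (L0 A) \<in> hom1 C (L0 A) (L0 A)" using L0_in by (auto intro: Id1_in)
  with * show "iso2 (full_sub C S) (Id1 (full_sub C S) (P0 reflector A)) (P1 reflector (Id1 C A)) (PUnit reflector A)"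
    using L0_in by (simp add: L1_Id1 iso2_full_sub[where A = "L0 A" and B = "L0 A"] iso2_Id2 hom1_full_sub)
next
  fix f A B assume *: "f \<in> hom1 C A B"
  note f = L1_in[OF *] and A = hom1_Cell0[OF *]
  note f' = Id1_in[OF hom1_Cell0(1)[OF f]] Id1_in[OF hom1_Cell0(2)[OF f]] Id2_in[OF f]
  show "PComp reflector f (Id1 C A) \<cdot>\<^bsub>full_sub C S\<^esub> (Id2 (full_sub C S) (P1 reflector f)
      \<star>\<^bsub>full_sub C S\<^esub> PUnit reflector A) = Id2 (full_sub C S) (P1 reflector f)"
    "PComp reflector (Id1 C B) f \<cdot>\<^bsub>full_sub C S\<^esub>
        (PUnit reflector B \<star>\<^bsub>full_sub C S\<^esub> Id2 (full_sub C S) (P1 reflector f))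
      = Id2 (full_sub C S) (P1 reflector f)"
    using f f' A HComp_unit_right[OF f f] HComp_unit_left[OF f f]
    by (simp_all add: L1_Id1 Comp1_Id1 Id1_Comp1 VComp_Id2)
next
  fix f g h A B E G
  assume *: "f \<in> hom1 C A B" "g \<in> hom1 C B E" "h \<in> hom1 C E G"
  note L = L1_in[OF *(1)] L1_in[OF *(2)] L1_in[OF *(3)]
  have **: "L1 h \<odot> L1 g \<in> hom1 C (L0 B) (L0 G)" "L1 g \<odot> L1 f \<in> hom1 C (L0 A) (L0 E)"
    "L1 h \<odot> L1 g \<odot> L1 f \<in> hom1 C (L0 A) (L0 G)"
    using L by (auto intro: Comp1_in)
  show "PComp reflector (h \<odot> g) f \<cdot>\<^bsub>full_sub C S\<^esub> (PComp reflector h g \<star>\<^bsub>full_sub C S\<^esub> Id2 (full_sub C S) (P1 reflector f)) =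
       PComp reflector h (g \<odot> f) \<cdot>\<^bsub>full_sub C S\<^esub> (Id2 (full_sub C S) (P1 reflector h) \<star>\<^bsub>full_sub C S\<^esub> PComp reflector g f)"
    using * ** L by (simp add: L1_Comp1 HComp_Id2[of _ "L0 B"] HComp_Id2[of _ _ "L0 E"] HComp_Id2 Comp1_assoc)
qed (use L0_in in auto)

text \<open>The comparison functor is precomposition with the unit. By \<open>factor\<close> the two
  ends of each pseudonaturality cell are one and the same 1-cell, so both coherence laws compare
  identity 2-cells. Among the conditions on \<open>\<theta>\<close> it is naturality that has
  content, and it comes down to \<open>L2_eta\<close>.\<close>

theorem reflector_left_biadjoint:
  "is_left_biadjoint C (full_sub C S) reflector (inclusion (full_sub C S))"
proof -
  let ?D = "full_sub C S"
  define \<Phi>0 where "\<Phi>0 A B f = f \<odot> \<eta> A" for A and B :: 'o and f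
  define \<Phi>1 where "\<Phi>1 A B s = s \<star> Id2 C (\<eta> A)" for A and B :: 'o and s
  \<comment> \<open>The object \<open>A\<close> is not among the arguments of a pseudonaturality
    cell; it is recovered as the codomain of \<open>u\<close>.\<close>
  define \<theta> where "\<theta> u v f = Id2 C (v \<odot> (f \<odot> \<eta> (Cod1 C u)) \<odot> u)" for u v f
  interpret D: is_two_category ?D by (rule full_sub_two_category)
  interpret L: is_pseudofunctor C ?D reflector by (rule reflector_pseudofunctor)
  interpret U: is_pseudofunctor ?D C "inclusion ?D" by (rule inclusion_pseudofunctor)
  have factor: "(v \<odot> f \<odot> L1 u) \<odot> \<eta> A' = v \<odot> (f \<odot> \<eta> A) \<odot> u"
    if "A \<in> Cell0 C" "u \<in> hom1 C A' A" "v \<in> hom1 C B B'" "f \<in> hom1 C (L0 A) B" for A A' B B' u v f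
  proof -
    note A' = hom1_Cell0(1)[OF that(2)]
    note fu = Comp1_in[OF L1_in[OF that(2)] that(4)]
    show ?thesis
      using Comp1_assoc[OF eta_in[OF A'] fu that(3)] Comp1_assoc[OF eta_in[OF A'] L1_in[OF that(2)] that(4)]
        Comp1_assoc[OF that(2) eta_in[OF that(1)] that(4)] eta_natural[OF that(2)] by simp
  qed
  have cell: "v \<odot> (f \<odot> \<eta> A) \<odot> u \<in> hom1 C A' B'"
    if "A \<in> Cell0 C" "u \<in> hom1 C A' A" "v \<in> hom1 C B B'" "f \<in> hom1 C (L0 A) B" for A A' B B' u v f
    using that by (intro Comp1_in[of _ _ B] Comp1_in[of _ _ A] Comp1_in[of _ _ "L0 A"] eta_in)
  have theta: "\<theta> u v f = Id2 C (v \<odot> (f \<odot> \<eta> A) \<odot> u)" if "u \<in> hom1 C A' A" for u v f A A'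
    using that unfolding \<theta>_def by (auto simp: hom1_def)
  have "is_biadjunction C ?D reflector (inclusion ?D) \<Phi>0 \<Phi>1 \<theta>"
  proof
    fix A B assume *: "A \<in> Cell0 C" "B \<in> Cell0 ?D"
    then have B: "B \<in> Cell0 C" "B \<in> S" by auto
    note LA = L0_in[OF *(1)]
    have hom: "f \<in> hom1 ?D (L0 A) B \<longleftrightarrow> f \<in> hom1 C (L0 A) B" for f
      using LA B by (simp add: hom1_full_sub)
    have hom2: "hom2 ?D f g = hom2 C f g" if "f \<in> hom1 C (L0 A) B" for f g
      using that hom hom2_full_sub by metis
    have func: "is_functor (hom_cat ?D (L0 A) B) (hom_cat C A B) (\<Phi>0 A B) (\<Phi>1 A B)"
    proof
      fix f assume "f \<in> Ob (hom_cat ?D (L0 A) B)"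
      then have f: "f \<in> hom1 C (L0 A) B" using hom by (simp add: hom_cat_def)
      show "\<Phi>0 A B f \<in> Ob (hom_cat C A B)"
        using f eta_in[OF *(1)] by (auto simp: \<Phi>0_def hom_cat_def intro: Comp1_in)
      show "\<Phi>1 A B (Idn (hom_cat ?D (L0 A) B) f) = Idn (hom_cat C A B) (\<Phi>0 A B f)"
        using f eta_in[OF *(1)] by (simp add: \<Phi>0_def \<Phi>1_def hom_cat_def HComp_Id2)
    next
      fix f g s assume "f \<in> Ob (hom_cat ?D (L0 A) B)" "s \<in> Ar (hom_cat ?D (L0 A) B) f g"
      then have "f \<in> hom1 C (L0 A) B" "s \<in> hom2 C f g" using hom hom2 by (auto simp: hom_cat_def)
      then show "\<Phi>1 A B s \<in> Ar (hom_cat C A B) (\<Phi>0 A B f) (\<Phi>0 A B g)"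
        using HComp_in'[OF eta_in[OF *(1)]] Id2_in[OF eta_in[OF *(1)]]
        by (auto simp: \<Phi>0_def \<Phi>1_def hom_cat_def)
    next
      fix f g h s t assume "f \<in> Ob (hom_cat ?D (L0 A) B)" "g \<in> Ob (hom_cat ?D (L0 A) B)"
        "s \<in> Ar (hom_cat ?D (L0 A) B) f g" "t \<in> Ar (hom_cat ?D (L0 A) B) g h"
      then have "f \<in> hom1 C (L0 A) B" "s \<in> hom2 C f g" "t \<in> hom2 C g h"
        using hom hom2 by (auto simp: hom_cat_def)
      then show "\<Phi>1 A B (Cmp (hom_cat ?D (L0 A) B) t s) = Cmp (hom_cat C A B) (\<Phi>1 A B t) (\<Phi>1 A B s)"
        using whisker_VComp[OF eta_in[OF *(1)]] by (simp add: \<Phi>1_def hom_cat_def)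
    qed
    have "is_equivalence (hom_cat ?D (L0 A) B) (hom_cat C A B) (\<Phi>0 A B) (\<Phi>1 A B)"
    proof (rule is_equivalenceI[OF D.hom_category hom_category func])
      fix f g assume "f \<in> Ob (hom_cat ?D (L0 A) B)" "g \<in> Ob (hom_cat ?D (L0 A) B)"
      then show "bij_betw (\<Phi>1 A B) (Ar (hom_cat ?D (L0 A) B) f g)
          (Ar (hom_cat C A B) (\<Phi>0 A B f) (\<Phi>0 A B g))"
        using full_faithful[OF *(1), of B f g] B hom hom2
        by (simp add: hom_cat_def \<Phi>0_def \<Phi>1_def[abs_def])
    next
      fix h assume "h \<in> Ob (hom_cat C A B)"
      then show "\<exists>f\<in>Ob (hom_cat ?D (L0 A) B). \<exists>s. is_iso (hom_cat C A B) (\<Phi>0 A B f) h s"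
        using ess_surj[OF *(1), of B h] B hom
        by (auto simp: hom_cat_def \<Phi>0_def is_iso_def iso2_def)
    next
      show "Dom2 C s = f" "Cod2 C s = g" if "s \<in> Ar (hom_cat C A B) f g" for f g s
        using that by (auto simp: hom_cat_def hom2_def)
    qed (use * LA in auto)
    then show "is_equivalence (hom_cat ?D (P0 reflector A) B) (hom_cat C A (P0 (inclusion ?D) B)) (\<Phi>0 A B) (\<Phi>1 A B)"
      by (simp add: inclusion_def)
  next
    fix A A' B B' u v f
    assume "A \<in> Cell0 C" "u \<in> hom1 C A' A" "v \<in> hom1 ?D B B'" "f \<in> hom1 ?D (P0 reflector A) B"
    then have *: "A \<in> Cell0 C" "u \<in> hom1 C A' A" "v \<in> hom1 C B B'" "f \<in> hom1 C (L0 A) B"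
      by (auto simp: hom1_full_sub)
    show "iso2 C (\<Phi>0 A' B' (v \<odot>\<^bsub>?D\<^esub> f \<odot>\<^bsub>?D\<^esub> P1 reflector u)) (P1 (inclusion ?D) v \<odot> \<Phi>0 A B f \<odot> u) (\<theta> u v f)"
      using iso2_Id2[OF cell[OF *]] by (simp add: theta[OF *(2)] \<Phi>0_def inclusion_def factor[OF *])
  next
    fix A A' B B' u u' v v' f f' r s t
    assume "A \<in> Cell0 C" "u \<in> hom1 C A' A" "u' \<in> hom1 C A' A"
        "v \<in> hom1 ?D B B'" "v' \<in> hom1 ?D B B'"
        "f \<in> hom1 ?D (P0 reflector A) B" "f' \<in> hom1 ?D (P0 reflector A) B"
        "r \<in> hom2 C u u'" "s \<in> hom2 ?D v v'" "t \<in> hom2 ?D f f'"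
    then have *: "A \<in> Cell0 C" "u \<in> hom1 C A' A" "u' \<in> hom1 C A' A"
        "v \<in> hom1 C B B'" "v' \<in> hom1 C B B'"
        "f \<in> hom1 C (L0 A) B" "f' \<in> hom1 C (L0 A) B"
        "r \<in> hom2 C u u'" "s \<in> hom2 C v v'" "t \<in> hom2 C f f'"
      by (auto simp: hom1_full_sub dest: hom2_full_subD)
    note A' = hom1_Cell0(1)[OF *(2)]
    note \<eta> = eta_in[OF *(1)] eta_in[OF A']
    note \<eta>2 = \<eta>[THEN Id2_in]
    \<comment> \<open>The unit travels inward until it meets \<open>L2 r\<close>, where
      \<open>L2_eta\<close> turns it into the unit at \<open>A\<close> on the other side of
      \<open>r\<close>.\<close>
    have "(s \<star> t \<star> L2 r) \<star> Id2 C (\<eta> A') = s \<star> (t \<star> L2 r) \<star> Id2 C (\<eta> A')"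
      by (rule HComp_assoc'[OF \<eta>(2) Comp1_in[OF L1_in[OF *(2)] *(6)] *(4) \<eta>2(2)
          HComp_in'[OF L1_in[OF *(2)] *(6) L2_in[OF *(2,8)] *(10)] *(9)])
    also have "(t \<star> L2 r) \<star> Id2 C (\<eta> A') = t \<star> Id2 C (\<eta> A) \<star> r"
      using HComp_assoc'[OF \<eta>(2) L1_in[OF *(2)] *(6) \<eta>2(2) L2_in[OF *(2,8)] *(10)]
      by (simp add: L2_eta[OF *(2,8)])
    also have "\<dots> = (t \<star> Id2 C (\<eta> A)) \<star> r"
      by (rule HComp_assoc'[OF *(2) \<eta>(1) *(6,8) \<eta>2(1) *(10), symmetric])
    finally have eq: "(s \<star> t \<star> L2 r) \<star> Id2 C (\<eta> A') = s \<star> (t \<star> Id2 C (\<eta> A)) \<star> r" .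
    have "s \<star> (t \<star> Id2 C (\<eta> A)) \<star> r \<in> hom2 C (v \<odot> (f \<odot> \<eta> A) \<odot> u) (v' \<odot> (f' \<odot> \<eta> A) \<odot> u')"
      using * \<eta>(1) \<eta>2(1)
      by (intro HComp_in'[of _ A' B _ B'] HComp_in'[of _ A' A _ B] HComp_in'[of _ A "L0 A" _ B] Comp1_in) auto
    then show "\<theta> u' v' f' \<cdot> \<Phi>1 A' B' (s \<star>\<^bsub>?D\<^esub> t \<star>\<^bsub>?D\<^esub> P2 reflector r)
        = (P2 (inclusion ?D) s \<star> \<Phi>1 A B t \<star> r) \<cdot> \<theta> u v f"
      using VComp_Id2[OF cell[OF *(1,2,4,6)]] Id2_VComp[OF cell[OF *(1,2,4,6)]]
      by (simp add: theta[OF *(2)] theta[OF *(3)] \<Phi>1_def inclusion_def eq)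
  next
    fix A B f assume "A \<in> Cell0 C" "f \<in> hom1 ?D (P0 reflector A) B"
    then have *: "A \<in> Cell0 C" "f \<in> hom1 C (L0 A) B" by (auto simp: hom1_full_sub)
    note i = Id1_in[OF *(1)] Id1_in[OF hom1_Cell0(1)[OF *(2)]] Id1_in[OF hom1_Cell0(2)[OF *(2)]]
    note f\<eta> = Comp1_in[OF eta_in[OF *(1)] *(2)]
    show "\<theta> (Id1 C A) (Id1 ?D B) f \<cdot> \<Phi>1 A B (Id2 ?D (Id1 ?D B) \<star>\<^bsub>?D\<^esub> Id2 ?D f \<star>\<^bsub>?D\<^esub> PUnit reflector A)
        = PUnit (inclusion ?D) B \<star> Id2 C (\<Phi>0 A B f) \<star> Id2 C (Id1 C A)"
      using HComp_Id2[OF i(2) *(2)] HComp_Id2[OF *(2) i(3)] HComp_Id2[OF eta_in[OF *(1)] *(2)]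
        HComp_Id2[OF i(1) f\<eta>] HComp_Id2[OF f\<eta> i(3)] VComp_Id2[OF f\<eta> Id2_in[OF f\<eta>]]
      by (simp add: theta[OF i(1)] \<Phi>0_def \<Phi>1_def inclusion_def Comp1_Id1[OF *(2)] Id1_Comp1[OF *(2)]
          Comp1_Id1[OF f\<eta>] Id1_Comp1[OF f\<eta>])
  next
    fix A A' A'' B B' B'' u u' v v' f
    assume "A \<in> Cell0 C" "u \<in> hom1 C A' A" "u' \<in> hom1 C A'' A'"
        "v \<in> hom1 ?D B B'" "v' \<in> hom1 ?D B' B''" "f \<in> hom1 ?D (P0 reflector A) B"
    then have *: "A \<in> Cell0 C" "u \<in> hom1 C A' A" "u' \<in> hom1 C A'' A'"
        "v \<in> hom1 C B B'" "v' \<in> hom1 C B' B''" "f \<in> hom1 C (L0 A) B"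
      by (auto simp: hom1_full_sub)
    note uu = Comp1_in[OF *(3,2)] and vv = Comp1_in[OF *(4,5)]
    note A' = hom1_Cell0(1)[OF *(2)]
    note f\<eta> = Comp1_in[OF eta_in[OF *(1)] *(6)]
    note g = Comp1_in[OF Comp1_in[OF L1_in[OF *(2)] *(6)] *(4)]
    have "\<Phi>1 A'' B'' (Id2 C (v' \<odot> v) \<star> Id2 C f \<star> Id2 C (L1 u \<odot> L1 u'))
        = Id2 C (((v' \<odot> v) \<odot> f \<odot> L1 (u \<odot> u')) \<odot> \<eta> A'')"
      using HComp_Id2[OF L1_in[OF uu] *(6)] HComp_Id2[OF Comp1_in[OF L1_in[OF uu] *(6)] vv]
        HComp_Id2[OF eta_in[OF hom1_Cell0(1)[OF *(3)]] Comp1_in[OF Comp1_in[OF L1_in[OF uu] *(6)] vv]]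
      by (simp add: \<Phi>1_def L1_Comp1[OF *(3,2)])
    also have "\<dots> = Id2 C ((v' \<odot> v) \<odot> (f \<odot> \<eta> A) \<odot> u \<odot> u')"
      by (simp add: factor[OF *(1) uu vv *(6)])
    finally have 1: "\<Phi>1 A'' B'' (Id2 C (v' \<odot> v) \<star> Id2 C f \<star> Id2 C (L1 u \<odot> L1 u'))
        = Id2 C ((v' \<odot> v) \<odot> (f \<odot> \<eta> A) \<odot> u \<odot> u')" .
    have 2: "Id2 C (v' \<odot> v) \<star> Id2 C ((f \<odot> \<eta> A) \<odot> u \<odot> u')
        = Id2 C ((v' \<odot> v) \<odot> (f \<odot> \<eta> A) \<odot> u \<odot> u')"
      by (rule HComp_Id2[OF Comp1_in[OF uu f\<eta>] vv])
    \<comment> \<open>The composition axiom compares identity 2-cells, and this associativity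
      identifies the 1-cells on which they live.\<close>
    have 3: "(v' \<odot> v) \<odot> (f \<odot> \<eta> A) \<odot> u \<odot> u' = v' \<odot> (v \<odot> (f \<odot> \<eta> A) \<odot> u) \<odot> u'"
      using Comp1_assoc[OF Comp1_in[OF uu f\<eta>] *(4,5)] Comp1_assoc[OF *(3) Comp1_in[OF *(2) f\<eta>] *(4)]
        Comp1_assoc[OF *(3,2) f\<eta>] by simp
    have 4: "Id2 C v' \<star> Id2 C (v \<odot> (f \<odot> \<eta> A) \<odot> u) \<star> Id2 C u' = Id2 C (v' \<odot> (v \<odot> (f \<odot> \<eta> A) \<odot> u) \<odot> u')"
      using HComp_Id2[OF *(3) cell[OF *(1,2,4,6)]]
        HComp_Id2[OF Comp1_in[OF *(3) cell[OF *(1,2,4,6)]] *(5)] by simp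
    have 5: "\<theta> u' v' (v \<odot> f \<odot> L1 u) = Id2 C (v' \<odot> (v \<odot> (f \<odot> \<eta> A) \<odot> u) \<odot> u')"
      by (simp add: theta[OF *(3)] factor[OF *(1,2,4,6)])
    note c = Comp1_in[OF Comp1_in[OF *(3) cell[OF *(1,2,4,6)]] *(5)]
    show "\<theta> (u \<odot> u') (v' \<odot>\<^bsub>?D\<^esub> v) f
            \<cdot> \<Phi>1 A'' B'' (Id2 ?D (v' \<odot>\<^bsub>?D\<^esub> v) \<star>\<^bsub>?D\<^esub> Id2 ?D f \<star>\<^bsub>?D\<^esub> PComp reflector u u')
        = (PComp (inclusion ?D) v' v \<star> Id2 C (\<Phi>0 A B f \<odot> u \<odot> u'))
            \<cdot> (Id2 C (P1 (inclusion ?D) v') \<star> \<theta> u v f \<star> Id2 C u')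
            \<cdot> \<theta> u' v' (v \<odot>\<^bsub>?D\<^esub> f \<odot>\<^bsub>?D\<^esub> P1 reflector u)"
      using VComp_Id2[OF c Id2_in[OF c]]
      by (simp add: inclusion_def 1 2 \<Phi>0_def theta[OF uu] theta[OF *(2)] 3 4 5)
  qed
  then show ?thesis unfolding is_left_biadjoint_def by blast
qed

end

section \<open>The 2-category of enriched categories\<close>

text \<open>Keeps the degree \<open>1\<close> of unary maps from being rewritten to \<open>Suc 0\<close>.\<close>

declare One_nat_def [simp del]

section \<open>Projections and the calculus of substitution\<close>

lemma Tup_single [simp]: "[f] \<in> Tup M m n X Y \<longleftrightarrow> m = 1 \<and> f \<in> Hom M n X Y"
  by (auto simp: Tup_def)

lemma Tup_length: "fs \<in> Tup M m n X Y \<Longrightarrow> length fs = m"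
  by (simp add: Tup_def)

lemma Tup_nth: "\<lbrakk>fs \<in> Tup M m n X Y; i < m\<rbrakk> \<Longrightarrow> fs ! i \<in> Hom M n X Y"
  by (auto simp: Tup_def)

lemma Tup_memD: "\<lbrakk>fs \<in> Tup M m n X Y; f \<in> set fs\<rbrakk> \<Longrightarrow> f \<in> Hom M n X Y"
  by (auto simp: Tup_def)

lemma Tup_map:
  assumes "fs \<in> Tup M m n X Y" "\<And>f. f \<in> Hom M n X Y \<Longrightarrow> h f \<in> Hom M' n' X' Y'"
  shows "map h fs \<in> Tup M' m n' X' Y'"
  using assms by (auto simp: Tup_def)

lemma Tup_map_upt:
  assumes "\<And>i. i < m \<Longrightarrow> h i \<in> Hom M n X Y"
  shows "map h [0..<m] \<in> Tup M m n X Y"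
  using assms by (auto simp: Tup_def)

context is_fset_category
begin

lemma Prj_in:
  assumes "X \<in> Obj M" "i < n" shows "Prj M X n i \<in> Hom M n X X"
  unfolding Prj_def using assms by (intro Act_in Unt_in) (auto simp: FinMap_def)

lemma Prjs_in: "X \<in> Obj M \<Longrightarrow> Prjs M X n \<in> Tup M n n X X"
  unfolding Prjs_def by (intro Tup_map_upt Prj_in)

lemma Prj_Unt: 
  assumes "X \<in> Obj M" shows "Prj M X 1 0 = Unt M X"
proof -
  have "(\<lambda>j\<in>{..<1}. 0) = (\<lambda>i\<in>{..<1::nat}. i)" by (rule restrict_ext) auto
  then show ?thesis
    unfolding Prj_def using assms by (metis Act_id Unt_in)
qed

lemma Prjs_1: "X \<in> Obj M \<Longrightarrow> Prjs M X 1 = [Unt M X]"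
  using Prj_Unt[of X] by (simp add: Prjs_def One_nat_def)

lemma Sub_Unt: "\<lbrakk>X \<in> Obj M; Y \<in> Obj M; f \<in> Hom M n X Y\<rbrakk> \<Longrightarrow> Sub M X Y Y n (Unt M Y) [f] = f"
  using Sub_Prj[of X Y "[f]" 1 n 0] by (simp add: Prj_Unt)

lemma Sub_Unt_right: "\<lbrakk>X \<in> Obj M; Y \<in> Obj M; g \<in> Hom M 1 X Y\<rbrakk> \<Longrightarrow> Sub M X X Y 1 g [Unt M X] = g"
  using Sub_Prjs[of X Y g 1] by (simp add: Prjs_1)

text \<open>Apply dinaturality to the full tuple of projections, whose substitution changes nothing.
  Reindexing thereby becomes a substitution and can be handled by the substitution laws, as in
  \<open>Act_Prj\<close>.\<close>

lemma Act_eq_Sub: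
  assumes "X \<in> Obj M" "Y \<in> Obj M" "\<phi> \<in> FinMap n m" "f \<in> Hom M n X Y"
  shows "Act M X Y n m \<phi> f = Sub M X X Y m f (map (\<lambda>i. Prj M X m (\<phi> i)) [0..<n])"
proof -
  have "\<phi> i < m" if "i < n" for i using assms(3) that by (auto simp: FinMap_def)
  then have "map (\<lambda>i. Prjs M X m ! \<phi> i) [0..<n] = map (\<lambda>i. Prj M X m (\<phi> i)) [0..<n]"
    by (simp add: Prjs_def)
  then show ?thesis
    using Sub_dinatural[OF assms(1,1,2,3,4) Prjs_in[OF assms(1)]] Sub_Prjs[OF assms(1,2) Act_in[OF assms]]
    by metis
qed

lemma Act_Prj:
  assumes "X \<in> Obj M" "\<phi> \<in> FinMap n m" "i < n"
  shows "Act M X X n m \<phi> (Prj M X n i) = Prj M X m (\<phi> i)"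
proof -
  have "\<phi> j < m" if "j < n" for j using assms that by (auto simp: FinMap_def)
  then show ?thesis
    using assms Sub_Prj[of X X "map (\<lambda>i. Prj M X m (\<phi> i)) [0..<n]" n m i]
    by (simp add: Act_eq_Sub Prj_in Tup_map_upt)
qed

lemma Sub_assoc1:
  assumes "W \<in> Obj M" "X \<in> Obj M" "Y \<in> Obj M" "Z \<in> Obj M"
    "h \<in> Hom M 1 Y Z" "g \<in> Hom M k X Y" "fs \<in> Tup M k n W X"
  shows "Sub M W Y Z n h [Sub M W X Y n g fs] = Sub M W X Z n (Sub M X Y Z k h [g]) fs"
  using Sub_assoc[OF assms(1-5), of "[g]" k fs n] assms by simp

lemma Sub_assoc11:
  assumes "W \<in> Obj M" "X \<in> Obj M" "Y \<in> Obj M" "Z \<in> Obj M"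
    "h \<in> Hom M 1 Y Z" "g \<in> Hom M 1 X Y" "f \<in> Hom M n W X"
  shows "Sub M W Y Z n h [Sub M W X Y n g [f]] = Sub M W X Z n (Sub M X Y Z 1 h [g]) [f]"
  using assms by (intro Sub_assoc1) auto

lemma Sub_Prj_map:
  assumes "X \<in> Obj M" "Y \<in> Obj M" "fs \<in> Tup M n k X Y"
  shows "map (\<lambda>p. Sub M X Y Y k p fs) (Prjs M Y n) = fs"
  using assms by (auto intro: nth_equalityI simp: Prjs_def Sub_Prj Tup_length)

lemma Sub_Act_single:
  assumes "X \<in> Obj M" "Y \<in> Obj M" "Z \<in> Obj M" "\<psi> \<in> FinMap n n'" "g \<in> Hom M 1 Y Z" "f \<in> Hom M n X Y"
  shows "Sub M X Y Z n' g [Act M X Y n n' \<psi> f] = Act M X Z n n' \<psi> (Sub M X Y Z n g [f])"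
  using Sub_natural[of X Y Z \<psi> n n' g 1 "[f]"] assms by simp

lemma Sub_single_in:
  assumes "X \<in> Obj M" "Y \<in> Obj M" "Z \<in> Obj M" "g \<in> Hom M 1 Y Z" "f \<in> Hom M n X Y"
  shows "Sub M X Y Z n g [f] \<in> Hom M n X Z"
  using assms Sub_in[of X Y Z g 1 "[f]" n] by simp

end

lemma FHom_restrict_apply [simp]:
  "\<lbrakk>X \<in> Obj M; Y \<in> Obj M; f \<in> Hom M n X Y\<rbrakk> \<Longrightarrow> FHom_restrict M h n X Y f = h n X Y f"
  by (simp add: FHom_restrict_def)

lemma FHom_restrict_idem [simp]: "FHom_restrict M (FHom_restrict M h) = FHom_restrict M h"
  by (auto simp: FHom_restrict_def fun_eq_iff)

sublocale is_fset_functor \<subseteq> D: is_fset_category "FDom F" by (rule FDom_cat)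
sublocale is_fset_functor \<subseteq> C: is_fset_category "FCod F" by (rule FCod_cat)

context is_fset_functor
begin

lemma FHom_Tup: "\<lbrakk>X \<in> Obj (FDom F); Y \<in> Obj (FDom F); fs \<in> Tup (FDom F) m n X Y\<rbrakk>
    \<Longrightarrow> map (FHom F n X Y) fs \<in> Tup (FCod F) m n (FObj F X) (FObj F Y)"
  by (erule Tup_map) (rule FHom_in)

lemma FHom_Prj: "\<lbrakk>X \<in> Obj (FDom F); i < n\<rbrakk>
    \<Longrightarrow> FHom F n X X (Prj (FDom F) X n i) = Prj (FCod F) (FObj F X) n i"
  unfolding Prj_def by (subst FHom_natural) (auto simp: D.Unt_in FHom_Unt FinMap_def D.Unt_in)

lemma FHom_Prjs: "X \<in> Obj (FDom F) \<Longrightarrow> map (FHom F n X X) (Prjs (FDom F) X n) = Prjs (FCod F) (FObj F X) n"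
  by (simp add: Prjs_def FHom_Prj)

lemma FHom_Sub1: "\<lbrakk>X \<in> Obj (FDom F); Y \<in> Obj (FDom F); Z \<in> Obj (FDom F);
        g \<in> Hom (FDom F) 1 Y Z; f \<in> Hom (FDom F) n X Y\<rbrakk>
      \<Longrightarrow> FHom F n X Z (Sub (FDom F) X Y Z n g [f])
        = Sub (FCod F) (FObj F X) (FObj F Y) (FObj F Z) n (FHom F 1 Y Z g) [FHom F n X Y f]"
  using FHom_Sub[of X Y Z g 1 "[f]" n] by simp

end

text \<open>Outside the objects and maps of the domain both functors are \<open>undefined\<close>,
  by \<open>FObj_ext\<close> and \<open>FHom_ext\<close>; this is how the strict laws for 1-cells
  become equalities of records.\<close>

lemma fset_fun_eqI:
  fixes F G :: "('o, 'a) fset_fun"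
  assumes "is_fset_functor F" "is_fset_functor G" "FDom F = FDom G" "FCod F = FCod G"
    and obj: "\<And>X. X \<in> Obj (FDom F) \<Longrightarrow> FObj F X = FObj G X"
    and hom: "\<And>n X Y f. \<lbrakk>X \<in> Obj (FDom F); Y \<in> Obj (FDom F); f \<in> Hom (FDom F) n X Y\<rbrakk>
      \<Longrightarrow> FHom F n X Y f = FHom G n X Y f"
  shows "F = G"
proof -
  interpret F: is_fset_functor F by fact
  interpret G: is_fset_functor G by fact
  have "FObj F = FObj G"
    using F.FObj_ext G.FObj_ext obj assms(3) by (intro extensionalityI[of _ "Obj (FDom F)"]) auto
  moreover have "FHom_restrict (FDom F) (FHom F) = FHom_restrict (FDom F) (FHom G)"
    using hom by (auto simp: FHom_restrict_def fun_eq_iff)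
  then have "FHom F = FHom G" using F.FHom_ext G.FHom_ext assms(3) by simp
  ultimately show ?thesis using assms(3,4) by simp
qed

text \<open>Components of the right type, with naturality left open. Naturality can then be treated
  as a property of single maps, \<open>natural_for\<close>, and the class of maps having it can be
  studied by itself.\<close>

locale fset_family =
  F: is_fset_functor F + G: is_fset_functor G
  for F G :: "('o, 'a) fset_fun" +
  fixes a :: "'o \<Rightarrow> 'a"
  assumes FDom_eq: "FDom G = FDom F"
    and FCod_eq: "FCod G = FCod F"
    and at_in: "X \<in> Obj (FDom F) \<Longrightarrow> a X \<in> Hom (FCod F) 1 (FObj F X) (FObj G X)"
begin

lemmas GObj_in = G.FObj_in[unfolded FDom_eq FCod_eq]
lemmas GHom_in = G.FHom_in[unfolded FDom_eq FCod_eq]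
lemmas GHom_Sub = G.FHom_Sub[unfolded FDom_eq FCod_eq]
lemmas GHom_Prj = G.FHom_Prj[unfolded FDom_eq FCod_eq]
lemmas GHom_Tup = G.FHom_Tup[unfolded FDom_eq FCod_eq]

definition ats :: "nat \<Rightarrow> 'o \<Rightarrow> 'a list" where
  "ats n X = map (\<lambda>p. Sub (FCod F) (FObj F X) (FObj F X) (FObj G X) n (a X) [p]) (Prjs (FCod F) (FObj F X) n)"

definition natural_for :: "nat \<Rightarrow> 'o \<Rightarrow> 'o \<Rightarrow> 'a \<Rightarrow> bool" where
  "natural_for n X Y f \<longleftrightarrow> Sub (FCod F) (FObj F X) (FObj F Y) (FObj G Y) n (a Y) [FHom F n X Y f]
    = Sub (FCod F) (FObj F X) (FObj G X) (FObj G Y) n (FHom G n X Y f) (ats n X)"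

lemma ats_in: "X \<in> Obj (FDom F) \<Longrightarrow> ats n X \<in> Tup (FCod F) n n (FObj F X) (FObj G X)"
  unfolding ats_def
  by (intro Tup_map[OF F.C.Prjs_in] F.C.Sub_single_in F.FObj_in GObj_in at_in)

lemma ats_nth: "i < n \<Longrightarrow> ats n X ! i
    = Sub (FCod F) (FObj F X) (FObj F X) (FObj G X) n (a X) [Prj (FCod F) (FObj F X) n i]"
  by (simp add: ats_def Prjs_def)

text \<open>Substitute \<open>us\<close> into the naturality square. By associativity it enters each
  \<open>a X \<circ> \<pi>\<^sub>j\<close>, where the projection selects an entry of
  \<open>us\<close>. This form is what pasting of squares requires.\<close>

lemma natural_for_at:
  assumes f: "natural_for n X Y f" "f \<in> Hom (FDom F) n X Y"
    and XY: "X \<in> Obj (FDom F)" "Y \<in> Obj (FDom F)" and W: "W \<in> Obj (FCod F)"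
    and us: "us \<in> Tup (FCod F) n k W (FObj F X)"
  shows "Sub (FCod F) W (FObj F Y) (FObj G Y) k (a Y)
        [Sub (FCod F) W (FObj F X) (FObj F Y) k (FHom F n X Y f) us]
    = Sub (FCod F) W (FObj G X) (FObj G Y) k (FHom G n X Y f)
        (map (\<lambda>u. Sub (FCod F) W (FObj F X) (FObj G X) k (a X) [u]) us)"
proof -
  let ?N = "FCod F"
  note o = F.FObj_in[OF XY(1)] F.FObj_in[OF XY(2)] GObj_in[OF XY(1)] GObj_in[OF XY(2)]
  note Ff = F.FHom_in[OF XY f(2)] and Gf = GHom_in[OF XY f(2)]
  have "Sub ?N W (FObj F Y) (FObj G Y) k (a Y) [Sub ?N W (FObj F X) (FObj F Y) k (FHom F n X Y f) us]
      = Sub ?N W (FObj F X) (FObj G Y) k (Sub ?N (FObj F X) (FObj F Y) (FObj G Y) n (a Y) [FHom F n X Y f]) us"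
    using o W us Ff at_in[OF XY(2)] by (intro F.C.Sub_assoc1) auto
  also have "\<dots> = Sub ?N W (FObj F X) (FObj G Y) k (Sub ?N (FObj F X) (FObj G X) (FObj G Y) n (FHom G n X Y f) (ats n X)) us"
    using f(1) by (simp add: natural_for_def)
  also have "\<dots> = Sub ?N W (FObj G X) (FObj G Y) k (FHom G n X Y f)
      (map (\<lambda>g. Sub ?N W (FObj F X) (FObj G X) k g us) (ats n X))"
    using o W us Gf ats_in[OF XY(1)] by (intro F.C.Sub_assoc[symmetric]) auto
  also have "map (\<lambda>g. Sub ?N W (FObj F X) (FObj G X) k g us) (ats n X)
      = map (\<lambda>p. Sub ?N W (FObj F X) (FObj G X) k (a X) [Sub ?N W (FObj F X) (FObj F X) k p us]) (Prjs ?N (FObj F X) n)"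
    using o W us at_in[OF XY(1)] Tup_memD[OF F.C.Prjs_in[OF o(1)]]
    by (auto simp: ats_def intro!: F.C.Sub_assoc1[symmetric])
  also have "\<dots> = map (\<lambda>u. Sub ?N W (FObj F X) (FObj G X) k (a X) [u])
      (map (\<lambda>p. Sub ?N W (FObj F X) (FObj F X) k p us) (Prjs ?N (FObj F X) n))"
    by simp
  also have "map (\<lambda>p. Sub ?N W (FObj F X) (FObj F X) k p us) (Prjs ?N (FObj F X) n) = us"
    using W o us by (intro F.C.Sub_Prj_map)
  finally show ?thesis .
qed

lemma natural_for_Prj:
  assumes "X \<in> Obj (FDom F)" "i < n"
  shows "natural_for n X X (Prj (FDom F) X n i)"
  using assms F.C.Sub_Prj[OF F.FObj_in GObj_in ats_in]
  by (simp add: natural_for_def F.FHom_Prj GHom_Prj ats_nth)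

text \<open>The square of \<open>g\<close> is instantiated at the images of the \<open>fs\<close>
  under \<open>F\<close>, the squares of the \<open>fs\<close> rewrite each entry, and associativity
  regroups the result. Together with \<open>natural_for_Prj\<close> this allows naturality to be
  checked on generators.\<close>

lemma natural_for_Sub:
  assumes XYZ: "X \<in> Obj (FDom F)" "Y \<in> Obj (FDom F)" "Z \<in> Obj (FDom F)"
    and g: "g \<in> Hom (FDom F) m Y Z" "natural_for m Y Z g"
    and fs: "fs \<in> Tup (FDom F) m n X Y" "\<And>f. f \<in> set fs \<Longrightarrow> natural_for n X Y f"
  shows "natural_for n X Z (Sub (FDom F) X Y Z n g fs)"
proof -
  let ?N = "FCod F"
  note o = XYZ[THEN F.FObj_in] XYZ[THEN GObj_in]
  have "Sub ?N (FObj F X) (FObj F Z) (FObj G Z) n (a Z) [FHom F n X Z (Sub (FDom F) X Y Z n g fs)]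
    = Sub ?N (FObj F X) (FObj G Y) (FObj G Z) n (FHom G m Y Z g)
        (map (\<lambda>u. Sub ?N (FObj F X) (FObj F Y) (FObj G Y) n (a Y) [u]) (map (FHom F n X Y) fs))"
    unfolding F.FHom_Sub[OF XYZ g(1) fs(1)]
    using XYZ o g F.FHom_Tup[OF XYZ(1,2) fs(1)] by (intro natural_for_at) auto
  also have "map (\<lambda>u. Sub ?N (FObj F X) (FObj F Y) (FObj G Y) n (a Y) [u]) (map (FHom F n X Y) fs)
    = map (\<lambda>h. Sub ?N (FObj F X) (FObj G X) (FObj G Y) n h (ats n X)) (map (FHom G n X Y) fs)"
    using fs(2) by (simp add: natural_for_def)
  also have "Sub ?N (FObj F X) (FObj G Y) (FObj G Z) n (FHom G m Y Z g) \<dots>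
    = Sub ?N (FObj F X) (FObj G X) (FObj G Z) n
        (Sub ?N (FObj G X) (FObj G Y) (FObj G Z) n (FHom G m Y Z g) (map (FHom G n X Y) fs)) (ats n X)"
    by (rule F.C.Sub_assoc[OF o(1,4,5,6) GHom_in[OF XYZ(2,3) g(1)] GHom_Tup[OF XYZ(1,2) fs(1)] ats_in[OF XYZ(1)]])
  finally show ?thesis
    by (simp add: natural_for_def GHom_Sub[OF XYZ g(1) fs(1)])
qed

lemma transformationI:
  assumes "\<And>n X Y f. \<lbrakk>X \<in> Obj (FDom F); Y \<in> Obj (FDom F); f \<in> Hom (FDom F) n X Y\<rbrakk> \<Longrightarrow> natural_for n X Y f"
    and "a \<in> extensional (Obj (FDom F))"
  shows "is_fset_transformation F G a"
proof (rule is_fset_transformation.intro)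
  fix X Y f n assume "X \<in> Obj (FDom F)" "Y \<in> Obj (FDom F)" "f \<in> Hom (FDom F) n X Y"
  then show "Sub (FCod F) (FObj F X) (FObj F Y) (FObj G Y) n (a Y) [FHom F n X Y f]
        = Sub (FCod F) (FObj F X) (FObj G X) (FObj G Y) n (FHom G n X Y f)
            (map (\<lambda>p. Sub (FCod F) (FObj F X) (FObj F X) (FObj G X) n (a X) [p])
              (Prjs (FCod F) (FObj F X) n))"
    using assms(1) unfolding natural_for_def ats_def by blast
qed (use assms(2) F.is_fset_functor_axioms G.is_fset_functor_axioms FDom_eq FCod_eq at_in in auto)

end

sublocale is_fset_transformation \<subseteq> fset_family F G a
  by (intro fset_family.intro fset_family_axioms.intro dom_functor cod_functor FDom_eq FCod_eq at_in)

context is_fset_transformation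
begin

lemma natural_for: "\<lbrakk>X \<in> Obj (FDom F); Y \<in> Obj (FDom F); f \<in> Hom (FDom F) n X Y\<rbrakk> \<Longrightarrow> natural_for n X Y f"
  unfolding natural_for_def ats_def by (rule natural)

lemma natural_at:
  assumes XY: "X \<in> Obj (FDom F)" "Y \<in> Obj (FDom F)" and W: "W \<in> Obj (FCod F)"
    and f: "f \<in> Hom (FDom F) n X Y" and us: "us \<in> Tup (FCod F) n k W (FObj F X)"
  shows "Sub (FCod F) W (FObj F Y) (FObj G Y) k (a Y)
        [Sub (FCod F) W (FObj F X) (FObj F Y) k (FHom F n X Y f) us]
    = Sub (FCod F) W (FObj G X) (FObj G Y) k (FHom G n X Y f)
        (map (\<lambda>u. Sub (FCod F) W (FObj F X) (FObj G X) k (a X) [u]) us)"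
  by (rule natural_for_at[OF natural_for[OF XY f] f XY W us])

text \<open>In degree 1 the unit is the only projection, so the tuple on the right collapses to
  \<open>[a X]\<close> and the ordinary naturality square remains.\<close>

lemma natural1:
  assumes XY: "X \<in> Obj (FDom F)" "Y \<in> Obj (FDom F)" and f: "f \<in> Hom (FDom F) 1 X Y"
  shows "Sub (FCod F) (FObj F X) (FObj F Y) (FObj G Y) 1 (a Y) [FHom F 1 X Y f]
    = Sub (FCod F) (FObj F X) (FObj G X) (FObj G Y) 1 (FHom G 1 X Y f) [a X]"
  using natural[OF XY f] F.C.Prjs_1[OF F.FObj_in[OF XY(1)]]
    F.C.Sub_Unt_right[OF F.FObj_in[OF XY(1)] GObj_in[OF XY(1)] at_in[OF XY(1)]] by (simp)

end


section \<open>Composites of functors and transformations, and the 2-category laws\<close>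

lemma Cell_FSetCAT [simp]:
  "Cell0 FSetCAT = {M. is_fset_category M}" "Cell1 FSetCAT = {F. is_fset_functor F}"
  "Dom1 FSetCAT = FDom" "Cod1 FSetCAT = FCod" "Dom2 FSetCAT = TDom" "Cod2 FSetCAT = TCod"
  "Id1 FSetCAT = fset_id" "Comp1 FSetCAT = fset_comp"
  "Id2 FSetCAT = fset_tr_id" "VComp FSetCAT = fset_vcomp" "HComp FSetCAT = fset_hcomp"
  by (simp_all add: FSetCAT_def)

lemma hom1_FSetCAT: "F \<in> hom1 FSetCAT A B \<longleftrightarrow> is_fset_functor F \<and> FDom F = A \<and> FCod F = B"
  by (simp add: hom1_def FSetCAT_def)

lemma hom2_FSetCAT:
  "s \<in> hom2 FSetCAT F G \<longleftrightarrow> is_fset_transformation F G (TAt s) \<and> TDom s = F \<and> TCod s = G"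
  by (auto simp: hom2_def FSetCAT_def)

lemma fset_fun_simps [simp]:
  "FDom (fset_id M) = M" "FCod (fset_id M) = M"
  "X \<in> Obj M \<Longrightarrow> FObj (fset_id M) X = X"
  "\<lbrakk>X \<in> Obj M; Y \<in> Obj M; f \<in> Hom M n X Y\<rbrakk> \<Longrightarrow> FHom (fset_id M) n X Y f = f"
  "FDom (fset_comp G F) = FDom F" "FCod (fset_comp G F) = FCod G"
  "X \<in> Obj (FDom F) \<Longrightarrow> FObj (fset_comp G F) X = FObj G (FObj F X)"
  "\<lbrakk>X \<in> Obj (FDom F); Y \<in> Obj (FDom F); f \<in> Hom (FDom F) n X Y\<rbrakk>
    \<Longrightarrow> FHom (fset_comp G F) n X Y f = FHom G n (FObj F X) (FObj F Y) (FHom F n X Y f)"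
  by (simp_all add: fset_id_def fset_comp_def)

lemma fset_id_functor: "is_fset_category M \<Longrightarrow> is_fset_functor (fset_id M)"
proof -
  assume "is_fset_category M"
  then interpret is_fset_category M .
  have "map (FHom (fset_id M) n X Y) fs = fs" if "X \<in> Obj M" "Y \<in> Obj M" "fs \<in> Tup M m n X Y" for m n X Y fs
    using that by (auto intro!: map_idI dest: Tup_memD)
  then show ?thesis
    by (intro is_fset_functor.intro)
      (simp_all add: is_fset_category_axioms Act_in Unt_in Sub_in, simp_all add: fset_id_def)
qed

lemma fset_comp_functor:
  assumes "is_fset_functor F" "is_fset_functor G" "FDom G = FCod F"
  shows "is_fset_functor (fset_comp G F)"
proof -
  interpret F: is_fset_functor F by fact
  interpret G: is_fset_functor G by fact
  note G = G.FObj_in G.FHom_in G.FHom_natural G.FHom_Unt G.FHom_Sub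
  show ?thesis
  proof (rule is_fset_functor.intro)
    fix X Y Z g m n fs
    assume a: "X \<in> Obj (FDom (fset_comp G F))" "Y \<in> Obj (FDom (fset_comp G F))" "Z \<in> Obj (FDom (fset_comp G F))"
      "g \<in> Hom (FDom (fset_comp G F)) m Y Z" "fs \<in> Tup (FDom (fset_comp G F)) m n X Y"
    have eq: "map (FHom (fset_comp G F) n X Y) fs = map (FHom G n (FObj F X) (FObj F Y)) (map (FHom F n X Y) fs)"
      using a by (auto dest: Tup_memD)
    show "FHom (fset_comp G F) n X Z (Sub (FDom (fset_comp G F)) X Y Z n g fs) =
       Sub (FCod (fset_comp G F)) (FObj (fset_comp G F) X) (FObj (fset_comp G F) Y) (FObj (fset_comp G F) Z) n
        (FHom (fset_comp G F) m Y Z g) (map (FHom (fset_comp G F) n X Y) fs)"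
      unfolding eq using a F.FHom_Tup[of X Y fs m n] by (simp add: F.D.Sub_in F.FHom_Sub F.FObj_in F.FHom_in assms(3) G[unfolded assms(3)] del: map_map)
  qed (use assms in \<open>simp_all add: F.FObj_in F.FHom_in F.FHom_natural F.FHom_Unt F.D.Unt_in F.D.Act_in
      G[unfolded assms(3)] F.FDom_cat G.FCod_cat\<close>,
      simp_all add: fset_comp_def)
qed

lemma fset_tr_eqI:
  assumes "s \<in> hom2 FSetCAT F G" "t \<in> hom2 FSetCAT F G" "\<And>X. X \<in> Obj (FDom F) \<Longrightarrow> TAt s X = TAt t X"
  shows "s = t"
proof -
  interpret s: is_fset_transformation F G "TAt s" using assms(1) by (simp add: hom2_FSetCAT)
  interpret t: is_fset_transformation F G "TAt t" using assms(2) by (simp add: hom2_FSetCAT)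
  have "TAt s = TAt t"
    using s.at_ext t.at_ext assms(3) by (rule extensionalityI)
  then show ?thesis using assms(1,2) by (simp add: hom2_FSetCAT)
qed

lemma TAt_simps [simp]:
  "TDom (fset_tr_id F) = F" "TCod (fset_tr_id F) = F"
  "X \<in> Obj (FDom F) \<Longrightarrow> TAt (fset_tr_id F) X = Unt (FCod F) (FObj F X)"
  "TDom (fset_vcomp t s) = TDom s" "TCod (fset_vcomp t s) = TCod t"
  "X \<in> Obj (FDom (TDom s)) \<Longrightarrow> TAt (fset_vcomp t s) X
    = Sub (FCod (TDom s)) (FObj (TDom s) X) (FObj (TCod s) X) (FObj (TCod t) X) 1 (TAt t X) [TAt s X]"
  "TDom (fset_hcomp t s) = fset_comp (TDom t) (TDom s)" "TCod (fset_hcomp t s) = fset_comp (TCod t) (TCod s)"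
  "X \<in> Obj (FDom (TDom s)) \<Longrightarrow> TAt (fset_hcomp t s) X
    = Sub (FCod (TDom t)) (FObj (TDom t) (FObj (TDom s) X)) (FObj (TDom t) (FObj (TCod s) X))
        (FObj (TCod t) (FObj (TCod s) X)) 1
        (TAt t (FObj (TCod s) X)) [FHom (TDom t) 1 (FObj (TDom s) X) (FObj (TCod s) X) (TAt s X)]"
  by (simp_all add: fset_tr_id_def fset_vcomp_def fset_hcomp_def Let_def)

lemma fset_tr_id_in:
  assumes "is_fset_functor F" shows "fset_tr_id F \<in> hom2 FSetCAT F F"
proof -
  interpret is_fset_functor F by fact
  have "is_fset_transformation F F (TAt (fset_tr_id F))"
  proof (rule is_fset_transformation.intro)
    fix X Y f n assume XY: "X \<in> Obj (FDom F)" "Y \<in> Obj (FDom F)" "f \<in> Hom (FDom F) n X Y"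
    have "map (\<lambda>p. Sub (FCod F) (FObj F X) (FObj F X) (FObj F X) n (Unt (FCod F) (FObj F X)) [p])
        (Prjs (FCod F) (FObj F X) n) = Prjs (FCod F) (FObj F X) n"
      using XY FObj_in by (auto intro!: map_idI C.Sub_Unt dest: Tup_memD[OF C.Prjs_in])
    then show "Sub (FCod F) (FObj F X) (FObj F Y) (FObj F Y) n (TAt (fset_tr_id F) Y) [FHom F n X Y f] =
       Sub (FCod F) (FObj F X) (FObj F X) (FObj F Y) n (FHom F n X Y f)
        (map (\<lambda>p. Sub (FCod F) (FObj F X) (FObj F X) (FObj F X) n (TAt (fset_tr_id F) X) [p]) (Prjs (FCod F) (FObj F X) n))"
      using XY FObj_in FHom_in by (simp add: C.Sub_Unt C.Sub_Prjs)
  qed (use assms in \<open>auto simp: FObj_in C.Unt_in fset_tr_id_def\<close>)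
  then show ?thesis by (simp add: hom2_FSetCAT)
qed

text \<open>The two squares are pasted: the square of \<open>s\<close> produces \<open>G f\<close>
  at the tuple of all \<open>s X \<circ> \<pi>\<^sub>j\<close>, and the square of \<open>t\<close>
  is then used at that tuple through \<open>natural_at\<close>.\<close>

lemma fset_vcomp_in:
  assumes s: "s \<in> hom2 FSetCAT F G" and t: "t \<in> hom2 FSetCAT G H"
  shows "fset_vcomp t s \<in> hom2 FSetCAT F H"
proof -
  interpret s: is_fset_transformation F G "TAt s" using s by (simp add: hom2_FSetCAT)
  interpret t: is_fset_transformation G H "TAt t" using t by (simp add: hom2_FSetCAT)
  have st: "TDom s = F" "TCod s = G" "TDom t = G" "TCod t = H" using s t by (auto simp: hom2_FSetCAT)
  note eq = s.FDom_eq s.FCod_eq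
  note t_in = t.at_in[unfolded eq]
  note HObj_in = t.GObj_in[unfolded eq]
  note HHom_in = t.GHom_in[unfolded eq]
  note o = s.F.FObj_in s.GObj_in HObj_in
  have "is_fset_transformation F H (TAt (fset_vcomp t s))"
  proof (rule is_fset_transformation.intro)
    show "FDom H = FDom F" "FCod H = FCod F" using eq t.FDom_eq t.FCod_eq by auto
    show "TAt (fset_vcomp t s) X \<in> Hom (FCod F) 1 (FObj F X) (FObj H X)" if "X \<in> Obj (FDom F)" for X
      using that o s.at_in t_in by (simp add: st s.F.C.Sub_single_in)
    show "TAt (fset_vcomp t s) \<in> extensional (Obj (FDom F))"
      by (simp add: fset_vcomp_def st)
    fix X Y f n assume a: "X \<in> Obj (FDom F)" "Y \<in> Obj (FDom F)" "f \<in> Hom (FDom F) n X Y"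
    let ?N = "FCod F"
    let ?P = "Prjs ?N (FObj F X) n"
    let ?sp = "map (\<lambda>p. Sub ?N (FObj F X) (FObj F X) (FObj G X) n (TAt s X) [p]) ?P"
    note oX = o[OF a(1)] and oY = o[OF a(2)]
    have P: "?P \<in> Tup ?N n n (FObj F X) (FObj F X)" using oX by (intro s.F.C.Prjs_in)
    have sp: "?sp \<in> Tup ?N n n (FObj F X) (FObj G X)"
      using oX s.at_in[OF a(1)] by (intro Tup_map[OF P] s.F.C.Sub_single_in) auto
    have "Sub ?N (FObj F X) (FObj F Y) (FObj H Y) n (TAt (fset_vcomp t s) Y) [FHom F n X Y f]
      = Sub ?N (FObj F X) (FObj G Y) (FObj H Y) n (TAt t Y) [Sub ?N (FObj F X) (FObj F Y) (FObj G Y) n (TAt s Y) [FHom F n X Y f]]"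
      using oX oY t_in[OF a(2)] s.at_in[OF a(2)] s.F.FHom_in[OF a] a
      by (simp add: st) (intro s.F.C.Sub_assoc1[symmetric], auto)
    also have "\<dots> = Sub ?N (FObj F X) (FObj G Y) (FObj H Y) n (TAt t Y)
        [Sub ?N (FObj F X) (FObj G X) (FObj G Y) n (FHom G n X Y f) ?sp]"
      by (simp add: s.natural[OF a])
    also have "\<dots> = Sub ?N (FObj F X) (FObj H X) (FObj H Y) n (FHom H n X Y f)
        (map (\<lambda>u. Sub ?N (FObj F X) (FObj G X) (FObj H X) n (TAt t X) [u]) ?sp)"
      by (rule t.natural_at[unfolded eq, OF a(1,2) oX(1) a(3) sp])
    also have "map (\<lambda>u. Sub ?N (FObj F X) (FObj G X) (FObj H X) n (TAt t X) [u]) ?sp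
      = map (\<lambda>p. Sub ?N (FObj F X) (FObj F X) (FObj H X) n (TAt (fset_vcomp t s) X) [p]) ?P"
      using oX a t_in[OF a(1)] s.at_in[OF a(1)] Tup_memD[OF P]
      by (auto simp: st intro!: s.F.C.Sub_assoc1)
    finally show "Sub ?N (FObj F X) (FObj F Y) (FObj H Y) n (TAt (fset_vcomp t s) Y) [FHom F n X Y f]
      = Sub ?N (FObj F X) (FObj H X) (FObj H Y) n (FHom H n X Y f)
          (map (\<lambda>p. Sub ?N (FObj F X) (FObj F X) (FObj H X) n (TAt (fset_vcomp t s) X) [p]) ?P)" .
  qed (rule s.dom_functor t.cod_functor)+
  then show ?thesis by (simp add: hom2_FSetCAT st)
qed

text \<open>Apply \<open>H\<close> to the square of \<open>s\<close>; as \<open>H\<close> preserves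
  projections, the tuple that arises has the entries \<open>H (s X) \<circ> \<pi>\<^sub>j\<close>.
  Then use the square of \<open>t\<close> at the image of \<open>f\<close> under \<open>G\<close>,
  instantiated at that tuple.\<close>

lemma fset_hcomp_in:
  assumes s: "s \<in> hom2 FSetCAT F G" and t: "t \<in> hom2 FSetCAT H K" and FH: "FDom H = FCod F"
  shows "fset_hcomp t s \<in> hom2 FSetCAT (fset_comp H F) (fset_comp K G)"
proof -
  interpret s: is_fset_transformation F G "TAt s" using s by (simp add: hom2_FSetCAT)
  interpret t: is_fset_transformation H K "TAt t" using t by (simp add: hom2_FSetCAT)
  have st: "TDom s = F" "TCod s = G" "TDom t = H" "TCod t = K" using s t by (auto simp: hom2_FSetCAT)
  note sO = s.F.FObj_in s.GObj_in
  note HO = sO[THEN t.F.FObj_in[unfolded FH]] sO[THEN t.GObj_in[unfolded FH]]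
  note t_in = t.at_in[unfolded FH]
  have Hs: "FHom H 1 (FObj F X) (FObj G X) (TAt s X) \<in> Hom (FCod H) 1 (FObj H (FObj F X)) (FObj H (FObj G X))"
    if "X \<in> Obj (FDom F)" for X
    using that t.F.FHom_in[unfolded FH, OF sO(1) sO(2) s.at_in] by blast
  have at: "TAt (fset_hcomp t s) X \<in> Hom (FCod H) 1 (FObj H (FObj F X)) (FObj K (FObj G X))" if "X \<in> Obj (FDom F)" for X
    using that HO[OF that] t_in[OF sO(2)[OF that]] Hs[OF that] by (auto simp: st intro!: t.F.C.Sub_single_in)
  have "is_fset_transformation (fset_comp H F) (fset_comp K G) (TAt (fset_hcomp t s))"
  proof (rule is_fset_transformation.intro)
    show "is_fset_functor (fset_comp H F)" "is_fset_functor (fset_comp K G)"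
      using FH t.FDom_eq s.FCod_eq by (auto intro!: fset_comp_functor s.dom_functor t.dom_functor s.cod_functor t.cod_functor)
    show "FDom (fset_comp K G) = FDom (fset_comp H F)" "FCod (fset_comp K G) = FCod (fset_comp H F)"
      using s.FDom_eq t.FCod_eq by auto
    show "TAt (fset_hcomp t s) X \<in> Hom (FCod (fset_comp H F)) 1 (FObj (fset_comp H F) X) (FObj (fset_comp K G) X)"
      if "X \<in> Obj (FDom (fset_comp H F))" for X
      using that at[of X] by (simp add: s.FDom_eq del: TAt_simps)
    show "TAt (fset_hcomp t s) \<in> extensional (Obj (FDom (fset_comp H F)))"
      by (simp add: fset_hcomp_def st Let_def)
    fix X Y f n assume "X \<in> Obj (FDom (fset_comp H F))" "Y \<in> Obj (FDom (fset_comp H F))"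
      "f \<in> Hom (FDom (fset_comp H F)) n X Y"
    then have a: "X \<in> Obj (FDom F)" "Y \<in> Obj (FDom F)" "f \<in> Hom (FDom F) n X Y" by auto
    let ?N = "FCod F" and ?E = "FCod H"
    let ?P = "Prjs ?N (FObj F X) n"
    let ?sp = "map (\<lambda>p. Sub ?N (FObj F X) (FObj F X) (FObj G X) n (TAt s X) [p]) ?P"
    note sX = sO[OF a(1)] and sY = sO[OF a(2)] and HX = HO[OF a(1)] and HY = HO[OF a(2)]
    have P: "?P \<in> Tup ?N n n (FObj F X) (FObj F X)" using sX by (intro s.F.C.Prjs_in)
    have sp: "?sp \<in> Tup ?N n n (FObj F X) (FObj G X)"
      using sX s.at_in[OF a(1)] by (intro Tup_map[OF P] s.F.C.Sub_single_in) auto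
    have "Sub ?E (FObj H (FObj F X)) (FObj H (FObj F Y)) (FObj K (FObj G Y)) n (TAt (fset_hcomp t s) Y)
        [FHom H n (FObj F X) (FObj F Y) (FHom F n X Y f)]
      = Sub ?E (FObj H (FObj F X)) (FObj H (FObj G Y)) (FObj K (FObj G Y)) n (TAt t (FObj G Y))
          [Sub ?E (FObj H (FObj F X)) (FObj H (FObj F Y)) (FObj H (FObj G Y)) n (FHom H 1 (FObj F Y) (FObj G Y) (TAt s Y))
            [FHom H n (FObj F X) (FObj F Y) (FHom F n X Y f)]]"
      using HX HY a t_in[OF sY(2)] Hs[OF a(2)] t.F.FHom_in[unfolded FH, OF sX(1) sY(1) s.F.FHom_in[OF a]]
      by (simp add: st) (intro t.F.C.Sub_assoc1[symmetric], auto)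
    also have "Sub ?E (FObj H (FObj F X)) (FObj H (FObj F Y)) (FObj H (FObj G Y)) n (FHom H 1 (FObj F Y) (FObj G Y) (TAt s Y))
            [FHom H n (FObj F X) (FObj F Y) (FHom F n X Y f)]
        = FHom H n (FObj F X) (FObj G Y) (Sub ?N (FObj F X) (FObj F Y) (FObj G Y) n (TAt s Y) [FHom F n X Y f])"
      using sX sY s.at_in[OF a(2)] s.F.FHom_in[OF a] by (intro t.F.FHom_Sub1[unfolded FH, symmetric]) auto
    also have "\<dots> = FHom H n (FObj F X) (FObj G Y) (Sub ?N (FObj F X) (FObj G X) (FObj G Y) n (FHom G n X Y f) ?sp)"
      by (simp add: s.natural[OF a])
    also have "\<dots> = Sub ?E (FObj H (FObj F X)) (FObj H (FObj G X)) (FObj H (FObj G Y)) n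
        (FHom H n (FObj G X) (FObj G Y) (FHom G n X Y f)) (map (FHom H n (FObj F X) (FObj G X)) ?sp)"
      by (rule t.F.FHom_Sub[unfolded FH, OF sX(1,2) sY(2) s.GHom_in[OF a] sp])
    also have "map (FHom H n (FObj F X) (FObj G X)) ?sp
      = map (\<lambda>p. Sub ?E (FObj H (FObj F X)) (FObj H (FObj F X)) (FObj H (FObj G X)) n
          (FHom H 1 (FObj F X) (FObj G X) (TAt s X)) [p]) (map (FHom H n (FObj F X) (FObj F X)) ?P)"
      using sX s.at_in[OF a(1)] Tup_memD[OF P] by (auto intro!: t.F.FHom_Sub1[unfolded FH])
    also have "map (FHom H n (FObj F X) (FObj F X)) ?P = Prjs ?E (FObj H (FObj F X)) n"
      using t.F.FHom_Prjs[unfolded FH, OF sX(1)] .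
    also have "Sub ?E (FObj H (FObj F X)) (FObj H (FObj G Y)) (FObj K (FObj G Y)) n (TAt t (FObj G Y))
        [Sub ?E (FObj H (FObj F X)) (FObj H (FObj G X)) (FObj H (FObj G Y)) n
          (FHom H n (FObj G X) (FObj G Y) (FHom G n X Y f))
          (map (\<lambda>p. Sub ?E (FObj H (FObj F X)) (FObj H (FObj F X)) (FObj H (FObj G X)) n
            (FHom H 1 (FObj F X) (FObj G X) (TAt s X)) [p]) (Prjs ?E (FObj H (FObj F X)) n))]
      = Sub ?E (FObj H (FObj F X)) (FObj K (FObj G X)) (FObj K (FObj G Y)) n
          (FHom K n (FObj G X) (FObj G Y) (FHom G n X Y f))
          (map (\<lambda>u. Sub ?E (FObj H (FObj F X)) (FObj H (FObj G X)) (FObj K (FObj G X)) n (TAt t (FObj G X)) [u])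
            (map (\<lambda>p. Sub ?E (FObj H (FObj F X)) (FObj H (FObj F X)) (FObj H (FObj G X)) n
              (FHom H 1 (FObj F X) (FObj G X) (TAt s X)) [p]) (Prjs ?E (FObj H (FObj F X)) n)))"
      using sX sY HX s.GHom_in[OF a] Hs[OF a(1)]
      by (intro t.natural_at[unfolded FH] Tup_map[OF t.F.C.Prjs_in] t.F.C.Sub_single_in) auto
    also have "map (\<lambda>u. Sub ?E (FObj H (FObj F X)) (FObj H (FObj G X)) (FObj K (FObj G X)) n (TAt t (FObj G X)) [u])
            (map (\<lambda>p. Sub ?E (FObj H (FObj F X)) (FObj H (FObj F X)) (FObj H (FObj G X)) n
              (FHom H 1 (FObj F X) (FObj G X) (TAt s X)) [p]) (Prjs ?E (FObj H (FObj F X)) n))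
      = map (\<lambda>p. Sub ?E (FObj H (FObj F X)) (FObj H (FObj F X)) (FObj K (FObj G X)) n (TAt (fset_hcomp t s) X) [p])
          (Prjs ?E (FObj H (FObj F X)) n)"
      using HX a t_in[OF sX(2)] Hs[OF a(1)] Tup_memD[OF t.F.C.Prjs_in[OF HX(1)]]
      by (auto simp: st intro!: t.F.C.Sub_assoc1)
    finally show "Sub (FCod (fset_comp H F)) (FObj (fset_comp H F) X) (FObj (fset_comp H F) Y) (FObj (fset_comp K G) Y) n
        (TAt (fset_hcomp t s) Y) [FHom (fset_comp H F) n X Y f]
      = Sub (FCod (fset_comp H F)) (FObj (fset_comp H F) X) (FObj (fset_comp K G) X) (FObj (fset_comp K G) Y) n
        (FHom (fset_comp K G) n X Y f)
        (map (\<lambda>p. Sub (FCod (fset_comp H F)) (FObj (fset_comp H F) X) (FObj (fset_comp H F) X) (FObj (fset_comp K G) X) n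
          (TAt (fset_hcomp t s) X) [p]) (Prjs (FCod (fset_comp H F)) (FObj (fset_comp H F) X) n))"
      using a by (simp add: s.FDom_eq del: TAt_simps)
  qed
  then show ?thesis by (simp add: hom2_FSetCAT st)
qed

lemma FSetCAT_two_category: "is_two_category (FSetCAT :: (('o, 'a) fset_cat, ('o, 'a) fset_fun, ('o, 'a) fset_tr) two_cat)"
proof (rule is_two_category.intro)
  fix f :: "('o, 'a) fset_fun" assume "f \<in> Cell1 FSetCAT"
  then interpret is_fset_functor f by simp
  show "Dom1 FSetCAT f \<in> Cell0 FSetCAT" "Cod1 FSetCAT f \<in> Cell0 FSetCAT"
    by (simp_all add: FDom_cat FCod_cat)
next
  fix s :: "('o, 'a) fset_tr" assume "s \<in> Cell2 FSetCAT"
  then interpret is_fset_transformation "TDom s" "TCod s" "TAt s" by (simp add: FSetCAT_def)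
  show "Dom2 FSetCAT s \<in> Cell1 FSetCAT" "Cod2 FSetCAT s \<in> Cell1 FSetCAT"
    "Dom1 FSetCAT (Dom2 FSetCAT s) = Dom1 FSetCAT (Cod2 FSetCAT s) \<and>
     Cod1 FSetCAT (Dom2 FSetCAT s) = Cod1 FSetCAT (Cod2 FSetCAT s)"
    using dom_functor cod_functor FDom_eq FCod_eq by auto
next
  fix A B :: "('o, 'a) fset_cat"
  show "is_category (hom_cat FSetCAT A B)"
  proof (rule is_category.intro)
    fix F G s assume "F \<in> Ob (hom_cat FSetCAT A B)" "G \<in> Ob (hom_cat FSetCAT A B)" "s \<in> Ar (hom_cat FSetCAT A B) F G"
    then have s: "s \<in> hom2 FSetCAT F G" by (simp add: hom_cat_def)
    then interpret s: is_fset_transformation F G "TAt s" by (simp add: hom2_FSetCAT)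
    have st: "TDom s = F" "TCod s = G" using s by (auto simp: hom2_FSetCAT)
    show "Cmp (hom_cat FSetCAT A B) s (Idn (hom_cat FSetCAT A B) F) = s"
      using fset_vcomp_in[OF fset_tr_id_in[OF s.dom_functor] s] s
      by (auto intro!: fset_tr_eqI[of _ F G] s.F.C.Sub_Unt_right s.at_in s.F.FObj_in s.GObj_in simp: hom_cat_def st)
    show "Cmp (hom_cat FSetCAT A B) (Idn (hom_cat FSetCAT A B) G) s = s"
      using fset_vcomp_in[OF s fset_tr_id_in[OF s.cod_functor]] s
      by (auto intro!: fset_tr_eqI[of _ F G] s.F.C.Sub_Unt s.at_in s.F.FObj_in s.GObj_in
          simp: hom_cat_def st s.FDom_eq s.FCod_eq)
    fix H K t r assume "t \<in> Ar (hom_cat FSetCAT A B) G H" "r \<in> Ar (hom_cat FSetCAT A B) H K"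
    then have t: "t \<in> hom2 FSetCAT G H" and r: "r \<in> hom2 FSetCAT H K" by (auto simp: hom_cat_def)
    interpret t: is_fset_transformation G H "TAt t" using t by (simp add: hom2_FSetCAT)
    interpret r: is_fset_transformation H K "TAt r" using r by (simp add: hom2_FSetCAT)
    have st': "TDom t = G" "TCod t = H" "TDom r = H" "TCod r = K" using t r by (auto simp: hom2_FSetCAT)
    note eqG = s.FDom_eq s.FCod_eq
    note eqH = t.FDom_eq[unfolded eqG] t.FCod_eq[unfolded eqG]
    show "Cmp (hom_cat FSetCAT A B) (Cmp (hom_cat FSetCAT A B) r t) s
        = Cmp (hom_cat FSetCAT A B) r (Cmp (hom_cat FSetCAT A B) t s)"
      unfolding hom_cat_def cat.simps Cell_FSetCAT
    proof (rule fset_tr_eqI)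
      show "fset_vcomp (fset_vcomp r t) s \<in> hom2 FSetCAT F K" "fset_vcomp r (fset_vcomp t s) \<in> hom2 FSetCAT F K"
        using s t r by (auto intro: fset_vcomp_in)
      fix X assume X: "X \<in> Obj (FDom F)"
      then show "TAt (fset_vcomp (fset_vcomp r t) s) X = TAt (fset_vcomp r (fset_vcomp t s)) X"
        using s.F.FObj_in s.GObj_in s.at_in t.GObj_in[unfolded eqG] t.at_in[unfolded eqG]
          r.GObj_in[unfolded eqH] r.at_in[unfolded eqH]
        by (simp add: st st' eqG s.F.C.Sub_assoc11)
    qed
  qed (auto simp: hom_cat_def hom1_FSetCAT intro: fset_tr_id_in fset_vcomp_in)
next
  fix A :: "('o, 'a) fset_cat" assume "A \<in> Cell0 FSetCAT"
  then show "Id1 FSetCAT A \<in> hom1 FSetCAT A A" by (simp add: hom1_FSetCAT fset_id_functor)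
next
  fix f g :: "('o, 'a) fset_fun" and A B D
  assume "f \<in> hom1 FSetCAT A B" "g \<in> hom1 FSetCAT B D"
  then show "g \<odot>\<^bsub>FSetCAT\<^esub> f \<in> hom1 FSetCAT A D" by (simp add: hom1_FSetCAT fset_comp_functor)
next
  fix f :: "('o, 'a) fset_fun" and A B assume "f \<in> hom1 FSetCAT A B"
  then have f: "is_fset_functor f" "FDom f = A" "FCod f = B" by (auto simp: hom1_FSetCAT)
  interpret is_fset_functor f by fact
  note [simp] = D.is_fset_category_axioms C.is_fset_category_axioms f(1)
  show "f \<odot>\<^bsub>FSetCAT\<^esub> Id1 FSetCAT A = f" "Id1 FSetCAT B \<odot>\<^bsub>FSetCAT\<^esub> f = f"
    unfolding f(2,3)[symmetric]
    by (auto intro!: fset_fun_eqI fset_comp_functor fset_id_functor simp: FObj_in FHom_in)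
next
  fix f g h :: "('o, 'a) fset_fun" and A B D E
  assume "f \<in> hom1 FSetCAT A B" "g \<in> hom1 FSetCAT B D" "h \<in> hom1 FSetCAT D E"
  then have fgh: "is_fset_functor f" "is_fset_functor g" "is_fset_functor h" "FDom g = FCod f" "FDom h = FCod g"
    by (auto simp: hom1_FSetCAT)
  interpret f: is_fset_functor f by fact
  interpret g: is_fset_functor g by fact
  show "(h \<odot>\<^bsub>FSetCAT\<^esub> g) \<odot>\<^bsub>FSetCAT\<^esub> f = h \<odot>\<^bsub>FSetCAT\<^esub> (g \<odot>\<^bsub>FSetCAT\<^esub> f)"
    using fgh by (auto intro!: fset_fun_eqI fset_comp_functor simp: f.FObj_in f.FHom_in)
next
  fix f f' g g' s t and A B D :: "('o, 'a) fset_cat"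
  assume "f \<in> hom1 FSetCAT A B" "g \<in> hom1 FSetCAT B D" "s \<in> hom2 FSetCAT f f'" "t \<in> hom2 FSetCAT g g'"
  then show "t \<star>\<^bsub>FSetCAT\<^esub> s \<in> hom2 FSetCAT (g \<odot>\<^bsub>FSetCAT\<^esub> f) (g' \<odot>\<^bsub>FSetCAT\<^esub> f')"
    by (simp add: hom1_FSetCAT fset_hcomp_in)
next
  fix f g and A B D :: "('o, 'a) fset_cat"
  assume "f \<in> hom1 FSetCAT A B" "g \<in> hom1 FSetCAT B D"
  then have fg: "is_fset_functor f" "is_fset_functor g" "FDom g = FCod f" by (auto simp: hom1_FSetCAT)
  interpret f: is_fset_functor f by fact
  interpret g: is_fset_functor g by fact
  note g = g.FObj_in[unfolded fg(3)] g.FHom_Unt[unfolded fg(3)]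
  show "Id2 FSetCAT g \<star>\<^bsub>FSetCAT\<^esub> Id2 FSetCAT f = Id2 FSetCAT (g \<odot>\<^bsub>FSetCAT\<^esub> f)"
    unfolding Cell_FSetCAT
  proof (rule fset_tr_eqI)
    show "fset_hcomp (fset_tr_id g) (fset_tr_id f) \<in> hom2 FSetCAT (fset_comp g f) (fset_comp g f)"
      "fset_tr_id (fset_comp g f) \<in> hom2 FSetCAT (fset_comp g f) (fset_comp g f)"
      using fg by (auto intro!: fset_hcomp_in fset_tr_id_in fset_comp_functor)
    show "TAt (fset_hcomp (fset_tr_id g) (fset_tr_id f)) X = TAt (fset_tr_id (fset_comp g f)) X"
      if "X \<in> Obj (FDom (fset_comp g f))" for X
      using that by (simp add: fg(3) f.FObj_in g g.C.Sub_Unt g.C.Unt_in)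
  qed
next
  fix f f' f'' g g' g'' s s' t t' and A B D :: "('o, 'a) fset_cat"
  assume h1: "f \<in> hom1 FSetCAT A B" "g \<in> hom1 FSetCAT B D"
    and s: "s \<in> hom2 FSetCAT f f'" and s': "s' \<in> hom2 FSetCAT f' f''"
    and t: "t \<in> hom2 FSetCAT g g'" and t': "t' \<in> hom2 FSetCAT g' g''"
  interpret s: is_fset_transformation f f' "TAt s" using s by (simp add: hom2_FSetCAT)
  interpret s': is_fset_transformation f' f'' "TAt s'" using s' by (simp add: hom2_FSetCAT)
  interpret t: is_fset_transformation g g' "TAt t" using t by (simp add: hom2_FSetCAT)
  interpret t': is_fset_transformation g' g'' "TAt t'" using t' by (simp add: hom2_FSetCAT)
  have fg: "FDom g = FCod f" using h1 by (simp add: hom1_FSetCAT)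
  note eq = s.FDom_eq s.FCod_eq t.FDom_eq t.FCod_eq fg
  have st: "TDom s = f" "TCod s = f'" "TDom s' = f'" "TCod s' = f''"
    "TDom t = g" "TCod t = g'" "TDom t' = g'" "TCod t' = g''"
    using s s' t t' by (auto simp: hom2_FSetCAT)
  show "(t' \<cdot>\<^bsub>FSetCAT\<^esub> t) \<star>\<^bsub>FSetCAT\<^esub> (s' \<cdot>\<^bsub>FSetCAT\<^esub> s)
      = (t' \<star>\<^bsub>FSetCAT\<^esub> s') \<cdot>\<^bsub>FSetCAT\<^esub> (t \<star>\<^bsub>FSetCAT\<^esub> s)"
    unfolding Cell_FSetCAT
  proof (rule fset_tr_eqI)
    show "fset_hcomp (fset_vcomp t' t) (fset_vcomp s' s) \<in> hom2 FSetCAT (fset_comp g f) (fset_comp g'' f'')"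
      by (rule fset_hcomp_in[OF fset_vcomp_in[OF s s'] fset_vcomp_in[OF t t'] fg])
    show "fset_vcomp (fset_hcomp t' s') (fset_hcomp t s) \<in> hom2 FSetCAT (fset_comp g f) (fset_comp g'' f'')"
      by (rule fset_vcomp_in[OF fset_hcomp_in[OF s t fg] fset_hcomp_in[OF s' t']]) (simp add: eq)
    fix X assume "X \<in> Obj (FDom (fset_comp g f))"
    then have X: "X \<in> Obj (FDom f)" by simp
    note o = s.F.FObj_in[OF X] s.GObj_in[OF X] s'.GObj_in[unfolded eq, OF X]
    note a = s.at_in[OF X] s'.at_in[unfolded eq, OF X]
    note go = o[THEN t.F.FObj_in[unfolded fg]] o[THEN t.GObj_in[unfolded fg]] o[THEN t'.GObj_in[unfolded eq]]
    note b = o[THEN t.at_in[unfolded fg]] o[THEN t'.at_in[unfolded eq]]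
    note ga = t.F.FHom_in[unfolded fg, OF o(1,2) a(1)] t.F.FHom_in[unfolded fg, OF o(2,3) a(2)]
      t.GHom_in[unfolded fg, OF o(1,2) a(1)] t.GHom_in[unfolded fg, OF o(2,3) a(2)]
    let ?E = "FCod g"
    let ?o = "FObj f X" and ?o' = "FObj f' X" and ?o'' = "FObj f'' X"
    have "TAt (fset_hcomp (fset_vcomp t' t) (fset_vcomp s' s)) X
      = Sub ?E (FObj g ?o) (FObj g ?o'') (FObj g'' ?o'') 1
          (Sub ?E (FObj g ?o'') (FObj g' ?o'') (FObj g'' ?o'') 1 (TAt t' ?o'') [TAt t ?o''])
          [Sub ?E (FObj g ?o) (FObj g ?o') (FObj g ?o'') 1 (FHom g 1 ?o' ?o'' (TAt s' X)) [FHom g 1 ?o ?o' (TAt s X)]]"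
      using X o by (simp add: st fg t.F.FHom_Sub1[unfolded fg] a)
    also have "\<dots> = Sub ?E (FObj g ?o) (FObj g' ?o'') (FObj g'' ?o'') 1 (TAt t' ?o'')
        [Sub ?E (FObj g ?o) (FObj g ?o') (FObj g' ?o'') 1
          (Sub ?E (FObj g ?o') (FObj g ?o'') (FObj g' ?o'') 1 (TAt t ?o'') [FHom g 1 ?o' ?o'' (TAt s' X)])
          [FHom g 1 ?o ?o' (TAt s X)]]"
      using go b ga by (simp add: t.F.C.Sub_assoc1[symmetric] t.F.C.Sub_single_in)
    \<comment> \<open>Interchange is the naturality of \<open>t\<close> at the degree 1 map
      \<open>TAt s' X\<close>; the steps on either side unfold and reassociate.\<close>
    also have "\<dots> = Sub ?E (FObj g ?o) (FObj g' ?o'') (FObj g'' ?o'') 1 (TAt t' ?o'')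
        [Sub ?E (FObj g ?o) (FObj g ?o') (FObj g' ?o'') 1
          (Sub ?E (FObj g ?o') (FObj g' ?o') (FObj g' ?o'') 1 (FHom g' 1 ?o' ?o'' (TAt s' X)) [TAt t ?o'])
          [FHom g 1 ?o ?o' (TAt s X)]]"
      by (simp add: t.natural1[unfolded fg, OF o(2,3) a(2)])
    also have "\<dots> = TAt (fset_vcomp (fset_hcomp t' s') (fset_hcomp t s)) X"
      using X go b ga by (simp add: st eq s'.FDom_eq t.F.C.Sub_assoc11 t.F.C.Sub_single_in)
    finally show "TAt (fset_hcomp (fset_vcomp t' t) (fset_vcomp s' s)) X
      = TAt (fset_vcomp (fset_hcomp t' s') (fset_hcomp t s)) X" .
  qed
next
  fix f f' s and A B :: "('o, 'a) fset_cat"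
  assume h1: "f \<in> hom1 FSetCAT A B" and s: "s \<in> hom2 FSetCAT f f'"
  interpret s: is_fset_transformation f f' "TAt s" using s by (simp add: hom2_FSetCAT)
  have AB: "A = FDom f" "B = FCod f" using h1 by (auto simp: hom1_FSetCAT)
  have st: "TDom s = f" "TCod s = f'" using s by (auto simp: hom2_FSetCAT)
  note eq = s.FDom_eq s.FCod_eq
  have ids: "is_fset_functor (fset_id A)" "is_fset_functor (fset_id B)"
    using AB by (auto intro!: fset_id_functor s.F.FDom_cat s.F.FCod_cat)
  \<comment> \<open>A horizontal composite has composite functors as its boundary, so these
    equalities of functors are needed before components can be compared.\<close>
  have r: "fset_comp F (fset_id A) = F" and l: "fset_comp (fset_id B) F = F"
    if "is_fset_functor F" "FDom F = A" "FCod F = B" for F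
  proof -
    interpret is_fset_functor F by fact
    note [simp] = that
    show "fset_comp F (fset_id A) = F" "fset_comp (fset_id B) F = F"
      using ids FObj_in FHom_in by (auto intro!: fset_fun_eqI fset_comp_functor)
  qed
  note f = s.dom_functor AB[symmetric] and f' = s.cod_functor eq[folded AB]
  show "s \<star>\<^bsub>FSetCAT\<^esub> Id2 FSetCAT (Id1 FSetCAT A) = s"
    unfolding Cell_FSetCAT
  proof (rule fset_tr_eqI[OF _ s])
    show "fset_hcomp s (fset_tr_id (fset_id A)) \<in> hom2 FSetCAT f f'"
      using fset_hcomp_in[OF fset_tr_id_in[OF ids(1)] s] r[OF f] r[OF f'] AB by simp
    show "TAt (fset_hcomp s (fset_tr_id (fset_id A))) X = TAt s X" if "X \<in> Obj (FDom f)" for X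
      using that s.F.FObj_in[of X] s.GObj_in[of X] s.at_in[of X] s.F.D.Unt_in[of X] s.F.FHom_Unt[of X]
      by (simp add: AB st s.F.C.Sub_Unt_right)
  qed
  show "Id2 FSetCAT (Id1 FSetCAT B) \<star>\<^bsub>FSetCAT\<^esub> s = s"
    unfolding Cell_FSetCAT
  proof (rule fset_tr_eqI[OF _ s])
    show "fset_hcomp (fset_tr_id (fset_id B)) s \<in> hom2 FSetCAT f f'"
      using fset_hcomp_in[OF s fset_tr_id_in[OF ids(2)]] l[OF f] l[OF f'] AB by simp
    show "TAt (fset_hcomp (fset_tr_id (fset_id B)) s) X = TAt s X" if "X \<in> Obj (FDom f)" for X
      using that s.F.FObj_in[of X] s.GObj_in[of X] s.at_in[of X]
      by (simp add: AB st s.F.C.Sub_Unt)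
  qed
next
  fix f f' g g' h h' s t r and A B D E :: "('o, 'a) fset_cat"
  assume h1: "f \<in> hom1 FSetCAT A B" "g \<in> hom1 FSetCAT B D" "h \<in> hom1 FSetCAT D E"
    and s: "s \<in> hom2 FSetCAT f f'" and t: "t \<in> hom2 FSetCAT g g'" and r: "r \<in> hom2 FSetCAT h h'"
  interpret s: is_fset_transformation f f' "TAt s" using s by (simp add: hom2_FSetCAT)
  interpret t: is_fset_transformation g g' "TAt t" using t by (simp add: hom2_FSetCAT)
  interpret r: is_fset_transformation h h' "TAt r" using r by (simp add: hom2_FSetCAT)
  have fgh: "FDom g = FCod f" "FDom h = FCod g" using h1 by (auto simp: hom1_FSetCAT)
  note eq = s.FDom_eq s.FCod_eq t.FDom_eq t.FCod_eq fgh
  have st: "TDom s = f" "TCod s = f'" "TDom t = g" "TCod t = g'" "TDom r = h" "TCod r = h'"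
    using s t r by (auto simp: hom2_FSetCAT)
  have assoc: "fset_comp (fset_comp k j) i = fset_comp k (fset_comp j i)"
    if "is_fset_functor i" "is_fset_functor j" "is_fset_functor k" "FDom j = FCod i" "FDom k = FCod j" for i j k :: "('o, 'a) fset_fun"
  proof -
    interpret is_fset_functor i by fact
    show ?thesis using that by (auto intro!: fset_fun_eqI fset_comp_functor simp: FObj_in FHom_in)
  qed
  note a1 = assoc[OF s.dom_functor t.dom_functor r.dom_functor fgh]
  have a2: "fset_comp (fset_comp h' g') f' = fset_comp h' (fset_comp g' f')"
    using assoc[OF s.cod_functor t.cod_functor r.cod_functor] eq r.FDom_eq by simp
  show "(r \<star>\<^bsub>FSetCAT\<^esub> t) \<star>\<^bsub>FSetCAT\<^esub> s = r \<star>\<^bsub>FSetCAT\<^esub> (t \<star>\<^bsub>FSetCAT\<^esub> s)"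
    unfolding Cell_FSetCAT
  proof (rule fset_tr_eqI)
    show "fset_hcomp (fset_hcomp r t) s \<in> hom2 FSetCAT (fset_comp (fset_comp h g) f) (fset_comp (fset_comp h' g') f')"
      using fgh by (intro fset_hcomp_in[OF s fset_hcomp_in[OF t r]]) auto
    show "fset_hcomp r (fset_hcomp t s) \<in> hom2 FSetCAT (fset_comp (fset_comp h g) f) (fset_comp (fset_comp h' g') f')"
      unfolding a1 a2 using fgh by (intro fset_hcomp_in[OF fset_hcomp_in[OF s t] r]) auto
    fix X assume "X \<in> Obj (FDom (fset_comp (fset_comp h g) f))"
    then have X: "X \<in> Obj (FDom f)" by simp
    note o = s.F.FObj_in[OF X] s.GObj_in[OF X]
    note a = s.at_in[OF X]
    note go = o[THEN t.F.FObj_in[unfolded fgh(1)]] o[THEN t.GObj_in[unfolded fgh(1)]]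
    note ga = t.F.FHom_in[unfolded fgh(1), OF o a]
    note b = o[THEN t.at_in[unfolded fgh(1)]]
    note hgo = go[THEN r.F.FObj_in[unfolded fgh(2)]] go[THEN r.GObj_in[unfolded fgh(2)]]
    note hga = r.F.FHom_in[unfolded fgh(2), OF go(1,2) ga] r.F.FHom_in[unfolded fgh(2), OF go(2,4) b(2)]
    note c = go[THEN r.at_in[unfolded fgh(2)]]
    show "TAt (fset_hcomp (fset_hcomp r t) s) X = TAt (fset_hcomp r (fset_hcomp t s)) X"
      using X o a go ga b hgo hga c
      by (simp add: st eq r.F.FHom_Sub1[unfolded fgh(2)] r.F.C.Sub_assoc11 r.F.C.Sub_single_in)
  qed
qed

section \<open>Tensors as splittings\<close>

text \<open>\<open>block n k \<phi>\<close> is \<open>\<phi> \<times> n : k * n \<rightarrow> k' * n\<close>.\<close>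

definition block :: "nat \<Rightarrow> nat \<Rightarrow> (nat \<Rightarrow> nat) \<Rightarrow> nat \<Rightarrow> nat" where
  "block n k \<phi> = (\<lambda>i\<in>{..<k * n}. \<phi> (i div n) * n + i mod n)"

text \<open>Throughout, an index \<open>i\<close> of \<open>k * n\<close> stands for position
  \<open>i mod n\<close> in the summand \<open>i div n\<close>. This agrees with \<open>Inj\<close>
  and with the order in which \<open>concat\<close> lists tuples of length \<open>n\<close>.\<close>

lemma div_mod_less:
  assumes "i < k * (n :: nat)" shows "i div n < k" "i mod n < n"
  using assms by (auto simp: less_mult_imp_div_less) (metis mod_less_divisor mult_0_right not_less0 not_gr_zero)

lemma block_index_less: "\<lbrakk>a < k; c < n\<rbrakk> \<Longrightarrow> a * n + c < k * (n :: nat)"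
proof -
  assume "a < k" "c < n"
  then have "a * n + c < a * n + n" by simp
  also have "\<dots> = Suc a * n" by simp
  also have "\<dots> \<le> k * n" using \<open>a < k\<close> by (intro mult_le_mono1) simp
  finally show ?thesis .
qed

lemma block_in:
  assumes "\<phi> \<in> FinMap k k'" shows "block n k \<phi> \<in> FinMap (k * n) (k' * n)"
  using assms div_mod_less[of _ k n] by (auto simp: block_def FinMap_def intro!: block_index_less)

lemma block_id: "block n k (\<lambda>i\<in>{..<k}. i) = (\<lambda>i\<in>{..<k * n}. i)"
  using div_mod_less[of _ k n] by (auto simp: block_def fun_eq_iff)

lemma block_compose:
  assumes "\<phi> \<in> FinMap k k'"
  shows "block n k (compose {..<k} \<psi> \<phi>) = compose {..<k * n} (block n k' \<psi>) (block n k \<phi>)"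
proof
  fix i show "block n k (compose {..<k} \<psi> \<phi>) i = compose {..<k * n} (block n k' \<psi>) (block n k \<phi>) i"
  proof (cases "i < k * n")
    case True
    then have "i div n < k" "i mod n < n" "\<phi> (i div n) < k'"
      using assms div_mod_less[of i k n] by (auto simp: FinMap_def)
    then show ?thesis using True block_index_less[of "\<phi> (i div n)" k' "i mod n" n] by (simp add: block_def compose_def)
  qed (simp add: block_def compose_def)
qed

lemma block_1: "\<phi> \<in> FinMap n m \<Longrightarrow> block 1 n \<phi> = \<phi>"
  by (auto simp: block_def FinMap_def PiE_def extensional_def)

lemma length_concat_uniform: "\<forall>xs\<in>set xss. length xs = n \<Longrightarrow> length (concat xss) = length xss * n"
  by (induction xss) auto

lemma concat_nth_uniform:
  assumes "\<forall>xs\<in>set xss. length xs = n" "i < length xss * n"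
  shows "concat xss ! i = xss ! (i div n) ! (i mod n)"
  using assms
proof (induction xss arbitrary: i)
  case (Cons xs xss)
  show ?case
  proof (cases "i < n")
    case True
    then show ?thesis using Cons.prems by (simp add: nth_append)
  next
    case False
    have "n > 0" using Cons.prems(2) by (cases n) auto
    with False have "i div n = Suc ((i - n) div n)" "(i - n) mod n = i mod n"
      by (simp_all add: le_div_geq le_mod_geq)
    moreover have "concat xss ! (i - n) = xss ! ((i - n) div n) ! ((i - n) mod n)"
      using Cons.prems False by (intro Cons.IH) auto
    ultimately show ?thesis using Cons.prems False by (simp add: nth_append)
  qed
qed simp

text \<open>The equational form of \<open>exhibits_tensor\<close>.\<close>

definition splits :: "('o, 'a) fset_cat \<Rightarrow> nat \<Rightarrow> 'o \<Rightarrow> 'o \<Rightarrow> 'a \<Rightarrow> 'a list \<Rightarrow> bool" where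
  "splits M n X Z i ps \<longleftrightarrow> i \<in> Hom M n X Z \<and> ps \<in> Tup M n 1 Z X
     \<and> (\<forall>j<n. Sub M X Z X n (ps ! j) [i] = Prj M X n j) \<and> Sub M Z X Z 1 i ps = Unt M Z"

text \<open>\<open>spread M n X Z ps k\<close> is the tuple of all \<open>p\<^sub>c \<circ> \<pi>\<^sub>a \<in> M\<^sub>k(Z, X)\<close>, ordered as
  \<open>k * n = n + ... + n\<close>; substituting it inverts the bijection in \<open>exhibits_tensor\<close>.\<close>

definition spread :: "('o, 'a) fset_cat \<Rightarrow> nat \<Rightarrow> 'o \<Rightarrow> 'o \<Rightarrow> 'a list \<Rightarrow> nat \<Rightarrow> 'a list" where
  "spread M n X Z ps k = map (\<lambda>i. Sub M Z Z X k (ps ! (i mod n)) [Prj M Z k (i div n)]) [0..<k * n]"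

context is_fset_category
begin

text \<open>The universal property is applied with \<open>k = 1\<close>. For target \<open>X\<close>
  surjectivity yields each \<open>p\<^sub>j\<close> as a preimage of \<open>\<pi>\<^sub>j\<close>.
  For target \<open>Z\<close> injectivity yields the second equation, because
  \<open>i \<circ> (p\<^sub>1, ..., p\<^sub>n)\<close> and the unit agree after substitution of
  \<open>i\<close>.\<close>

lemma tensor_splits:
  assumes X: "X \<in> Obj M" and Z: "Z \<in> Obj M" and i: "exhibits_tensor M n X Z i"
  shows "\<exists>ps. splits M n X Z i ps"
proof -
  have i_in: "i \<in> Hom M n X Z" using i by (simp add: exhibits_tensor_def)
  have "Inj n 0 = (\<lambda>j\<in>{..<n}. j)" by (auto simp: Inj_def fun_eq_iff)
  then have "map (\<lambda>j. Act M X Z n (1 * n) (Inj n j) i) [0..<1] = [i]"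
    using X Z i_in by (simp add: One_nat_def Act_id)
  then have bij: "bij_betw (\<lambda>g. Sub M X Z Y n g [i]) (Hom M 1 Z Y) (Hom M n X Y)" if "Y \<in> Obj M" for Y
    using i that unfolding exhibits_tensor_def by (metis mult_1)
  have "\<exists>p\<in>Hom M 1 Z X. Sub M X Z X n p [i] = Prj M X n j" if "j < n" for j
  proof -
    have "Prj M X n j \<in> (\<lambda>g. Sub M X Z X n g [i]) ` Hom M 1 Z X"
      unfolding bij_betw_imp_surj_on[OF bij[OF X]] by (rule Prj_in[OF X that])
    then show ?thesis by (elim imageE) (rule bexI, erule sym, assumption)
  qed
  then obtain p where p: "\<And>j. j < n \<Longrightarrow> p j \<in> Hom M 1 Z X \<and> Sub M X Z X n (p j) [i] = Prj M X n j"
    by metis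
  let ?ps = "map p [0..<n]"
  have ps: "?ps \<in> Tup M n 1 Z X" using p by (intro Tup_map_upt) auto
  have "Sub M X Z Z n (Sub M Z X Z 1 i ?ps) [i] = Sub M X X Z n i (map (\<lambda>g. Sub M X Z X n g [i]) ?ps)"
    using X Z i_in ps by (intro Sub_assoc[symmetric]) auto
  also have "map (\<lambda>g. Sub M X Z X n g [i]) ?ps = Prjs M X n" using p by (simp add: Prjs_def)
  also have "Sub M X X Z n i (Prjs M X n) = Sub M X Z Z n (Unt M Z) [i]"
    using X Z i_in by (simp add: Sub_Prjs Sub_Unt)
  finally have "Sub M Z X Z 1 i ?ps = Unt M Z"
    using bij[OF Z] Sub_in[OF Z X Z i_in ps] Unt_in[OF Z] unfolding bij_betw_def inj_on_def by blast
  then show ?thesis using i_in ps p unfolding splits_def by (intro exI[of _ ?ps]) auto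
qed

lemma spread_in:
  assumes "X \<in> Obj M" "Z \<in> Obj M" "ps \<in> Tup M n 1 Z X"
  shows "spread M n X Z ps k \<in> Tup M (k * n) k Z X"
  unfolding spread_def using assms div_mod_less[of _ k n]
  by (intro Tup_map_upt Sub_single_in Prj_in Tup_nth[of ps]) auto

lemma spread_nth: "i < k * n \<Longrightarrow> spread M n X Z ps k ! i = Sub M Z Z X k (ps ! (i mod n)) [Prj M Z k (i div n)]"
  by (simp add: spread_def)

lemma spread_1:
  assumes "X \<in> Obj M" "Z \<in> Obj M" "ps \<in> Tup M n 1 Z X"
  shows "spread M n X Z ps 1 = ps"
  using assms Tup_nth[OF assms(3)]
  by (auto intro!: nth_equalityI simp: spread_def Tup_length Prj_Unt Sub_Unt_right)

text \<open>The entry at position \<open>c\<close> of summand \<open>a\<close> is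
  \<open>p\<^sub>c \<circ> \<pi>\<^sub>a\<close>, and the action of \<open>\<phi>\<close> replaces
  the index \<open>a\<close> by \<open>\<phi> a\<close>. This is what makes the extension of a
  functor to formal tensors natural in the degree.\<close>

lemma spread_Act:
  assumes X: "X \<in> Obj M" and Z: "Z \<in> Obj M" and ps: "ps \<in> Tup M n 1 Z X" and \<phi>: "\<phi> \<in> FinMap k k'"
  shows "map (\<lambda>i. spread M n X Z ps k' ! block n k \<phi> i) [0..<k * n] = map (Act M Z X k k' \<phi>) (spread M n X Z ps k)"
proof (rule nth_equalityI)
  fix i assume "i < length (map (\<lambda>i. spread M n X Z ps k' ! block n k \<phi> i) [0..<k * n])"
  then have i: "i < k * n" by simp
  note dm = div_mod_less[OF i]
  have b: "block n k \<phi> i = \<phi> (i div n) * n + i mod n" using i by (simp add: block_def)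
  have "\<phi> (i div n) < k'" using \<phi> dm by (auto simp: FinMap_def)
  then have "block n k \<phi> i < k' * n" "block n k \<phi> i div n = \<phi> (i div n)" "block n k \<phi> i mod n = i mod n"
    using b dm block_index_less by auto
  then show "map (\<lambda>i. spread M n X Z ps k' ! block n k \<phi> i) [0..<k * n] ! i = map (Act M Z X k k' \<phi>) (spread M n X Z ps k) ! i"
    using i dm X Z \<phi> Tup_nth[OF ps dm(2)]
    by (simp add: spread_def Act_Prj Sub_Act_single[symmetric] Prj_in)
qed (simp add: spread_def)

text \<open>At position \<open>c\<close> of summand \<open>a\<close> the projection selects
  \<open>i\<close> after the tuple \<open>uss ! a\<close>, and \<open>p\<^sub>c\<close> after
  \<open>i\<close> is \<open>\<pi>\<^sub>c\<close>, which leaves entry \<open>c\<close> of that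
  tuple. In a composite of extended maps the inner \<open>i\<close> and \<open>p\<^sub>c\<close>
  thus cancel and a concatenated tuple remains.\<close>

lemma spread_Sub:
  assumes W: "W \<in> Obj M" and X: "X \<in> Obj M" and Z: "Z \<in> Obj M" and s: "splits M n X Z i ps"
    and uss: "\<And>us. us \<in> set uss \<Longrightarrow> us \<in> Tup M n m W X"
  shows "map (\<lambda>s. Sub M W Z X m s (map (Sub M W X Z m i) uss)) (spread M n X Z ps (length uss)) = concat uss"
    (is "?l = ?r")
proof (rule nth_equalityI)
  have len: "\<forall>us\<in>set uss. length us = n" using Tup_length[OF uss] by blast
  show "length ?l = length ?r" using length_concat_uniform[OF len] by (simp add: spread_def)
  have i: "i \<in> Hom M n X Z" and ps: "ps \<in> Tup M n 1 Z X" using s by (auto simp: splits_def)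
  have ws: "map (Sub M W X Z m i) uss \<in> Tup M (length uss) m W Z"
    using uss W X Z i by (auto simp: Tup_def[of M "length uss"] intro!: Sub_in)
  fix l assume "l < length ?l"
  then have l: "l < length uss * n" by (simp add: spread_def)
  note dm = div_mod_less[OF l]
  note p = Tup_nth[OF ps dm(2)]
  have u: "uss ! (l div n) \<in> Tup M n m W X" using dm uss by auto
  have "?l ! l = Sub M W Z X m (Sub M Z Z X (length uss) (ps ! (l mod n)) [Prj M Z (length uss) (l div n)])
      (map (Sub M W X Z m i) uss)"
    using l by (simp add: spread_def)
  also have "\<dots> = Sub M W Z X m (ps ! (l mod n)) [Sub M W Z Z m (Prj M Z (length uss) (l div n)) (map (Sub M W X Z m i) uss)]"
    using W X Z p dm ws by (intro Sub_assoc1[symmetric] Prj_in) auto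
  also have "\<dots> = Sub M W Z X m (ps ! (l mod n)) [Sub M W X Z m i (uss ! (l div n))]"
    using W Z ws dm by (simp add: Sub_Prj)
  also have "\<dots> = Sub M W X X m (Sub M X Z X n (ps ! (l mod n)) [i]) (uss ! (l div n))"
    using W X Z p i u by (intro Sub_assoc1) auto
  also have "\<dots> = uss ! (l div n) ! (l mod n)"
    using s W X u dm by (simp add: splits_def Sub_Prj)
  also have "\<dots> = concat uss ! l" using concat_nth_uniform[OF len l] by simp
  finally show "?l ! l = ?r ! l" .
qed

end

text \<open>Pointwise inverses are automatically natural. The square of \<open>s\<close> at the
  tuple of all \<open>b X \<circ> \<pi>\<^sub>j\<close> expresses the image of \<open>f\<close>
  under \<open>G\<close> as the component of \<open>s\<close> at \<open>Y\<close> after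
  \<open>F f\<close> at that tuple; composing with \<open>b Y\<close> cancels this
  component.\<close>

lemma iso2I:
  assumes s: "s \<in> hom2 FSetCAT F G"
    and b: "\<And>X. X \<in> Obj (FDom F) \<Longrightarrow> b X \<in> Hom (FCod F) 1 (FObj G X) (FObj F X)"
    and bs: "\<And>X. X \<in> Obj (FDom F) \<Longrightarrow>
      Sub (FCod F) (FObj F X) (FObj G X) (FObj F X) 1 (b X) [TAt s X] = Unt (FCod F) (FObj F X)"
    and sb: "\<And>X. X \<in> Obj (FDom F) \<Longrightarrow>
      Sub (FCod F) (FObj G X) (FObj F X) (FObj G X) 1 (TAt s X) [b X] = Unt (FCod F) (FObj G X)"
  shows "iso2 FSetCAT F G s"
proof -
  interpret s: is_fset_transformation F G "TAt s" using s by (simp add: hom2_FSetCAT)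
  have st: "TDom s = F" "TCod s = G" using s by (auto simp: hom2_FSetCAT)
  note eq = s.FDom_eq s.FCod_eq
  define c where "c = restrict b (Obj (FDom F))"
  let ?N = "FCod F"
  interpret c: fset_family G F c
    by unfold_locales (simp_all add: eq c_def b)
  have "is_fset_transformation G F c"
  proof (rule c.transformationI)
    show "c \<in> extensional (Obj (FDom G))" by (simp add: c_def eq)
    fix n X Y f assume "X \<in> Obj (FDom G)" "Y \<in> Obj (FDom G)" "f \<in> Hom (FDom G) n X Y"
    then have a: "X \<in> Obj (FDom F)" "Y \<in> Obj (FDom F)" "f \<in> Hom (FDom F) n X Y" by (auto simp: eq)
    note oX = s.F.FObj_in[OF a(1)] s.GObj_in[OF a(1)] and oY = s.F.FObj_in[OF a(2)] s.GObj_in[OF a(2)]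
    let ?P = "Prjs ?N (FObj G X) n"
    let ?u = "c.ats n X"
    have u: "?u \<in> Tup ?N n n (FObj G X) (FObj F X)"
      using c.ats_in[of X n] a by (simp add: eq)
    have Ff: "Sub ?N (FObj G X) (FObj F X) (FObj F Y) n (FHom F n X Y f) ?u \<in> Hom ?N n (FObj G X) (FObj F Y)"
      using oX oY u s.F.FHom_in[OF a] by (intro s.F.C.Sub_in)
    have "map (\<lambda>v. Sub ?N (FObj G X) (FObj F X) (FObj G X) n (TAt s X) [v]) ?u
      = map (\<lambda>p. Sub ?N (FObj G X) (FObj G X) (FObj G X) n (Sub ?N (FObj G X) (FObj F X) (FObj G X) 1 (TAt s X) [c X]) [p]) ?P"
      using oX a b s.at_in[OF a(1)] Tup_memD[OF s.F.C.Prjs_in[OF oX(2)]]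
      unfolding c.ats_def eq by (auto simp: c_def intro!: s.F.C.Sub_assoc11)
    also have "\<dots> = ?P"
      using a sb oX Tup_memD[OF s.F.C.Prjs_in[OF oX(2)]]
      by (auto simp: c_def intro!: map_idI s.F.C.Sub_Unt)
    finally have 1: "map (\<lambda>v. Sub ?N (FObj G X) (FObj F X) (FObj G X) n (TAt s X) [v]) ?u = ?P" .
    have "FHom G n X Y f = Sub ?N (FObj G X) (FObj F Y) (FObj G Y) n (TAt s Y)
        [Sub ?N (FObj G X) (FObj F X) (FObj F Y) n (FHom F n X Y f) ?u]"
      using s.natural_at[OF a(1,2) oX(2) a(3) u] s.F.C.Sub_Prjs[OF oX(2) oY(2) s.GHom_in[OF a]] by (simp add: 1)
    then have "Sub ?N (FObj G X) (FObj G Y) (FObj F Y) n (c Y) [FHom G n X Y f]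
      = Sub ?N (FObj G X) (FObj F Y) (FObj F Y) n (Sub ?N (FObj F Y) (FObj G Y) (FObj F Y) 1 (c Y) [TAt s Y])
          [Sub ?N (FObj G X) (FObj F X) (FObj F Y) n (FHom F n X Y f) ?u]"
      using oX oY b[OF a(2)] s.at_in[OF a(2)] Ff a by (simp add: c_def s.F.C.Sub_assoc11)
    also have "\<dots> = Sub ?N (FObj G X) (FObj F X) (FObj F Y) n (FHom F n X Y f) ?u"
      using a bs oX oY Ff by (simp add: c_def s.F.C.Sub_Unt)
    finally show "c.natural_for n X Y f" by (simp add: c.natural_for_def eq)
  qed
  then have t: "\<lparr>TDom = G, TCod = F, TAt = c\<rparr> \<in> hom2 FSetCAT G F" (is "?t \<in> _") by (simp add: hom2_FSetCAT)
  have "fset_vcomp ?t s = fset_tr_id F"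
    using fset_vcomp_in[OF s t] fset_tr_id_in[OF s.dom_functor]
    by (rule fset_tr_eqI) (simp add: st bs c_def)
  moreover have "fset_vcomp s ?t = fset_tr_id G"
    using fset_vcomp_in[OF t s] fset_tr_id_in[OF s.cod_functor]
    by (rule fset_tr_eqI) (simp add: st eq sb c_def)
  ultimately show ?thesis using s t unfolding iso2_def by auto
qed

text \<open>What full faithfulness needs from the unit, freed from all coding. Every object is split
  over an object in the image of \<open>J\<close>, and every map factors as \<open>inc\<close> after
  images of maps after the spread of \<open>prs\<close>. The condition \<open>base\<close> makes the
  splitting trivial on the image of \<open>J\<close>, so that a component extended by the splitting
  formula returns the given one there.\<close>

locale split_generated = J: is_fset_functor J
  for J :: "('o, 'a) fset_fun" +
  fixes rk :: "'o \<Rightarrow> nat" and bs :: "'o \<Rightarrow> 'o" and inc :: "'o \<Rightarrow> 'a" and prs :: "'o \<Rightarrow> 'a list"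
  assumes bs_in: "A \<in> Obj (FCod J) \<Longrightarrow> bs A \<in> Obj (FDom J)"
    and split: "A \<in> Obj (FCod J) \<Longrightarrow> splits (FCod J) (rk A) (FObj J (bs A)) A (inc A) (prs A)"
    and generated: "\<lbrakk>A \<in> Obj (FCod J); B \<in> Obj (FCod J); f \<in> Hom (FCod J) k A B\<rbrakk>
      \<Longrightarrow> \<exists>hs\<in>Tup (FDom J) (rk B) (k * rk A) (bs A) (bs B).
        f = Sub (FCod J) A (FObj J (bs B)) B k (inc B)
          (map (\<lambda>h. Sub (FCod J) A (FObj J (bs A)) (FObj J (bs B)) k (FHom J (k * rk A) (bs A) (bs B) h)
            (spread (FCod J) (rk A) (FObj J (bs A)) A (prs A) k)) hs)"
    and base: "X \<in> Obj (FDom J) \<Longrightarrow> bs (FObj J X) = X \<and> inc (FObj J X) = Unt (FCod J) (FObj J X)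
      \<and> prs (FObj J X) = [Unt (FCod J) (FObj J X)] \<and> rk (FObj J X) = 1"
begin

lemma TAt_whisker:
  assumes s: "s \<in> hom2 FSetCAT H K" and HJ: "FDom H = FCod J" and X: "X \<in> Obj (FDom J)"
  shows "TAt (fset_hcomp s (fset_tr_id J)) X = TAt s (FObj J X)"
proof -
  interpret s: is_fset_transformation H K "TAt s" using s by (simp add: hom2_FSetCAT)
  have st: "TDom s = H" "TCod s = K" using s by (auto simp: hom2_FSetCAT)
  have "FObj J X \<in> Obj (FDom H)" using X J.FObj_in HJ by simp
  then show ?thesis
    using X s.F.FObj_in s.GObj_in s.at_in s.F.FHom_Unt[of "FObj J X"]
    by (simp add: st HJ[symmetric] s.F.C.Sub_Unt_right)
qed

text \<open>The formula \<open>ext\<close> serves twice: it recomputes a given transformation from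
  its restriction, which gives injectivity, and it defines the candidate extension, which gives
  surjectivity once naturality is known on the generators.\<close>

lemma full_faithful:
  assumes H: "H \<in> hom1 FSetCAT (FCod J) N" and K: "K \<in> hom1 FSetCAT (FCod J) N"
  shows "bij_betw (\<lambda>s. fset_hcomp s (fset_tr_id J)) (hom2 FSetCAT H K)
    (hom2 FSetCAT (fset_comp H J) (fset_comp K J))"
proof -
  interpret H: is_fset_functor H using H by (simp add: hom1_FSetCAT)
  interpret K: is_fset_functor K using K by (simp add: hom1_FSetCAT)
  let ?P = "FCod J"
  have HD: "FDom H = ?P" "FCod H = N" and KD: "FDom K = ?P" "FCod K = N"
    using H K by (auto simp: hom1_FSetCAT)
  interpret N: is_fset_category N using H.FCod_cat HD by simp
  note H_in = H.FObj_in[unfolded HD] and H_hom = H.FHom_in[unfolded HD] and H_Sub1 = H.FHom_Sub1[unfolded HD]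
    and H_Sub = H.FHom_Sub[unfolded HD] and H_Prj = H.FHom_Prj[unfolded HD] and H_Unt = H.FHom_Unt[unfolded HD]
  note K_in = K.FObj_in[unfolded KD] and K_hom = K.FHom_in[unfolded KD] and K_Sub1 = K.FHom_Sub1[unfolded KD]
    and K_Sub = K.FHom_Sub[unfolded KD] and K_Prj = K.FHom_Prj[unfolded KD] and K_Unt = K.FHom_Unt[unfolded KD]
  have inc: "inc A \<in> Hom ?P (rk A) (FObj J (bs A)) A" and prs: "prs A \<in> Tup ?P (rk A) 1 A (FObj J (bs A))"
    and prs_inc: "j < rk A \<Longrightarrow> Sub ?P (FObj J (bs A)) A (FObj J (bs A)) (rk A) (prs A ! j) [inc A]
        = Prj ?P (FObj J (bs A)) (rk A) j"
    and inc_prs: "Sub ?P A (FObj J (bs A)) A 1 (inc A) (prs A) = Unt ?P A"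
    if "A \<in> Obj ?P" for A j
    using split[OF that] by (auto simp: splits_def)
  have e: "FObj J (bs A) \<in> Obj ?P" if "A \<in> Obj ?P" for A using that bs_in J.FObj_in by blast
  \<comment> \<open>Write the unit of \<open>A\<close> as
    \<open>i \<circ> (p\<^sub>1, ..., p\<^sub>n)\<close> and apply naturality at \<open>i\<close>:
    this forces the component at \<open>A\<close> to be \<open>K i\<close> after the tuple of all
    \<open>b \<circ> H p\<^sub>j\<close>.\<close>
  define ext where "ext b A = Sub N (FObj H A) (FObj K (FObj J (bs A))) (FObj K A) 1
      (FHom K (rk A) (FObj J (bs A)) A (inc A))
      (map (\<lambda>p. Sub N (FObj H A) (FObj H (FObj J (bs A))) (FObj K (FObj J (bs A))) 1 (b (bs A))
        [FHom H 1 A (FObj J (bs A)) p]) (prs A))" for b A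
  have HP: "map (FHom H 1 A (FObj J (bs A))) (prs A) \<in> Tup N (rk A) 1 (FObj H A) (FObj H (FObj J (bs A)))"
    if "A \<in> Obj ?P" for A
    using that H.FHom_Tup[of A "FObj J (bs A)" "prs A" "rk A" 1] e prs by (simp add: HD)
  have determined: "TAt s A = ext (\<lambda>X. TAt s (FObj J X)) A" if s: "s \<in> hom2 FSetCAT H K" and A: "A \<in> Obj ?P" for s A
  proof -
    interpret s: is_fset_transformation H K "TAt s" using s by (simp add: hom2_FSetCAT)
    have "TAt s A = Sub N (FObj H A) (FObj H A) (FObj K A) 1 (TAt s A) [FHom H 1 A A (Unt ?P A)]"
      using A H_in s.at_in[of A] s.GObj_in[of A] by (simp add: HD H_Unt N.Sub_Unt_right)
    also have "FHom H 1 A A (Unt ?P A) = Sub N (FObj H A) (FObj H (FObj J (bs A))) (FObj H A) 1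
        (FHom H (rk A) (FObj J (bs A)) A (inc A)) (map (FHom H 1 A (FObj J (bs A))) (prs A))"
      using H_Sub[OF A e[OF A] A inc[OF A] prs[OF A]] by (simp add: inc_prs[OF A])
    also have "Sub N (FObj H A) (FObj H A) (FObj K A) 1 (TAt s A) [\<dots>]
        = Sub N (FObj H A) (FObj K (FObj J (bs A))) (FObj K A) 1
          (FHom K (rk A) (FObj J (bs A)) A (inc A))
          (map (\<lambda>u. Sub N (FObj H A) (FObj H (FObj J (bs A))) (FObj K (FObj J (bs A))) 1 (TAt s (FObj J (bs A))) [u])
            (map (FHom H 1 A (FObj J (bs A))) (prs A)))"
      by (rule s.natural_at[unfolded HD, OF e[OF A] A H_in[OF A] inc[OF A] HP[OF A]])
    finally show ?thesis by (simp add: ext_def comp_def)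
  qed
  have "inj_on (\<lambda>s. fset_hcomp s (fset_tr_id J)) (hom2 FSetCAT H K)"
  proof (rule inj_onI)
    fix s t assume s: "s \<in> hom2 FSetCAT H K" and t: "t \<in> hom2 FSetCAT H K"
      and eq: "fset_hcomp s (fset_tr_id J) = fset_hcomp t (fset_tr_id J)"
    have "TAt s (FObj J X) = TAt t (FObj J X)" if "X \<in> Obj (FDom J)" for X
      using TAt_whisker[OF s HD(1) that] TAt_whisker[OF t HD(1) that] eq by simp
    then show "s = t"
      using determined[OF s] determined[OF t] bs_in
      by (intro fset_tr_eqI[OF s t]) (simp add: HD ext_def)
  qed
  moreover have "fset_hcomp s (fset_tr_id J) \<in> hom2 FSetCAT (fset_comp H J) (fset_comp K J)"
    if "s \<in> hom2 FSetCAT H K" for s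
    using fset_hcomp_in[OF fset_tr_id_in[OF J.is_fset_functor_axioms] that HD(1)] .
  moreover have "\<exists>s\<in>hom2 FSetCAT H K. fset_hcomp s (fset_tr_id J) = t"
    if t: "t \<in> hom2 FSetCAT (fset_comp H J) (fset_comp K J)" for t
  proof -
    interpret t: is_fset_transformation "fset_comp H J" "fset_comp K J" "TAt t"
      using t by (simp add: hom2_FSetCAT)
    let ?b = "TAt t"
    have b: "?b X \<in> Hom N 1 (FObj H (FObj J X)) (FObj K (FObj J X))" if "X \<in> Obj (FDom J)" for X
      using t.at_in[of X] that by (simp add: HD)
    define c where "c = (\<lambda>A\<in>Obj ?P. ext ?b A)"
    have bH: "Sub N W (FObj H (FObj J (bs A))) (FObj K (FObj J (bs A))) n (?b (bs A)) [u]
        \<in> Hom N n W (FObj K (FObj J (bs A)))"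
      if "A \<in> Obj ?P" "W \<in> Obj N" "u \<in> Hom N n W (FObj H (FObj J (bs A)))" for A n u W
      using that b[OF bs_in] H_in K_in e by (intro N.Sub_single_in) auto
    have bHs: "map (\<lambda>p. Sub N (FObj H A) (FObj H (FObj J (bs A))) (FObj K (FObj J (bs A))) 1 (?b (bs A))
        [FHom H 1 A (FObj J (bs A)) p]) (prs A) \<in> Tup N (rk A) 1 (FObj H A) (FObj K (FObj J (bs A)))" (is "?bHs A \<in> _")
      if A: "A \<in> Obj ?P" for A
      using A H_in e by (intro Tup_map[OF prs[OF A]] bH H_hom) auto
    have Kinc: "FHom K (rk A) (FObj J (bs A)) A (inc A) \<in> Hom N (rk A) (FObj K (FObj J (bs A))) (FObj K A)"
      if "A \<in> Obj ?P" for A using that e inc by (intro K_hom)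
    interpret c: fset_family H K c
      using H_in K_in e bHs Kinc
      by unfold_locales (auto simp: HD KD c_def ext_def intro!: N.Sub_in)
    \<comment> \<open>The trivial splitting prescribed by \<open>base\<close> turns both outer
      factors of \<open>ext\<close> into units.\<close>
    have cJ: "c (FObj J X) = ?b X" if X: "X \<in> Obj (FDom J)" for X
    proof -
      note JX = J.FObj_in[OF X]
      show ?thesis
        using base[OF X] JX H_in[OF JX] K_in[OF JX] b[OF X] N.Unt_in[OF H_in[OF JX]]
        by (simp add: c_def ext_def H_Unt K_Unt N.Sub_Unt_right N.Sub_Unt)
    qed
    have nat_J: "c.natural_for n (FObj J X) (FObj J Y) (FHom J n X Y h)"
      if "X \<in> Obj (FDom J)" "Y \<in> Obj (FDom J)" "h \<in> Hom (FDom J) n X Y" for n X Y h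
      using t.natural[of X Y h n] that by (simp add: c.natural_for_def c.ats_def cJ HD)
    \<comment> \<open>\<open>K p\<^sub>j\<close> after \<open>K i\<close> is a projection, which
      picks the entry \<open>b \<circ> H p\<^sub>j\<close> out of \<open>c A\<close>; in degree 1
      this is the whole square.\<close>
    have nat_prs: "c.natural_for 1 A (FObj J (bs A)) p" if A: "A \<in> Obj ?P" and p: "p \<in> set (prs A)" for A p
    proof -
      obtain j where j: "j < rk A" "p = prs A ! j"
        using p Tup_length[OF prs[OF A]] by (auto simp: in_set_conv_nth)
      have p_in: "p \<in> Hom ?P 1 A (FObj J (bs A))" using Tup_memD[OF prs[OF A] p] .
      note o = H_in[OF A] K_in[OF A] H_in[OF e[OF A]] K_in[OF e[OF A]]
      have "Sub N (FObj H A) (FObj K A) (FObj K (FObj J (bs A))) 1 (FHom K 1 A (FObj J (bs A)) p) [c A]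
        = Sub N (FObj H A) (FObj K (FObj J (bs A))) (FObj K (FObj J (bs A))) 1
            (Sub N (FObj K (FObj J (bs A))) (FObj K A) (FObj K (FObj J (bs A))) (rk A)
              (FHom K 1 A (FObj J (bs A)) p) [FHom K (rk A) (FObj J (bs A)) A (inc A)]) (?bHs A)"
        unfolding c_def ext_def using A o Kinc[OF A] bHs[OF A] K_hom[OF A e[OF A] p_in]
        by simp (intro N.Sub_assoc1, auto)
      also have "Sub N (FObj K (FObj J (bs A))) (FObj K A) (FObj K (FObj J (bs A))) (rk A)
              (FHom K 1 A (FObj J (bs A)) p) [FHom K (rk A) (FObj J (bs A)) A (inc A)]
          = Prj N (FObj K (FObj J (bs A))) (rk A) j"
        using K_Sub1[OF e[OF A] A e[OF A] p_in inc[OF A]] K_Prj[OF e[OF A] j(1)]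
        by (simp add: j(2) prs_inc[OF A j(1)])
      also have "Sub N (FObj H A) (FObj K (FObj J (bs A))) (FObj K (FObj J (bs A))) 1 \<dots> (?bHs A)
          = Sub N (FObj H A) (FObj H (FObj J (bs A))) (FObj K (FObj J (bs A))) 1 (?b (bs A)) [FHom H 1 A (FObj J (bs A)) p]"
        using N.Sub_Prj[OF o(1,4) bHs[OF A] j(1)] j Tup_length[OF prs[OF A]] by simp
      finally show ?thesis
        using o A N.Prjs_1[OF o(1)] c.at_in[of A] cJ[OF bs_in[OF A]]
        by (simp add: c.natural_for_def c.ats_def HD N.Sub_Unt_right)
    qed
    \<comment> \<open>Dually, each entry \<open>b \<circ> H p\<^sub>j\<close> of \<open>c A\<close>
      becomes \<open>b \<circ> \<pi>\<^sub>j\<close> after substitution of \<open>H i\<close>, which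
      is an entry of \<open>c.ats\<close>.\<close>
    have nat_inc: "c.natural_for (rk A) (FObj J (bs A)) A (inc A)" if A: "A \<in> Obj ?P" for A
    proof -
      note o = H_in[OF A] K_in[OF A] H_in[OF e[OF A]] K_in[OF e[OF A]]
      note Hinc = H_hom[OF e[OF A] A inc[OF A]]
      let ?HJ = "FObj H (FObj J (bs A))" and ?KJ = "FObj K (FObj J (bs A))"
      have "Sub N ?HJ (FObj H A) (FObj K A) (rk A) (c A) [FHom H (rk A) (FObj J (bs A)) A (inc A)]
        = Sub N ?HJ ?KJ (FObj K A) (rk A) (FHom K (rk A) (FObj J (bs A)) A (inc A))
          (map (\<lambda>g. Sub N ?HJ (FObj H A) ?KJ (rk A) g [FHom H (rk A) (FObj J (bs A)) A (inc A)]) (?bHs A))"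
        unfolding c_def ext_def using A o Kinc[OF A] bHs[OF A] Hinc
        by (simp del: map_map) (intro N.Sub_assoc[symmetric], auto)
      also have "map (\<lambda>g. Sub N ?HJ (FObj H A) ?KJ (rk A) g [FHom H (rk A) (FObj J (bs A)) A (inc A)]) (?bHs A)
        = c.ats (rk A) (FObj J (bs A))"
      proof (rule nth_equalityI)
        fix j assume "j < length (map (\<lambda>g. Sub N ?HJ (FObj H A) ?KJ (rk A) g [FHom H (rk A) (FObj J (bs A)) A (inc A)]) (?bHs A))"
        then have j: "j < rk A" "j < length (prs A)" using Tup_length[OF prs[OF A]] by auto
        note p = Tup_nth[OF prs[OF A] j(1)]
        have "Sub N ?HJ (FObj H A) ?KJ (rk A) (Sub N (FObj H A) ?HJ ?KJ 1 (?b (bs A)) [FHom H 1 A (FObj J (bs A)) (prs A ! j)])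
            [FHom H (rk A) (FObj J (bs A)) A (inc A)]
          = Sub N ?HJ ?HJ ?KJ (rk A) (?b (bs A)) [Sub N ?HJ (FObj H A) ?HJ (rk A) (FHom H 1 A (FObj J (bs A)) (prs A ! j))
            [FHom H (rk A) (FObj J (bs A)) A (inc A)]]"
          using o Hinc H_hom[OF A e[OF A] p] b[OF bs_in[OF A]] by (intro N.Sub_assoc11[symmetric]) auto
        also have "Sub N ?HJ (FObj H A) ?HJ (rk A) (FHom H 1 A (FObj J (bs A)) (prs A ! j)) [FHom H (rk A) (FObj J (bs A)) A (inc A)]
          = Prj N ?HJ (rk A) j"
          using H_Sub1[OF e[OF A] A e[OF A] p inc[OF A]] H_Prj[OF e[OF A] j(1)] by (simp add: prs_inc[OF A j(1)])
        finally show "map (\<lambda>g. Sub N ?HJ (FObj H A) ?KJ (rk A) g [FHom H (rk A) (FObj J (bs A)) A (inc A)]) (?bHs A) ! j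
            = c.ats (rk A) (FObj J (bs A)) ! j"
          using j by (simp add: c.ats_nth cJ[OF bs_in[OF A]] HD)
      qed (use Tup_length[OF prs[OF A]] in \<open>simp add: c.ats_def Prjs_def\<close>)
      finally show ?thesis by (simp add: c.natural_for_def HD)
    qed
    have "is_fset_transformation H K c"
    proof (rule c.transformationI)
      show "c \<in> extensional (Obj (FDom H))" by (simp add: c_def HD)
      fix k A B f assume "A \<in> Obj (FDom H)" "B \<in> Obj (FDom H)" "f \<in> Hom (FDom H) k A B"
      then have A: "A \<in> Obj ?P" and B: "B \<in> Obj ?P" and f: "f \<in> Hom ?P k A B" by (auto simp: HD)
      let ?sp = "spread ?P (rk A) (FObj J (bs A)) A (prs A) k"
      let ?g = "\<lambda>h. Sub ?P A (FObj J (bs A)) (FObj J (bs B)) k (FHom J (k * rk A) (bs A) (bs B) h) ?sp"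
      obtain hs where hs: "hs \<in> Tup (FDom J) (rk B) (k * rk A) (bs A) (bs B)"
        and f_eq: "f = Sub ?P A (FObj J (bs B)) B k (inc B) (map ?g hs)"
        using generated[OF A B f] by blast
      have sp: "?sp \<in> Tup ?P (k * rk A) k A (FObj J (bs A))"
        by (rule J.C.spread_in[OF e[OF A] A prs[OF A]])
      have nat_sp: "c.natural_for k A (FObj J (bs A)) u" if u: "u \<in> set ?sp" for u
      proof -
        obtain i where i: "i < k * rk A" "u = Sub ?P A A (FObj J (bs A)) k (prs A ! (i mod rk A)) [Prj ?P A k (i div rk A)]"
          using u by (auto simp: spread_def)
        note dm = div_mod_less[OF i(1)]
        have "prs A ! (i mod rk A) \<in> set (prs A)" using dm Tup_length[OF prs[OF A]] by simp
        then have "c.natural_for k A (FObj J (bs A)) (Sub (FDom H) A A (FObj J (bs A)) k (prs A ! (i mod rk A)) [Prj ?P A k (i div rk A)])"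
          using A e[OF A] Tup_memD[OF prs[OF A]] nat_prs[OF A] c.natural_for_Prj[of A "i div rk A" k] J.C.Prj_in[OF A dm(1)] dm
          by (intro c.natural_for_Sub[where m = 1 and Y = A]) (auto simp: HD)
        then show ?thesis by (simp add: i(2) HD)
      qed
      have nat_g: "c.natural_for k A (FObj J (bs B)) (?g h)" if "h \<in> set hs" for h
      proof -
        have "c.natural_for k A (FObj J (bs B)) (Sub (FDom H) A (FObj J (bs A)) (FObj J (bs B)) k (FHom J (k * rk A) (bs A) (bs B) h) ?sp)"
          using A e[OF A] e[OF B] sp nat_sp Tup_memD[OF hs that] bs_in[OF A] bs_in[OF B]
          by (intro c.natural_for_Sub[where m = "k * rk A" and Y = "FObj J (bs A)"] nat_J) (auto simp: HD intro: J.FHom_in)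
        then show ?thesis by (simp add: HD)
      qed
      have gs: "map ?g hs \<in> Tup ?P (rk B) k A (FObj J (bs B))"
        using A e[OF A] e[OF B] bs_in[OF A] bs_in[OF B] sp by (intro Tup_map[OF hs] J.C.Sub_in) (auto intro: J.FHom_in)
      have "c.natural_for k A B (Sub (FDom H) A (FObj J (bs B)) B k (inc B) (map ?g hs))"
        using A B e[OF B] inc[OF B] nat_inc[OF B] gs nat_g
        by (intro c.natural_for_Sub[where m = "rk B" and Y = "FObj J (bs B)"]) (auto simp: HD)
      then show "c.natural_for k A B f" by (simp add: HD f_eq[symmetric])
    qed
    then have s: "\<lparr>TDom = H, TCod = K, TAt = c\<rparr> \<in> hom2 FSetCAT H K" (is "?s \<in> _") by (simp add: hom2_FSetCAT)
    have "fset_hcomp ?s (fset_tr_id J) = t"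
      by (rule fset_tr_eqI[OF fset_hcomp_in[OF fset_tr_id_in[OF J.is_fset_functor_axioms] s HD(1)] t])
        (simp only: fset_fun_simps TAt_whisker[OF s HD(1)] fset_tr.simps cJ)
    with s show ?thesis by blast
  qed
  ultimately show ?thesis unfolding bij_betw_def by (auto simp: image_iff)
qed

end

section \<open>The free completion under tensors\<close>

text \<open>Iterated pairing is shown to be injective among lists of equal length, so the length is
  stored separately through an injection \<open>c\<close> of the naturals; \<open>c 0\<close> is an
  arbitrary starting value for the fold.\<close>

lemma infinite_list_inj:
  assumes "infinite (UNIV :: 'a set)"
  shows "\<exists>enc :: 'a list \<Rightarrow> 'a. inj enc"
proof -
  obtain p :: "'a \<times> 'a \<Rightarrow> 'a" where p: "inj p"
    using card_of_Times_same_infinite[OF assms] ordIso_imp_ordLeq card_of_ordLeq[of "UNIV \<times> UNIV :: ('a \<times> 'a) set" "UNIV :: 'a set"]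
    by auto
  obtain c :: "nat \<Rightarrow> 'a" where c: "inj c"
    using assms infinite_countable_subset by blast
  define code where "code = foldr (\<lambda>x y. p (x, y))"
  have "xs = ys" if "length xs = length ys" "code xs (c 0) = code ys (c 0)" for xs ys
    using that by (induction xs ys rule: list_induct2) (simp_all add: code_def inj_eq[OF p])
  then have "inj (\<lambda>xs. p (c (length xs), code xs (c 0)))"
    by (auto intro!: injI simp: inj_eq[OF p] inj_eq[OF c])
  then show ?thesis by blast
qed

text \<open>A bijection and not only an injection: every element is then the code of exactly one
  tuple, so maps of the completion can be compared after decoding.\<close>

lemma infinite_list_bij:
  assumes "infinite (UNIV :: 'a set)"
  shows "\<exists>enc :: 'a list \<Rightarrow> 'a. bij enc"
proof -
  obtain f :: "'a list \<Rightarrow> 'a" where "inj f" using infinite_list_inj[OF assms] by blast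
  moreover have "inj (\<lambda>x :: 'a. [x])" by (simp add: inj_def)
  ultimately show ?thesis
    using Schroeder_Bernstein[of f UNIV UNIV "\<lambda>x. [x]"] by auto
qed

text \<open>Meant for objects. Bijectivity makes every element a formal tensor with a definite rank
  and base, so that both are total functions and an object of the completion is recognised by its
  base.\<close>

lemma infinite_nat_Times_bij:
  assumes "infinite (UNIV :: 'a set)"
  shows "\<exists>enc :: nat \<times> 'a \<Rightarrow> 'a. bij enc"
proof -
  obtain p :: "'a \<times> 'a \<Rightarrow> 'a" where p: "inj p"
    using card_of_Times_same_infinite[OF assms] ordIso_imp_ordLeq card_of_ordLeq[of "UNIV \<times> UNIV :: ('a \<times> 'a) set" "UNIV :: 'a set"]
    by auto
  obtain c :: "nat \<Rightarrow> 'a" where c: "inj c"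
    using assms infinite_countable_subset by blast
  have "inj (\<lambda>(n, x). p (c n, x))" by (auto intro!: injI simp: inj_eq[OF p] inj_eq[OF c])
  moreover have "inj (\<lambda>x :: 'a. (0 :: nat, x))" by (simp add: inj_def)
  ultimately show ?thesis
    using Schroeder_Bernstein[of "\<lambda>(n, x). p (c n, x)" UNIV UNIV "\<lambda>x. (0, x)"] by auto
qed

text \<open>Objects \<open>y\<^sub>n \<otimes> X\<close> and tuples of maps must be coded in the types of the objects and maps of \<open>M\<close>;
  \<open>ob n X\<close> codes \<open>y\<^sub>n \<otimes> X\<close>. This is where the two types have to be infinite.\<close>

locale encoding =
  fixes enc :: "'a list \<Rightarrow> 'a" and dec :: "'a \<Rightarrow> 'a list"
    and ob :: "nat \<Rightarrow> 'o \<Rightarrow> 'o" and rk :: "'o \<Rightarrow> nat" and bs :: "'o \<Rightarrow> 'o"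
  assumes dec_enc [simp]: "dec (enc fs) = fs" and enc_dec [simp]: "enc (dec f) = f"
    and rk_ob [simp]: "rk (ob n X) = n" and bs_ob [simp]: "bs (ob n X) = X" and ob_rk_bs [simp]: "ob (rk A) (bs A) = A"
begin

lemma enc_eq_iff [simp]: "enc fs = enc gs \<longleftrightarrow> fs = gs"
  by (metis dec_enc)

lemma dec_eqI: "dec f = dec g \<Longrightarrow> f = g"
  by (metis enc_dec)

text \<open>Ranks are unrestricted, 0 included: it is the base that has to be an object of
  \<open>M\<close>. A map of degree \<open>k\<close> out of \<open>A\<close> has entries of degree
  \<open>k * rk A\<close>, and therefore \<open>\<phi>\<close> acts on it through
  \<open>block\<close>. The unit has degree 1, so its entries are the \<open>rk A\<close>
  projections of degree \<open>1 * rk A\<close>.\<close>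

definition completion :: "('o, 'a) fset_cat \<Rightarrow> ('o, 'a) fset_cat" where
  "completion M = \<lparr>Obj = {A. bs A \<in> Obj M},
     Hom = (\<lambda>k A B. {f. dec f \<in> Tup M (rk B) (k * rk A) (bs A) (bs B)}),
     Act = (\<lambda>A B k k' \<phi> f. enc (map (Act M (bs A) (bs B) (k * rk A) (k' * rk A) (block (rk A) k \<phi>)) (dec f))),
     Unt = (\<lambda>A. enc (Prjs M (bs A) (rk A))),
     Sub = (\<lambda>A B C k g fs. enc (map (\<lambda>h. Sub M (bs A) (bs B) (bs C) (k * rk A) h (concat (map dec fs))) (dec g)))\<rparr>"

lemma completion_simps [simp]:
  "A \<in> Obj (completion M) \<longleftrightarrow> bs A \<in> Obj M"
  "f \<in> Hom (completion M) k A B \<longleftrightarrow> dec f \<in> Tup M (rk B) (k * rk A) (bs A) (bs B)"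
  "Act (completion M) A B k k' \<phi> f = enc (map (Act M (bs A) (bs B) (k * rk A) (k' * rk A) (block (rk A) k \<phi>)) (dec f))"
  "Unt (completion M) A = enc (Prjs M (bs A) (rk A))"
  "Sub (completion M) A B C k g fs = enc (map (\<lambda>h. Sub M (bs A) (bs B) (bs C) (k * rk A) h (concat (map dec fs))) (dec g))"
  by (simp_all add: completion_def)

lemma completion_Tup_length:
  assumes "fs \<in> Tup (completion M) p k A B"
  shows "\<forall>xs\<in>set (map dec fs). length xs = rk B"
  using assms by (auto simp: Tup_def)

lemma completion_Tup_concat:
  assumes "fs \<in> Tup (completion M) p k A B"
  shows "concat (map dec fs) \<in> Tup M (p * rk B) (k * rk A) (bs A) (bs B)"
  using length_concat_uniform[OF completion_Tup_length[OF assms]] assms by (fastforce simp: Tup_def)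

lemma completion_concat_nth:
  assumes "fs \<in> Tup (completion M) p k A B" "i < p * rk B"
  shows "concat (map dec fs) ! i = dec (fs ! (i div rk B)) ! (i mod rk B)"
  using assms concat_nth_uniform[OF completion_Tup_length[OF assms(1)], of i] div_mod_less[OF assms(2)]
  by (simp add: Tup_length[OF assms(1)])

end

locale encoded_category = encoding enc dec ob rk bs + M: is_fset_category M
  for enc :: "'a list \<Rightarrow> 'a" and dec and ob :: "nat \<Rightarrow> 'o \<Rightarrow> 'o" and rk bs
    and M :: "('o, 'a) fset_cat"
begin

text \<open>Multiplied by the rank, the map from \<open>1\<close> to \<open>n\<close> with value
  \<open>i\<close> becomes the inclusion of the block with number \<open>i\<close>. It carries the
  unit, a full tuple of projections, to the projections of that block.\<close>

lemma dec_Prj: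
  assumes "bs A \<in> Obj M" "i < n"
  shows "dec (Prj (completion M) A n i) = map (\<lambda>j. Prj M (bs A) (n * rk A) (i * rk A + j)) [0..<rk A]"
proof -
  have *: "(\<lambda>j\<in>{..<1}. i) \<in> FinMap 1 n" using assms by (auto simp: FinMap_def)
  have "block (rk A) 1 (\<lambda>j\<in>{..<1}. i) \<in> FinMap (rk A) (n * rk A)"
    using block_in[OF *, of "rk A"] by simp
  then show ?thesis
    using assms(1) by (auto simp: Prj_def[of "completion M"] Prjs_def M.Act_Prj) (simp add: block_def)
qed

text \<open>The blocks, listed one after another, run through every projection once and in order.
  This reduces the right unit law of the completion to \<open>Sub_Prjs\<close> of
  \<open>M\<close>.\<close>

lemma concat_Prjs:
  assumes "bs A \<in> Obj M"
  shows "concat (map dec (Prjs (completion M) A n)) = Prjs M (bs A) (n * rk A)"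
proof -
  have len: "\<forall>xs\<in>set (map dec (Prjs (completion M) A n)). length xs = rk A"
    using assms by (auto simp: Prjs_def dec_Prj)
  show ?thesis
  proof (rule nth_equalityI)
    show "length (concat (map dec (Prjs (completion M) A n))) = length (Prjs M (bs A) (n * rk A))"
      using length_concat_uniform[OF len] by (simp add: Prjs_def)
    then show "concat (map dec (Prjs (completion M) A n)) ! i = Prjs M (bs A) (n * rk A) ! i"
      if "i < length (concat (map dec (Prjs (completion M) A n)))" for i
      using that concat_nth_uniform[OF len, of i] div_mod_less[of i n "rk A"] assms
      by (simp add: Prjs_def dec_Prj)
  qed
qed

text \<open>After decoding, the laws of substitution are those of \<open>M\<close> for every entry
  of the outer map, with the concatenation of the decoded arguments as tuple. What has to be shown
  is how concatenation interacts with reindexing, with projections and with substitution.\<close>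

lemma completion_category: "is_fset_category (completion M)"
proof (rule is_fset_category.intro)
  fix X Y n m \<phi> f
  assume "X \<in> Obj (completion M)" "Y \<in> Obj (completion M)" "\<phi> \<in> FinMap n m" "f \<in> Hom (completion M) n X Y"
  then show "Act (completion M) X Y n m \<phi> f \<in> Hom (completion M) m X Y"
    using block_in by (auto intro!: Tup_map M.Act_in)
next
  fix X Y f n
  assume "X \<in> Obj (completion M)" "Y \<in> Obj (completion M)" "f \<in> Hom (completion M) n X Y"
  then show "Act (completion M) X Y n n (\<lambda>i\<in>{..<n}. i) f = f"
    by (intro dec_eqI) (auto simp: block_id intro!: map_idI M.Act_id dest: Tup_memD)
next
  fix X Y \<phi> n m \<psi> k f
  assume "X \<in> Obj (completion M)" "Y \<in> Obj (completion M)" "\<phi> \<in> FinMap n m" "\<psi> \<in> FinMap m k" "f \<in> Hom (completion M) n X Y"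
  then show "Act (completion M) X Y n k (compose {..<n} \<psi> \<phi>) f = Act (completion M) X Y m k \<psi> (Act (completion M) X Y n m \<phi> f)"
    by (intro dec_eqI) (auto simp: block_compose intro!: M.Act_comp block_in dest: Tup_memD)
next
  fix X assume "X \<in> Obj (completion M)"
  then show "Unt (completion M) X \<in> Hom (completion M) 1 X X" by (simp add: M.Prjs_in)
next
  fix X Y Z g m n fs
  assume a: "X \<in> Obj (completion M)" "Y \<in> Obj (completion M)" "Z \<in> Obj (completion M)" "g \<in> Hom (completion M) m Y Z" "fs \<in> Tup (completion M) m n X Y"
  note cs = completion_Tup_concat[OF a(5)]
  show "Sub (completion M) X Y Z n g fs \<in> Hom (completion M) n X Z"
    using a cs by (auto intro!: Tup_map M.Sub_in)
  fix \<psi> n' assume \<psi>: "\<psi> \<in> FinMap n n'"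
  have eq: "concat (map dec (map (Act (completion M) X Y n n' \<psi>) fs))
      = map (Act M (bs X) (bs Y) (n * rk X) (n' * rk X) (block (rk X) n \<psi>)) (concat (map dec fs))"
    by (simp add: map_concat comp_def)
  show "Sub (completion M) X Y Z n' g (map (Act (completion M) X Y n n' \<psi>) fs) = Act (completion M) X Z n n' \<psi> (Sub (completion M) X Y Z n g fs)"
    unfolding completion_simps(5) eq using a cs block_in[OF \<psi>]
    by (intro dec_eqI) (auto intro!: M.Sub_natural dest: Tup_memD)
next
  fix X Y Z \<phi> m m' g fs n
  assume a: "X \<in> Obj (completion M)" "Y \<in> Obj (completion M)" "Z \<in> Obj (completion M)" "\<phi> \<in> FinMap m m'"
    "g \<in> Hom (completion M) m Y Z" "fs \<in> Tup (completion M) m' n X Y"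
  let ?r = "rk Y"
  have \<phi>: "\<phi> i < m'" if "i < m" for i using a(4) that by (auto simp: FinMap_def)
  have fs': "map (\<lambda>i. fs ! \<phi> i) [0..<m] \<in> Tup (completion M) m n X Y"
    using Tup_nth[OF a(6)] \<phi> by (intro Tup_map_upt) auto
  \<comment> \<open>Reindexing the concatenation by \<open>block\<close> moves whole blocks and
    keeps the position inside each, so it agrees with concatenating the reindexed tuple.\<close>
  have "map (\<lambda>i. concat (map dec fs) ! block ?r m \<phi> i) [0..<m * ?r] = concat (map dec (map (\<lambda>i. fs ! \<phi> i) [0..<m]))"
  proof (rule nth_equalityI)
    show "length (map (\<lambda>i. concat (map dec fs) ! block ?r m \<phi> i) [0..<m * ?r])
        = length (concat (map dec (map (\<lambda>i. fs ! \<phi> i) [0..<m])))"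
      using Tup_length[OF completion_Tup_concat[OF fs']] by simp
    fix i assume "i < length (map (\<lambda>i. concat (map dec fs) ! block ?r m \<phi> i) [0..<m * ?r])"
    then have i: "i < m * ?r" by simp
    note dm = div_mod_less[OF i]
    have "concat (map dec fs) ! (\<phi> (i div ?r) * ?r + i mod ?r) = dec (fs ! \<phi> (i div ?r)) ! (i mod ?r)"
      using completion_concat_nth[OF a(6), of "\<phi> (i div ?r) * ?r + i mod ?r"] block_index_less[OF \<phi>[OF dm(1)] dm(2)] dm by simp
    then show "map (\<lambda>i. concat (map dec fs) ! block ?r m \<phi> i) [0..<m * ?r] ! i
        = concat (map dec (map (\<lambda>i. fs ! \<phi> i) [0..<m])) ! i"
      using i dm completion_concat_nth[OF fs' i] by (simp add: block_def del: map_map)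
  qed
  then show "Sub (completion M) X Y Z n (Act (completion M) Y Z m m' \<phi> g) fs = Sub (completion M) X Y Z n g (map (\<lambda>i. fs ! \<phi> i) [0..<m])"
    using a M.Sub_dinatural[OF _ _ _ block_in[OF a(4)] _ completion_Tup_concat[OF a(6)]]
    by (intro dec_eqI) (auto dest: Tup_memD simp del: map_map simp: map_map[of "\<lambda>h. Sub M _ _ _ _ h _"])
next
  fix X Y fs n k i
  assume a: "X \<in> Obj (completion M)" "Y \<in> Obj (completion M)" "fs \<in> Tup (completion M) n k X Y" "i < n"
  have "dec (fs ! i) \<in> Tup M (rk Y) (k * rk X) (bs X) (bs Y)"
    using Tup_nth[OF a(3,4)] by simp
  then have "length (dec (fs ! i)) = rk Y" by (rule Tup_length)
  then show "Sub (completion M) X Y Y k (Prj (completion M) Y n i) fs = fs ! i"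
    using a M.Sub_Prj[OF _ _ completion_Tup_concat[OF a(3)]] block_index_less[OF a(4)] completion_concat_nth[OF a(3)]
    by (intro dec_eqI) (auto simp: dec_Prj intro!: nth_equalityI)
next
  fix X Y g n
  assume "X \<in> Obj (completion M)" "Y \<in> Obj (completion M)" "g \<in> Hom (completion M) n X Y"
  then show "Sub (completion M) X X Y n g (Prjs (completion M) X n) = g"
    by (intro dec_eqI) (auto simp: concat_Prjs intro!: map_idI M.Sub_Prjs dest: Tup_memD)
next
  fix W X Y Z h j gs k fs n
  assume a: "W \<in> Obj (completion M)" "X \<in> Obj (completion M)" "Y \<in> Obj (completion M)" "Z \<in> Obj (completion M)"
    "h \<in> Hom (completion M) j Y Z" "gs \<in> Tup (completion M) j k X Y" "fs \<in> Tup (completion M) k n W X"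
  have "concat (map dec (map (\<lambda>g. Sub (completion M) W X Y n g fs) gs))
      = map (\<lambda>q. Sub M (bs W) (bs X) (bs Y) (n * rk W) q (concat (map dec fs))) (concat (map dec gs))"
    by (simp add: map_concat comp_def)
  then show "Sub (completion M) W Y Z n h (map (\<lambda>g. Sub (completion M) W X Y n g fs) gs)
      = Sub (completion M) W X Z n (Sub (completion M) X Y Z k h gs) fs"
    using a M.Sub_assoc[OF _ _ _ _ _ completion_Tup_concat[OF a(6)] completion_Tup_concat[OF a(7)]]
    by (intro dec_eqI) (auto dest: Tup_memD simp del: map_map simp: map_map[of "\<lambda>h. Sub M _ _ _ _ h _"])
qed

text \<open>Tensoring a formal tensor with \<open>y\<^sub>p\<close> multiplies its rank by
  \<open>p\<close> and keeps its base. The hom-sets to be compared then coincide as sets, since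
  \<open>k * (p * n) = (k * p) * n\<close>, and the comparison map is the identity.\<close>

lemma completion_representable: "representable (completion M)"
  unfolding representable_def
proof (intro ballI allI)
  fix A p assume "A \<in> Obj (completion M)"
  then have A: "bs A \<in> Obj M" by simp
  let ?Z = "ob (p * rk A) (bs A)"
  let ?i = "enc (Prjs M (bs A) (p * rk A))"
  have "exhibits_tensor (completion M) p A ?Z ?i"
    unfolding exhibits_tensor_def
  proof (intro conjI ballI allI)
    show "?i \<in> Hom (completion M) p A ?Z" using A by (simp add: M.Prjs_in)
    fix B k assume "B \<in> Obj (completion M)"
    then have B: "bs B \<in> Obj M" by simp
    let ?fs = "map (\<lambda>j. Act (completion M) A ?Z p (k * p) (Inj p j) ?i) [0..<k]"
    let ?n = "rk A"
    \<comment> \<open>Multiplied by the rank, \<open>Inj p j\<close> is the inclusion of block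
      \<open>j\<close> of length \<open>p * rk A\<close>; for \<open>j < k\<close> these blocks
      together exhaust the projections.\<close>
    have dec_j: "dec (Act (completion M) A ?Z p (k * p) (Inj p j) ?i)
        = map (\<lambda>l. Prj M (bs A) (k * p * ?n) (j * (p * ?n) + l)) [0..<p * ?n]" if "j < k" for j
    proof -
      have "Inj p j \<in> FinMap p (k * p)"
        using block_index_less[OF that, of _ p] by (auto simp: Inj_def FinMap_def)
      note b = block_in[OF this, of ?n]
      have "block ?n p (Inj p j) l = j * (p * ?n) + l" if "l < p * ?n" for l
        using that div_mod_less[OF that] by (simp add: block_def Inj_def algebra_simps)
      then show ?thesis using A b by (simp add: Prjs_def M.Act_Prj)
    qed
    have len: "\<forall>xs\<in>set (map dec ?fs). length xs = p * ?n"
      using dec_j by (auto simp del: completion_simps)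
    have "concat (map dec ?fs) = Prjs M (bs A) (k * p * ?n)"
    proof (rule nth_equalityI)
      show "length (concat (map dec ?fs)) = length (Prjs M (bs A) (k * p * ?n))"
        using length_concat_uniform[OF len] by (simp add: Prjs_def)
      then show "concat (map dec ?fs) ! l = Prjs M (bs A) (k * p * ?n) ! l" if "l < length (concat (map dec ?fs))" for l
        using that concat_nth_uniform[OF len, of l] div_mod_less[of l k "p * ?n"] dec_j
        by (simp add: Prjs_def mult.assoc del: completion_simps) (simp only: div_mult_mod_eq)
    qed
    then have "Sub (completion M) A ?Z B (k * p) g ?fs = g" if "g \<in> Hom (completion M) k ?Z B" for g
      using that A B M.Sub_Prjs[OF A B]
      by (intro dec_eqI) (auto intro!: map_idI dest: Tup_memD simp: mult.assoc simp del: map_map)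
    moreover have "Hom (completion M) k ?Z B = Hom (completion M) (k * p) A B"
      by (auto simp: mult.assoc)
    ultimately show "bij_betw (\<lambda>g. Sub (completion M) A ?Z B (k * p) g ?fs) (Hom (completion M) k ?Z B) (Hom (completion M) (k * p) A B)"
      by (intro bij_betwI[of _ _ _ "\<lambda>g. g"]) auto
  qed
  then show "\<exists>Z\<in>Obj (completion M). \<exists>i. exhibits_tensor (completion M) p A Z i"
    using A by (intro bexI[of _ ?Z]) auto
qed

end

lemma upt_1 [simp]: "[0..<1] = [0 :: nat]"
  by (simp add: One_nat_def)

section \<open>Functoriality of the completion and naturality of its unit\<close>

context encoding
begin

definition completion_fun :: "('o, 'a) fset_fun \<Rightarrow> ('o, 'a) fset_fun" where
  "completion_fun F = \<lparr>FDom = completion (FDom F), FCod = completion (FCod F),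
     FObj = (\<lambda>A\<in>Obj (completion (FDom F)). ob (rk A) (FObj F (bs A))),
     FHom = FHom_restrict (completion (FDom F)) (\<lambda>k A B f. enc (map (FHom F (k * rk A) (bs A) (bs B)) (dec f)))\<rparr>"

definition eta :: "('o, 'a) fset_cat \<Rightarrow> ('o, 'a) fset_fun" where
  "eta M = \<lparr>FDom = M, FCod = completion M, FObj = (\<lambda>X\<in>Obj M. ob 1 X),
     FHom = FHom_restrict M (\<lambda>n X Y f. enc [f])\<rparr>"

lemma completion_fun_simps [simp]:
  "FDom (completion_fun F) = completion (FDom F)" "FCod (completion_fun F) = completion (FCod F)"
  "bs A \<in> Obj (FDom F) \<Longrightarrow> FObj (completion_fun F) A = ob (rk A) (FObj F (bs A))"
  "\<lbrakk>bs A \<in> Obj (FDom F); bs B \<in> Obj (FDom F); dec f \<in> Tup (FDom F) (rk B) (k * rk A) (bs A) (bs B)\<rbrakk>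
    \<Longrightarrow> FHom (completion_fun F) k A B f = enc (map (FHom F (k * rk A) (bs A) (bs B)) (dec f))"
  by (simp_all add: completion_fun_def)

lemma eta_simps [simp]:
  "FDom (eta M) = M" "FCod (eta M) = completion M"
  "X \<in> Obj M \<Longrightarrow> FObj (eta M) X = ob 1 X"
  "\<lbrakk>X \<in> Obj M; Y \<in> Obj M; f \<in> Hom M n X Y\<rbrakk> \<Longrightarrow> FHom (eta M) n X Y f = enc [f]"
  by (simp_all add: eta_def)

lemma encoded_categoryI: "is_fset_category M \<Longrightarrow> encoded_category enc dec ob rk bs M"
  by (intro encoded_category.intro encoding_axioms)

lemmas completion_category' = encoded_category.completion_category[OF encoded_categoryI]

text \<open>The functor acts entrywise, and entrywise maps commute with \<open>concat\<close>; each
  law is therefore that of \<open>F\<close> at the entries.\<close>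

lemma completion_fun_functor:
  assumes "is_fset_functor F" shows "is_fset_functor (completion_fun F)"
proof -
  interpret F: is_fset_functor F by fact
  interpret L: is_fset_category "completion (FDom F)" by (rule completion_category'[OF F.FDom_cat])
  show ?thesis
  proof (rule is_fset_functor.intro)
    show "is_fset_category (FDom (completion_fun F))" "is_fset_category (FCod (completion_fun F))"
      by (simp_all add: completion_category' F.FDom_cat F.FCod_cat)
    show "FObj (completion_fun F) \<in> extensional (Obj (FDom (completion_fun F)))" "FHom_restrict (FDom (completion_fun F)) (FHom (completion_fun F)) = FHom (completion_fun F)"
      by (simp_all add: completion_fun_def)
  next
    fix X assume X: "X \<in> Obj (FDom (completion_fun F))"
    then show "FObj (completion_fun F) X \<in> Obj (FCod (completion_fun F))" by (simp add: F.FObj_in)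
    show "FHom (completion_fun F) 1 X X (Unt (FDom (completion_fun F)) X) = Unt (FCod (completion_fun F)) (FObj (completion_fun F) X)"
      using X by (simp add: F.D.Prjs_in F.FHom_Prjs)
  next
    fix X Y f n assume "X \<in> Obj (FDom (completion_fun F))" "Y \<in> Obj (FDom (completion_fun F))" "f \<in> Hom (FDom (completion_fun F)) n X Y"
    then show "FHom (completion_fun F) n X Y f \<in> Hom (FCod (completion_fun F)) n (FObj (completion_fun F) X) (FObj (completion_fun F) Y)"
      by (simp add: F.FHom_Tup)
  next
    fix X Y \<phi> n m f
    assume "X \<in> Obj (FDom (completion_fun F))" "Y \<in> Obj (FDom (completion_fun F))" "\<phi> \<in> FinMap n m" "f \<in> Hom (FDom (completion_fun F)) n X Y"
    then show "FHom (completion_fun F) m X Y (Act (FDom (completion_fun F)) X Y n m \<phi> f)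
        = Act (FCod (completion_fun F)) (FObj (completion_fun F) X) (FObj (completion_fun F) Y) n m \<phi> (FHom (completion_fun F) n X Y f)"
      using L.Act_in[of X Y \<phi> n m f] by (auto intro!: F.FHom_natural block_in dest: Tup_memD)
  next
    fix X Y Z g m n fs
    assume a: "X \<in> Obj (FDom (completion_fun F))" "Y \<in> Obj (FDom (completion_fun F))" "Z \<in> Obj (FDom (completion_fun F))"
      "g \<in> Hom (FDom (completion_fun F)) m Y Z" "fs \<in> Tup (FDom (completion_fun F)) m n X Y"
    have "map dec (map (FHom (completion_fun F) n X Y) fs) = map (map (FHom F (n * rk X) (bs X) (bs Y))) (map dec fs)"
      using a Tup_memD[of _ "completion (FDom F)"] by auto
    then have cs: "concat (map dec (map (FHom (completion_fun F) n X Y) fs)) = map (FHom F (n * rk X) (bs X) (bs Y)) (concat (map dec fs))"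
      by (simp only: map_concat)
    have "FHom (completion_fun F) n X Z (Sub (completion (FDom F)) X Y Z n g fs)
        = enc (map (FHom F (n * rk X) (bs X) (bs Z)) (dec (Sub (completion (FDom F)) X Y Z n g fs)))"
      using a L.Sub_in[of X Y Z g m fs n] by (simp del: completion_simps(5))
    also have "\<dots> = enc (map (\<lambda>h. Sub (FCod F) (FObj F (bs X)) (FObj F (bs Y)) (FObj F (bs Z)) (n * rk X) h
        (map (FHom F (n * rk X) (bs X) (bs Y)) (concat (map dec fs)))) (map (FHom F (m * rk Y) (bs Y) (bs Z)) (dec g)))"
      using a completion_Tup_concat[of fs "FDom F" m n X Y] by (auto intro!: F.FHom_Sub dest: Tup_memD)
    finally show "FHom (completion_fun F) n X Z (Sub (FDom (completion_fun F)) X Y Z n g fs)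
        = Sub (FCod (completion_fun F)) (FObj (completion_fun F) X) (FObj (completion_fun F) Y) (FObj (completion_fun F) Z) n
            (FHom (completion_fun F) m Y Z g) (map (FHom (completion_fun F) n X Y) fs)"
      using a unfolding completion_fun_simps(1,2) completion_simps(5)[of "FCod F"] cs by simp
  qed
qed

lemma completion_fun_id:
  assumes "is_fset_category M" shows "completion_fun (fset_id M) = fset_id (completion M)"
proof -
  have "map (FHom (fset_id M) n X Y) fs = fs" if "X \<in> Obj M" "Y \<in> Obj M" "fs \<in> Tup M m n X Y" for m n X Y fs
    using that by (auto intro!: map_idI dest: Tup_memD)
  then show ?thesis
    using assms by (intro fset_fun_eqI completion_fun_functor fset_id_functor completion_category') simp_all
qed

lemma completion_fun_comp:
  assumes "is_fset_functor F" "is_fset_functor G" "FDom G = FCod F"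
  shows "completion_fun (fset_comp G F) = fset_comp (completion_fun G) (completion_fun F)"
proof -
  interpret F: is_fset_functor F by fact
  show ?thesis
    using assms by (intro fset_fun_eqI completion_fun_functor fset_comp_functor)
      (auto simp: F.FObj_in F.FHom_Tup dest: Tup_memD)
qed

text \<open>In rank 1 every block has length 1: \<open>block 1 n\<close> changes nothing, and
  concatenating one-entry tuples returns the original tuple.\<close>

lemma eta_functor:
  assumes "is_fset_category M" shows "is_fset_functor (eta M)"
proof -
  interpret is_fset_category M by fact
  show ?thesis
  proof (rule is_fset_functor.intro)
    fix X Y Z g m n fs
    assume a: "X \<in> Obj (FDom (eta M))" "Y \<in> Obj (FDom (eta M))" "Z \<in> Obj (FDom (eta M))"
      "g \<in> Hom (FDom (eta M)) m Y Z" "fs \<in> Tup (FDom (eta M)) m n X Y"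
    have "map dec (map (FHom (eta M) n X Y) fs) = map (\<lambda>f. [f]) fs"
      using a by (auto dest: Tup_memD)
    then have cs: "concat (map dec (map (FHom (eta M) n X Y) fs)) = fs" by (simp only: concat_map_singleton list.map_ident)
    show "FHom (eta M) n X Z (Sub (FDom (eta M)) X Y Z n g fs)
        = Sub (FCod (eta M)) (FObj (eta M) X) (FObj (eta M) Y) (FObj (eta M) Z) n
            (FHom (eta M) m Y Z g) (map (FHom (eta M) n X Y) fs)"
      unfolding eta_simps(2) completion_simps(5) cs using a by (simp add: Sub_in)
  qed (use assms in \<open>auto simp: completion_category' Act_in block_1 Unt_in Prjs_1\<close>, auto simp: eta_def)
qed

text \<open>An equality and not merely an isomorphism, because both composites code the same
  one-entry tuple and all categories share the coding \<open>ob\<close> and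
  \<open>enc\<close>.\<close>

lemma eta_natural:
  assumes "is_fset_functor F"
  shows "fset_comp (completion_fun F) (eta (FDom F)) = fset_comp (eta (FCod F)) F"
proof -
  interpret F: is_fset_functor F by fact
  show ?thesis
    using assms by (intro fset_fun_eqI completion_fun_functor fset_comp_functor eta_functor F.FDom_cat F.FCod_cat)
      (auto simp: F.FObj_in F.FHom_in)
qed

end

context encoded_category
begin

lemma Sub_Prjs_map: "\<lbrakk>X \<in> Obj M; Y \<in> Obj M; fs \<in> Tup M m n X Y\<rbrakk> \<Longrightarrow> map (\<lambda>h. Sub M X X Y n h (Prjs M X n)) fs = fs"
  by (auto intro!: map_idI M.Sub_Prjs dest: Tup_memD)

text \<open>One tuple plays both parts: coded as a whole, the projections of \<open>bs A\<close> in
  degree \<open>rk A\<close> form \<open>i\<close>; coded one at a time, they form the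
  \<open>p\<^sub>j\<close>. The spread of the \<open>p\<^sub>j\<close> decodes to all projections of
  degree \<open>k * rk A\<close>, and so the tuple that generates \<open>f\<close> is just
  \<open>dec f\<close>.\<close>

lemma eta_split_generated:
  "split_generated (eta M) rk bs (\<lambda>A. enc (Prjs M (bs A) (rk A)))
    (\<lambda>A. map (\<lambda>h. enc [h]) (Prjs M (bs A) (rk A)))"
proof -
  interpret J: is_fset_functor "eta M" by (rule eta_functor) (rule M.is_fset_category_axioms)
  interpret L: is_fset_category "completion M" by (rule completion_category)
  show ?thesis
  proof unfold_locales
    fix A assume "A \<in> Obj (FCod (eta M))"
    then have A: "bs A \<in> Obj M" by simp
    then show "bs A \<in> Obj (FDom (eta M))" by simp
    have cs: "concat (map (dec \<circ> (\<lambda>h. enc [h])) (Prjs M (bs A) (rk A))) = Prjs M (bs A) (rk A)"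
      by (simp add: comp_def)
    have ps: "map (\<lambda>h. enc [h]) (Prjs M (bs A) (rk A)) \<in> Tup (completion M) (rk A) 1 A (ob 1 (bs A))"
      using M.Prjs_in[OF A] by (auto intro!: Tup_map)
    have pj: "Sub (completion M) (ob 1 (bs A)) A (ob 1 (bs A)) (rk A) (map (\<lambda>h. enc [h]) (Prjs M (bs A) (rk A)) ! j)
          [enc (Prjs M (bs A) (rk A))] = Prj (completion M) (ob 1 (bs A)) (rk A) j" if "j < rk A" for j
      using that A M.Sub_Prjs[OF A A M.Prj_in[OF A that]]
      by (intro dec_eqI) (simp add: dec_Prj Prjs_def)
    show "splits (FCod (eta M)) (rk A) (FObj (eta M) (bs A)) A (enc (Prjs M (bs A) (rk A)))
        (map (\<lambda>h. enc [h]) (Prjs M (bs A) (rk A)))"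
      using A ps pj M.Prjs_in[OF A] Sub_Prjs_map[OF A A M.Prjs_in[OF A]]
      by (simp add: splits_def cs)
  next
    fix A B f k assume "A \<in> Obj (FCod (eta M))" "B \<in> Obj (FCod (eta M))" "f \<in> Hom (FCod (eta M)) k A B"
    then have A: "bs A \<in> Obj M" and B: "bs B \<in> Obj M" and f: "dec f \<in> Tup M (rk B) (k * rk A) (bs A) (bs B)" by auto
    let ?ps = "map (\<lambda>h. enc [h]) (Prjs M (bs A) (rk A))"
    let ?sp = "spread (completion M) (rk A) (ob 1 (bs A)) A ?ps k"
    have entry: "dec (?sp ! i) = [Prj M (bs A) (k * rk A) i]" if i: "i < k * rk A" for i
    proof -
      note dm = div_mod_less[OF i]
      have "map (\<lambda>j. Prj M (bs A) (k * rk A) (i div rk A * rk A + j)) [0..<rk A] \<in> Tup M (rk A) (k * rk A) (bs A) (bs A)"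
        using block_index_less[OF dm(1)] A by (intro Tup_map_upt M.Prj_in)
      then show ?thesis
        using i dm A M.Sub_Prj[of "bs A" "bs A" _ "rk A" "k * rk A" "i mod rk A"]
        by (simp add: L.spread_nth dec_Prj) (simp add: Prjs_def)
    qed
    have "map dec ?sp = map (\<lambda>i. [Prj M (bs A) (k * rk A) i]) [0..<k * rk A]"
      using entry by (intro nth_equalityI) (auto simp: spread_def)
    then have sp: "concat (map dec ?sp) = Prjs M (bs A) (k * rk A)" by (simp add: Prjs_def)
    have "Sub (completion M) A (ob 1 (bs A)) (ob 1 (bs B)) k (FHom (eta M) (k * rk A) (bs A) (bs B) h) ?sp = enc [h]"
      if "h \<in> set (dec f)" for h
      using A B Tup_memD[OF f that] by (simp add: sp M.Sub_Prjs)
    then have gs: "map (\<lambda>h. Sub (completion M) A (ob 1 (bs A)) (ob 1 (bs B)) k (FHom (eta M) (k * rk A) (bs A) (bs B) h) ?sp) (dec f)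
        = map (\<lambda>h. enc [h]) (dec f)" by (rule map_cong[OF refl])
    have "f = Sub (completion M) A (ob 1 (bs B)) B k (enc (Prjs M (bs B) (rk B))) (map (\<lambda>h. enc [h]) (dec f))"
      using A B f M.Sub_Prj_map[OF A B f] by (intro dec_eqI) (simp add: comp_def)
    then have "f = Sub (completion M) A (ob 1 (bs B)) B k (enc (Prjs M (bs B) (rk B)))
      (map (\<lambda>h. Sub (completion M) A (ob 1 (bs A)) (ob 1 (bs B)) k (FHom (eta M) (k * rk A) (bs A) (bs B) h) ?sp) (dec f))"
      unfolding gs .
    then show "\<exists>hs\<in>Tup (FDom (eta M)) (rk B) (k * rk A) (bs A) (bs B).
        f = Sub (FCod (eta M)) A (FObj (eta M) (bs B)) B k (enc (Prjs M (bs B) (rk B)))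
          (map (\<lambda>h. Sub (FCod (eta M)) A (FObj (eta M) (bs A)) (FObj (eta M) (bs B)) k
            (FHom (eta M) (k * rk A) (bs A) (bs B) h)
            (spread (FCod (eta M)) (rk A) (FObj (eta M) (bs A)) A ?ps k)) hs)"
      using A B f by (intro bexI[of _ "dec f"]) (simp_all del: completion_simps)
  next
    fix X assume "X \<in> Obj (FDom (eta M))"
    then show "bs (FObj (eta M) X) = X \<and> enc (Prjs M (bs (FObj (eta M) X)) (rk (FObj (eta M) X))) = Unt (FCod (eta M)) (FObj (eta M) X) \<and>
      map (\<lambda>h. enc [h]) (Prjs M (bs (FObj (eta M) X)) (rk (FObj (eta M) X))) = [Unt (FCod (eta M)) (FObj (eta M) X)] \<and>
      rk (FObj (eta M) X) = 1"
      by (simp add: M.Prjs_1)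
  qed
qed

text \<open>The extension copies the decomposition \<open>generated\<close>, with \<open>eta\<close>
  replaced by \<open>h\<close> and the splittings by chosen ones in \<open>N\<close>. Its laws come
  from those of the spread: \<open>spread_1\<close> for units, \<open>spread_Act\<close> for
  reindexing, \<open>spread_Sub\<close> for substitution.\<close>

lemma eta_ess_surj:
  assumes h: "h \<in> hom1 FSetCAT M N" and N: "representable N"
  shows "\<exists>F\<in>hom1 FSetCAT (completion M) N. \<exists>s. iso2 FSetCAT (fset_comp F (eta M)) h s"
proof -
  interpret h: is_fset_functor h using h by (simp add: hom1_FSetCAT)
  have hD: "FDom h = M" "FCod h = N" using h by (auto simp: hom1_FSetCAT)
  interpret N: is_fset_category N using h.FCod_cat hD by simp
  interpret L: is_fset_category "completion M" by (rule completion_category)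
  note h_in = h.FObj_in[unfolded hD] and h_hom = h.FHom_in[unfolded hD]
  \<comment> \<open>From here on a chosen tensor is known only through its splitting
    equations.\<close>
  have "\<forall>A. \<exists>Z i ps. bs A \<in> Obj M \<longrightarrow> Z \<in> Obj N \<and> splits N (rk A) (FObj h (bs A)) Z i ps"
    using N h_in N.tensor_splits unfolding representable_def by meson
  then obtain Z i ps where Zs: "\<And>A. bs A \<in> Obj M \<Longrightarrow> Z A \<in> Obj N"
    and spl: "\<And>A. bs A \<in> Obj M \<Longrightarrow> splits N (rk A) (FObj h (bs A)) (Z A) (i A) (ps A)" by metis
  have i_in: "i A \<in> Hom N (rk A) (FObj h (bs A)) (Z A)" and ps_in: "ps A \<in> Tup N (rk A) 1 (Z A) (FObj h (bs A))"
    and ps_i: "j < rk A \<Longrightarrow> Sub N (FObj h (bs A)) (Z A) (FObj h (bs A)) (rk A) (ps A ! j) [i A] = Prj N (FObj h (bs A)) (rk A) j"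
    and i_ps: "Sub N (Z A) (FObj h (bs A)) (Z A) 1 (i A) (ps A) = Unt N (Z A)"
    if "bs A \<in> Obj M" for A j
    using spl[OF that] by (auto simp: splits_def)
  define sp where "sp A k = spread N (rk A) (FObj h (bs A)) (Z A) (ps A) k" for A k
  \<comment> \<open>Entry by entry, \<open>h\<close> carries a map of degree \<open>k * rk A\<close>
    between the bases into \<open>N\<close>, and the spread turns it into a map of degree
    \<open>k\<close> out of \<open>Z A\<close>.\<close>
  define tr where "tr k A B = map (\<lambda>q. Sub N (Z A) (FObj h (bs A)) (FObj h (bs B)) k (FHom h (k * rk A) (bs A) (bs B) q) (sp A k))"
    for k A B
  define E1 where "E1 k A B f = Sub N (Z A) (FObj h (bs B)) (Z B) k (i B) (tr k A B (dec f))" for k A B f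
  define E where "E = \<lparr>FDom = completion M, FCod = N, FObj = (\<lambda>A\<in>Obj (completion M). Z A), FHom = FHom_restrict (completion M) E1\<rparr>"
  have E_simps [simp]: "FDom E = completion M" "FCod E = N" "bs A \<in> Obj M \<Longrightarrow> FObj E A = Z A"
    "\<lbrakk>bs A \<in> Obj M; bs B \<in> Obj M; dec f \<in> Tup M (rk B) (k * rk A) (bs A) (bs B)\<rbrakk> \<Longrightarrow> FHom E k A B f = E1 k A B f"
    for A B f k by (simp_all add: E_def)
  have sp_in: "sp A k \<in> Tup N (k * rk A) k (Z A) (FObj h (bs A))" if "bs A \<in> Obj M" for A k
    unfolding sp_def using that by (intro N.spread_in h_in Zs ps_in)
  have tr_in: "tr k A B fs \<in> Tup N m k (Z A) (FObj h (bs B))"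
    if "bs A \<in> Obj M" "bs B \<in> Obj M" "fs \<in> Tup M m (k * rk A) (bs A) (bs B)" for A B k fs m
    unfolding tr_def using that by (intro Tup_map[OF that(3)] N.Sub_in[OF _ _ _ _ sp_in] h_in Zs h_hom)
  have E1_in: "E1 k A B f \<in> Hom N k (Z A) (Z B)"
    if "bs A \<in> Obj M" "bs B \<in> Obj M" "dec f \<in> Tup M (rk B) (k * rk A) (bs A) (bs B)" for A B k f
    unfolding E1_def
    by (rule N.Sub_in[OF Zs[OF that(1)] h_in[OF that(2)] Zs[OF that(2)] i_in[OF that(2)] tr_in[OF that]])
  have E: "is_fset_functor E"
  proof (rule is_fset_functor.intro)
    fix X assume "X \<in> Obj (FDom E)"
    then have X: "bs X \<in> Obj M" by simp
    have "map (\<lambda>q. Sub N (Z X) (FObj h (bs X)) (FObj h (bs X)) 1 q (ps X)) (Prjs N (FObj h (bs X)) (rk X)) = ps X"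
      by (rule N.Sub_Prj_map[OF Zs[OF X] h_in[OF X] ps_in[OF X]])
    moreover have "tr 1 X X (Prjs M (bs X) (rk X)) = map (\<lambda>q. Sub N (Z X) (FObj h (bs X)) (FObj h (bs X)) 1 q (sp X 1))
        (map (FHom h (rk X) (bs X) (bs X)) (Prjs M (bs X) (rk X)))" by (simp add: tr_def)
    ultimately have "tr 1 X X (Prjs M (bs X) (rk X)) = ps X"
      using h.FHom_Prjs[of "bs X" "rk X"] X N.spread_1[OF h_in[OF X] Zs[OF X] ps_in[OF X]]
      by (simp add: sp_def hD del: map_map)
    then show "FHom E 1 X X (Unt (FDom E) X) = Unt (FCod E) (FObj E X)"
      using X M.Prjs_in[OF X] by (simp add: E1_def i_ps)
  next
    fix X Y \<phi> n m f assume "X \<in> Obj (FDom E)" "Y \<in> Obj (FDom E)" and \<phi>: "\<phi> \<in> FinMap n m" and "f \<in> Hom (FDom E) n X Y"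
    then have a: "bs X \<in> Obj M" "bs Y \<in> Obj M" "dec f \<in> Tup M (rk Y) (n * rk X) (bs X) (bs Y)" by auto
    note b = block_in[OF \<phi>, of "rk X"]
    have act: "dec (Act (completion M) X Y n m \<phi> f) \<in> Tup M (rk Y) (m * rk X) (bs X) (bs Y)"
      using L.Act_in[of X Y \<phi> n m f] a \<phi> by simp
    have "Sub N (Z X) (FObj h (bs X)) (FObj h (bs Y)) m (FHom h (m * rk X) (bs X) (bs Y) (Act M (bs X) (bs Y) (n * rk X) (m * rk X) (block (rk X) n \<phi>) q)) (sp X m)
      = Act N (Z X) (FObj h (bs Y)) n m \<phi> (Sub N (Z X) (FObj h (bs X)) (FObj h (bs Y)) n (FHom h (n * rk X) (bs X) (bs Y) q) (sp X n))"
      if "q \<in> set (dec f)" for q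
    proof -
      note q = Tup_memD[OF a(3) that]
      have "FHom h (m * rk X) (bs X) (bs Y) (Act M (bs X) (bs Y) (n * rk X) (m * rk X) (block (rk X) n \<phi>) q)
        = Act N (FObj h (bs X)) (FObj h (bs Y)) (n * rk X) (m * rk X) (block (rk X) n \<phi>) (FHom h (n * rk X) (bs X) (bs Y) q)"
        using h.FHom_natural[unfolded hD, OF a(1,2) b q] .
      moreover have "map (\<lambda>j. sp X m ! block (rk X) n \<phi> j) [0..<n * rk X] = map (Act N (Z X) (FObj h (bs X)) n m \<phi>) (sp X n)"
        unfolding sp_def by (rule N.spread_Act[OF h_in[OF a(1)] Zs[OF a(1)] ps_in[OF a(1)] \<phi>])
      ultimately show ?thesis
        using N.Sub_dinatural[OF Zs[OF a(1)] h_in[OF a(1)] h_in[OF a(2)] b h_hom[OF a(1,2) q] sp_in[OF a(1)]]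
          N.Sub_natural[OF Zs[OF a(1)] h_in[OF a(1)] h_in[OF a(2)] \<phi> h_hom[OF a(1,2) q] sp_in[OF a(1)]]
        by (simp del: map_map)
    qed
    then have "tr m X Y (dec (Act (completion M) X Y n m \<phi> f)) = map (Act N (Z X) (FObj h (bs Y)) n m \<phi>) (tr n X Y (dec f))"
      by (simp add: tr_def)
    then show "FHom E m X Y (Act (FDom E) X Y n m \<phi> f) = Act (FCod E) (FObj E X) (FObj E Y) n m \<phi> (FHom E n X Y f)"
      using a act N.Sub_natural[OF Zs[OF a(1)] h_in[OF a(2)] Zs[OF a(2)] \<phi> i_in[OF a(2)] tr_in[OF a]]
      by (simp add: E1_def del: completion_simps)
  next
    fix X Y W g m n fs
    assume "X \<in> Obj (FDom E)" "Y \<in> Obj (FDom E)" "W \<in> Obj (FDom E)"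
      "g \<in> Hom (FDom E) m Y W" "fs \<in> Tup (FDom E) m n X Y"
    then have X: "bs X \<in> Obj M" and Y: "bs Y \<in> Obj M" and W: "bs W \<in> Obj M"
      and g: "dec g \<in> Tup M (rk W) (m * rk Y) (bs Y) (bs W)" and fs: "fs \<in> Tup (completion M) m n X Y" by auto
    let ?hX = "FObj h (bs X)" and ?hY = "FObj h (bs Y)" and ?hW = "FObj h (bs W)"
    let ?cs = "concat (map dec fs)"
    let ?ws = "map (E1 n X Y) fs"
    note cs = completion_Tup_concat[OF fs]
    have f: "dec f \<in> Tup M (rk Y) (n * rk X) (bs X) (bs Y)" if "f \<in> set fs" for f
      using Tup_memD[OF fs that] by simp
    have ws: "?ws \<in> Tup N m n (Z X) (Z Y)"
      using X Y by (auto intro!: Tup_map[OF fs] E1_in)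
    have E_fs: "map (FHom E n X Y) fs = ?ws" using X Y f by simp
    \<comment> \<open>Between the two factors of a composite stands the injection \<open>i Y\<close>
      followed by its projections \<open>ps Y\<close>; they cancel and leave the concatenation by
      which the completion composes.\<close>
    have key: "map (\<lambda>s. Sub N (Z X) (Z Y) ?hY n s ?ws) (sp Y m) = tr n X Y ?cs"
    proof -
      have "map (\<lambda>s. Sub N (Z X) (Z Y) ?hY n s (map (Sub N (Z X) ?hY (Z Y) n (i Y)) (map (\<lambda>f. tr n X Y (dec f)) fs)))
          (spread N (rk Y) ?hY (Z Y) (ps Y) (length (map (\<lambda>f. tr n X Y (dec f)) fs))) = concat (map (\<lambda>f. tr n X Y (dec f)) fs)"
        using tr_in[OF X Y f] by (intro N.spread_Sub Zs X Y h_in spl) auto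
      then show ?thesis
        using Tup_length[OF fs] by (simp add: sp_def E1_def[abs_def] comp_def tr_def map_concat)
    qed
    have "Sub N (Z X) ?hX ?hW n (FHom h (n * rk X) (bs X) (bs W) (Sub M (bs X) (bs Y) (bs W) (n * rk X) q ?cs)) (sp X n)
      = Sub N (Z X) (Z Y) ?hW n (Sub N (Z Y) ?hY ?hW m (FHom h (m * rk Y) (bs Y) (bs W) q) (sp Y m)) ?ws"
      if "q \<in> set (dec g)" for q
    proof -
      note q = Tup_memD[OF g that]
      note hq = h_hom[OF Y W q]
      have hcs: "map (FHom h (n * rk X) (bs X) (bs Y)) ?cs \<in> Tup N (m * rk Y) (n * rk X) ?hX ?hY"
        using h.FHom_Tup[unfolded hD, OF X Y cs] .
      have "Sub N (Z X) ?hX ?hW n (FHom h (n * rk X) (bs X) (bs W) (Sub M (bs X) (bs Y) (bs W) (n * rk X) q ?cs)) (sp X n)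
        = Sub N (Z X) ?hX ?hW n (Sub N ?hX ?hY ?hW (n * rk X) (FHom h (m * rk Y) (bs Y) (bs W) q)
            (map (FHom h (n * rk X) (bs X) (bs Y)) ?cs)) (sp X n)"
        by (simp add: h.FHom_Sub[unfolded hD, OF X Y W q cs])
      also have "\<dots> = Sub N (Z X) ?hY ?hW n (FHom h (m * rk Y) (bs Y) (bs W) q) (tr n X Y ?cs)"
        using N.Sub_assoc[OF Zs[OF X] h_in[OF X] h_in[OF Y] h_in[OF W] hq hcs sp_in[OF X]]
        by (simp add: tr_def comp_def)
      also have "\<dots> = Sub N (Z X) (Z Y) ?hW n (Sub N (Z Y) ?hY ?hW m (FHom h (m * rk Y) (bs Y) (bs W) q) (sp Y m)) ?ws"
        unfolding key[symmetric]
        by (rule N.Sub_assoc[OF Zs[OF X] Zs[OF Y] h_in[OF Y] h_in[OF W] hq sp_in[OF Y] ws])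
      finally show ?thesis .
    qed
    then have "tr n X W (dec (Sub (completion M) X Y W n g fs)) = map (\<lambda>v. Sub N (Z X) (Z Y) ?hW n v ?ws) (tr m Y W (dec g))"
      by (simp add: tr_def)
    moreover have "dec (Sub (completion M) X Y W n g fs) \<in> Tup M (rk W) (n * rk X) (bs X) (bs W)"
      using L.Sub_in[of X Y W g m fs n] X Y W g fs by simp
    ultimately show "FHom E n X W (Sub (FDom E) X Y W n g fs)
        = Sub (FCod E) (FObj E X) (FObj E Y) (FObj E W) n (FHom E m Y W g) (map (FHom E n X Y) fs)"
      using X Y W g N.Sub_assoc[OF Zs[OF X] Zs[OF Y] h_in[OF W] Zs[OF W] i_in[OF W] tr_in[OF Y W g] ws]
      unfolding E_fs by (simp add: E1_def del: completion_simps(5) map_map)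
  qed (use Zs E1_in L.is_fset_category_axioms N.is_fset_category_axioms in auto, simp_all add: E_def)
  let ?E = "fset_comp E (eta M)"
  have E\<eta>: "is_fset_functor ?E"
    using E by (intro fset_comp_functor eta_functor M.is_fset_category_axioms) auto
  \<comment> \<open>A splitting of rank 1 has a single projection, and its equations say that this
    projection is inverse to \<open>i\<close>. It is thus the isomorphism from the chosen tensor of
    rank 1 back to the value of \<open>h\<close>.\<close>
  define p where "p X = ps (ob 1 X) ! 0" for X
  define s where "s = \<lparr>TDom = ?E, TCod = h, TAt = (\<lambda>X\<in>Obj M. p X)\<rparr>"
  have p_in: "p X \<in> Hom N 1 (Z (ob 1 X)) (FObj h X)" and ps_eq: "ps (ob 1 X) = [p X]" if "X \<in> Obj M" for X
    using Tup_nth[OF ps_in[of "ob 1 X"], of 0] Tup_length[OF ps_in[of "ob 1 X"]] that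
    by (auto simp: p_def One_nat_def length_Suc_conv)
  have "is_fset_transformation ?E h (\<lambda>X\<in>Obj M. p X)"
  proof (rule is_fset_transformation.intro)
    fix X Y f n assume "X \<in> Obj (FDom ?E)" "Y \<in> Obj (FDom ?E)" "f \<in> Hom (FDom ?E) n X Y"
    then have a: "X \<in> Obj M" "Y \<in> Obj M" "f \<in> Hom M n X Y" by auto
    let ?Z = "Z (ob 1 X)" and ?q = "Sub N (Z (ob 1 X)) (FObj h X) (FObj h Y) n (FHom h n X Y f) (sp (ob 1 X) n)"
    have bX: "bs (ob 1 X) \<in> Obj M" "bs (ob 1 Y) \<in> Obj M" using a by auto
    have q: "?q \<in> Hom N n ?Z (FObj h Y)"
      using N.Sub_in[OF Zs[OF bX(1)] h_in[OF a(1)] h_in[OF a(2)] h_hom[OF a]] sp_in[OF bX(1), of n] by simp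
    \<comment> \<open>On a one-entry tuple the extension is \<open>i (ob 1 Y)\<close> after
      \<open>?q\<close>. The projection \<open>p Y\<close> removes \<open>i (ob 1 Y)\<close>, and
      \<open>?q\<close> is the image of \<open>f\<close> under \<open>h\<close> at the spread, whose
      entries are \<open>p X \<circ> \<pi>\<^sub>j\<close>.\<close>
    have "Sub N ?Z (Z (ob 1 Y)) (FObj h Y) n (p Y) [Sub N ?Z (FObj h Y) (Z (ob 1 Y)) n (i (ob 1 Y)) [?q]]
      = Sub N ?Z (FObj h Y) (FObj h Y) n (Sub N (FObj h Y) (Z (ob 1 Y)) (FObj h Y) 1 (p Y) [i (ob 1 Y)]) [?q]"
      using i_in[OF bX(2)] Zs[OF bX(1)] Zs[OF bX(2)] h_in a p_in q by (intro N.Sub_assoc11) auto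
    also have "\<dots> = ?q"
      using ps_i[OF bX(2), of 0] a q Zs[OF bX(1)] h_in by (simp add: p_def N.Prj_Unt N.Sub_Unt)
    also have "\<dots> = Sub N ?Z (FObj h X) (FObj h Y) n (FHom h n X Y f) (map (\<lambda>r. Sub N ?Z ?Z (FObj h X) n (p X) [r]) (Prjs N ?Z n))"
      using a by (simp add: sp_def spread_def ps_eq Prjs_def comp_def)
    finally show "Sub (FCod ?E) (FObj ?E X) (FObj ?E Y) (FObj h Y) n ((\<lambda>X\<in>Obj M. p X) Y) [FHom ?E n X Y f]
       = Sub (FCod ?E) (FObj ?E X) (FObj h X) (FObj h Y) n (FHom h n X Y f)
          (map (\<lambda>r. Sub (FCod ?E) (FObj ?E X) (FObj ?E X) (FObj h X) n ((\<lambda>X\<in>Obj M. p X) X) [r]) (Prjs (FCod ?E) (FObj ?E X) n))"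
      using a by (simp add: E1_def tr_def)
  qed (use E\<eta> h.is_fset_functor_axioms p_in in \<open>auto simp: hD\<close>)
  then have s_in: "s \<in> hom2 FSetCAT ?E h" by (simp add: s_def hom2_FSetCAT)
  have "iso2 FSetCAT ?E h s"
  proof (rule iso2I[OF s_in, of "\<lambda>X. i (ob 1 X)"])
    fix X assume "X \<in> Obj (FDom ?E)"
    then have X: "X \<in> Obj M" by simp
    then show "i (ob 1 X) \<in> Hom (FCod ?E) 1 (FObj h X) (FObj ?E X)"
      "Sub (FCod ?E) (FObj ?E X) (FObj h X) (FObj ?E X) 1 (i (ob 1 X)) [TAt s X] = Unt (FCod ?E) (FObj ?E X)"
      "Sub (FCod ?E) (FObj h X) (FObj ?E X) (FObj h X) 1 (TAt s X) [i (ob 1 X)] = Unt (FCod ?E) (FObj h X)"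
      using i_in[of "ob 1 X"] i_ps[of "ob 1 X"] ps_i[of "ob 1 X" 0] h_in[OF X]
      by (simp_all add: s_def ps_eq N.Prj_Unt)
  qed
  moreover have "E \<in> hom1 FSetCAT (completion M) N" using E by (simp add: hom1_FSetCAT)
  ultimately show ?thesis by blast
qed

end

lemma (in encoding) FSetCAT_strict_reflection:
  "strict_reflection FSetCAT {M. representable M} completion completion_fun eta"
proof (rule strict_reflection.intro[OF FSetCAT_two_category], rule strict_reflection_axioms.intro)
  fix A :: "('o, 'a) fset_cat" assume "A \<in> Cell0 FSetCAT"
  then have A: "is_fset_category A" by simp
  then interpret A: encoded_category enc dec ob rk bs A by (rule encoded_categoryI)
  show "completion A \<in> Cell0 FSetCAT \<inter> {M. representable M}"
    by (simp add: A.completion_category A.completion_representable)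
  show "completion_fun (Id1 FSetCAT A) = Id1 FSetCAT (completion A)" using A by (simp add: completion_fun_id)
  show "eta A \<in> hom1 FSetCAT A (completion A)" using A by (simp add: hom1_FSetCAT eta_functor)
  fix B :: "('o, 'a) fset_cat" assume B: "B \<in> Cell0 FSetCAT \<inter> {M. representable M}"
  interpret J: split_generated "eta A" rk bs "\<lambda>X. enc (Prjs A (bs X) (rk X))" "\<lambda>X. map (\<lambda>h. enc [h]) (Prjs A (bs X) (rk X))"
    by (rule A.eta_split_generated)
  show "bij_betw (\<lambda>s. s \<star>\<^bsub>FSetCAT\<^esub> Id2 FSetCAT (eta A)) (hom2 FSetCAT f g)
      (hom2 FSetCAT (f \<odot>\<^bsub>FSetCAT\<^esub> eta A) (g \<odot>\<^bsub>FSetCAT\<^esub> eta A))"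
    if "f \<in> hom1 FSetCAT (completion A) B" "g \<in> hom1 FSetCAT (completion A) B" for f g
    using J.full_faithful[of f B g] that by simp
  show "\<exists>f\<in>hom1 FSetCAT (completion A) B. \<exists>s. iso2 FSetCAT (f \<odot>\<^bsub>FSetCAT\<^esub> eta A) h s"
    if "h \<in> hom1 FSetCAT A B" for h
    using A.eta_ess_surj[OF that] B by simp
next
  fix f and A B :: "('o, 'a) fset_cat" assume "f \<in> hom1 FSetCAT A B"
  then have f: "is_fset_functor f" "FDom f = A" "FCod f = B" by (auto simp: hom1_FSetCAT)
  then show "completion_fun f \<in> hom1 FSetCAT (completion A) (completion B)" "completion_fun f \<odot>\<^bsub>FSetCAT\<^esub> eta A = eta B \<odot>\<^bsub>FSetCAT\<^esub> f"
    using eta_natural[OF f(1)] by (auto simp: hom1_FSetCAT completion_fun_functor)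
  fix g and D :: "('o, 'a) fset_cat" assume "g \<in> hom1 FSetCAT B D"
  with f show "completion_fun (g \<odot>\<^bsub>FSetCAT\<^esub> f) = completion_fun g \<odot>\<^bsub>FSetCAT\<^esub> completion_fun f"
    by (auto simp: hom1_FSetCAT completion_fun_comp)
qed

theorem proposition5p2:
  assumes "infinite (UNIV :: 'o set)" and "infinite (UNIV :: 'a set)"
  shows "\<exists>L. is_left_biadjoint
    (FSetCAT :: (('o, 'a) fset_cat, ('o, 'a) fset_fun, ('o, 'a) fset_tr) two_cat)
    FSetCAT_rep L (inclusion FSetCAT_rep)"
proof -
  obtain enc :: "'a list \<Rightarrow> 'a" where enc: "bij enc" using infinite_list_bij[OF assms(2)] by blast
  obtain ob :: "nat \<times> 'o \<Rightarrow> 'o" where ob: "bij ob" using infinite_nat_Times_bij[OF assms(1)] by blast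
  \<comment> \<open>Rank and base are the two components of the decoded object. The coding is chosen
    before any category is given and so serves all of them.\<close>
  interpret encoding enc "inv enc" "\<lambda>n X. ob (n, X)" "\<lambda>A. fst (inv ob A)" "\<lambda>A. snd (inv ob A)"
    using enc ob by unfold_locales (simp_all add: bij_is_inj bij_is_surj surj_f_inv_f)
  interpret strict_reflection FSetCAT "{M. representable M}" completion completion_fun eta
    by (rule FSetCAT_strict_reflection)
  show ?thesis
    unfolding FSetCAT_rep_def using reflector_left_biadjoint by blast
qed

end
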